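(* Let $G=(V,E)$ be a random power law graph on $n$ vertices with average degree $\nu>1$ and exponent $2<\beta<3$. Let $K=\sqrt n$ if $2.5\le\beta\le 3$ and $K=n^{\frac{1}{(4-\beta)(\beta-1)}}$ if $2<\beta<2.5$. Let $H$ be the number of vertices of degree at least $K$, and let $x_1,\dots,x_n$ be any ordering of $V$ by degree in non-increasing order. For each $x_i$ let $l_i$ be the smallest integer such that the number of edges between $N_{l_i-1}(x_i)$ and $V\setminus N_{l_i-1}(x_i)$ is at least $\delta n^{(\beta-2)/(\beta-1)}$, where $\delta=4\nu\log^2 n$. Then the ApproximatePruning algorithm with ordering $x_1,\dots,x_n$, parameter $H$ and radii $\{l_i\}_{i=H+1}^n$ outputs a 2-hop cover with high probability. Moreover, the maximum number of landmarks used by any vertex is at most $O\big(\max(n^{\frac{\beta-2}{\beta-1}},n^{\frac{3-\beta}{4-\beta}})\log^3 n\big)$.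
   Context: Random power law graph: for $x_{\min}>0$, $\beta>2$, let $f(t)=Zt^{-\beta}$ on $[x_{\min},\infty)$, $Z=(\beta-1)x_{\min}^{\beta-1}$, with mean $\nu$ (the average degree). Each vertex gets an independent weight $p_x\sim f$; given the weights, each pair of distinct vertices $x,y$ is an edge independently with probability $\min\{p_xp_y/\mathrm{vol}(V),1\}$, $\mathrm{vol}(V)=\sum_x p_x$. $\mathrm{dist}$ is shortest-path distance, $d_v$ the degree, $N_l(x)=\{y:\mathrm{dist}(x,y)\le l\}$. ApproximatePruning (undirected version) with ordering $x_1,\dots,x_n$, integer $H$ and radii $l_{H+1},\dots,l_n$: initialize $L(v)=\emptyset$ for all $v$ and $O=\emptyset$. For $i=1,\dots,H$, run a pruned BFS from $x_i$: keep a priority queue initialized with $x_i$ at priority $0$; repeatedly extract a not-yet-extracted vertex $u$ of minimum priority $\ell$; let $\tilde d=\min_{z\in L(x_i)\cap L(u)}(\mathrm{dist}(x_i,z)+\mathrm{dist}(z,u))$ ($\infty$ if empty); if $\ell<\tilde d$, add $x_i$ (with value $\ell$) to $L(u)$ and, for each neighbor $y\notin O$ of $u$ not yet extracted, lower its priority to $\ell+1$ if smaller (inserting if absent); otherwise $u$ is pruned. Then add $x_i$ to $O$. Afterwards, for each $i=H+1,\dots,n$, add to $L(x_i)$ every $y$ with $\mathrm{dist}(x_i,y)\le l_i-1$ and every $y$ with $\mathrm{dist}(x_i,y)=l_i$ that has a neighbor $z$ with $\mathrm{dist}(x_i,z)=l_i-1$ and $d_z\le d_y$ (each stored with its distance).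 The estimate for $x,y$ is $\min_{z\in L(x)\cap L(y)}(\mathrm{dist}(x,z)+\mathrm{dist}(z,y))$; the output is a 2-hop cover if the estimate equals $\mathrm{dist}(x,y)$ for all pairs in the same connected component. The number of landmarks used by $v$ is $|L(v)|$. "With high probability" means with probability tending to $1$ as $n\to\infty$. *)

theory Defs
  imports "HOL-Probability.Probability" "HOL-Library.Extended_Nat"
begin

text \<open>A graph is given by a symmetric irreflexive adjacency predicate E on nat,
  with vertex set V = {..<n}.\<close>

definition reach_in :: "(nat \<Rightarrow> nat \<Rightarrow> bool) \<Rightarrow> nat \<Rightarrow> nat \<Rightarrow> nat \<Rightarrow> bool" where
  "reach_in E k x y \<longleftrightarrow>
     (\<exists>ps. length ps = Suc k \<and> hd ps = x \<and> last ps = y \<and> (\<forall>i<k. E (ps ! i) (ps ! Suc i)))"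

definition gdist :: "(nat \<Rightarrow> nat \<Rightarrow> bool) \<Rightarrow> nat \<Rightarrow> nat \<Rightarrow> enat" where
  "gdist E x y = (if \<exists>k. reach_in E k x y then enat (LEAST k. reach_in E k x y) else \<infinity>)"

definition deg :: "(nat \<Rightarrow> nat \<Rightarrow> bool) \<Rightarrow> nat \<Rightarrow> nat \<Rightarrow> nat" where
  "deg E n v = card {y. y < n \<and> E v y}"

definition nball :: "(nat \<Rightarrow> nat \<Rightarrow> bool) \<Rightarrow> nat \<Rightarrow> nat \<Rightarrow> nat \<Rightarrow> nat set" where
  "nball E n l x = {y. y < n \<and> gdist E x y \<le> enat l}"

definition cut_edges :: "(nat \<Rightarrow> nat \<Rightarrow> bool) \<Rightarrow> nat \<Rightarrow> nat set \<Rightarrow> nat" where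
  "cut_edges E n S = card {(u, v). u \<in> S \<and> v < n \<and> v \<notin> S \<and> E u v}"

text \<open>l_x: the smallest integer l (necessarily l \<ge> 1, since N_{l-1} is empty for l \<le> 0)
  such that the cut of N_{l-1}(x) has at least \<theta> edges.  If no such l exists
  (small components) we use the convention l = n, i.e. the vertex stores its whole component.\<close>
definition radius :: "(nat \<Rightarrow> nat \<Rightarrow> bool) \<Rightarrow> nat \<Rightarrow> real \<Rightarrow> nat \<Rightarrow> nat" where
  "radius E n \<theta> x =
     (if \<exists>l. 1 \<le> l \<and> real (cut_edges E n (nball E n (l - 1) x)) \<ge> \<theta>
      then LEAST l. 1 \<le> l \<and> real (cut_edges E n (nball E n (l - 1) x)) \<ge> \<theta>
      else n)"

text \<open>A labelling maps each vertex v to a set L(v) of pairs (landmark, stored distance).\<close>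
type_synonym labels = "nat \<Rightarrow> (nat \<times> nat) set"

definition label_est :: "labels \<Rightarrow> nat \<Rightarrow> nat \<Rightarrow> enat" where
  "label_est L a b = \<Sqinter> {enat (d1 + d2) | z d1 d2. (z, d1) \<in> L a \<and> (z, d2) \<in> L b}"

text \<open>One extraction step of the pruned BFS from root r, with already-processed roots Ov.
  State: (priorities Q, extracted set X, labels L).  Ties among equal priorities are broken
  by smallest vertex number.\<close>
definition pbfs_step :: "(nat \<Rightarrow> nat \<Rightarrow> bool) \<Rightarrow> nat \<Rightarrow> nat set \<Rightarrow> nat \<Rightarrow>
    (nat \<Rightarrow> nat option) \<times> nat set \<times> labels \<Rightarrow> (nat \<Rightarrow> nat option) \<times> nat set \<times> labels" where
  "pbfs_step E n Ov r st =
    (case st of (Q, X, L) \<Rightarrow>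
      (let P = {u. u \<notin> X \<and> Q u \<noteq> None} in
       if P = {} then (Q, X, L) else
       (let lv = Min (the ` Q ` P);
            u = (LEAST u. u \<in> P \<and> Q u = Some lv)
        in if enat lv < label_est L r u then
             ((\<lambda>y. if y < n \<and> E u y \<and> y \<notin> Ov \<and> y \<notin> X \<and> y \<noteq> u
                    then Some (case Q y of None \<Rightarrow> lv + 1 | Some q \<Rightarrow> min q (lv + 1))
                    else Q y),
              insert u X,
              L(u := insert (r, lv) (L u)))
           else (Q, insert u X, L))))"

text \<open>Pruned BFS from r: n extraction steps suffice, since each step extracts a new vertex.\<close>
definition pbfs :: "(nat \<Rightarrow> nat \<Rightarrow> bool) \<Rightarrow> nat \<Rightarrow> nat set \<Rightarrow> nat \<Rightarrow> labels \<Rightarrow> labels" where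
  "pbfs E n Ov r L =
     snd (snd ((pbfs_step E n Ov r ^^ n) (\<lambda>y. if y = r then Some 0 else None, {}, L)))"

primrec phase1 :: "(nat \<Rightarrow> nat \<Rightarrow> bool) \<Rightarrow> nat \<Rightarrow> nat list \<Rightarrow> nat set \<Rightarrow> labels \<Rightarrow> labels" where
  "phase1 E n [] Ov L = L"
| "phase1 E n (r # rs) Ov L = phase1 E n rs (insert r Ov) (pbfs E n Ov r L)"

definition phase2_labels :: "(nat \<Rightarrow> nat \<Rightarrow> bool) \<Rightarrow> nat \<Rightarrow> nat \<Rightarrow> nat \<Rightarrow> (nat \<times> nat) set" where
  "phase2_labels E n l v =
     {(y, the_enat (gdist E v y)) | y. y < n \<and> gdist E v y \<le> enat (l - 1)}
     \<union> {(y, l) | y. y < n \<and> gdist E v y = enat l \<and>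
          (\<exists>z<n. E y z \<and> gdist E v z = enat (l - 1) \<and> deg E n z \<le> deg E n y)}"

text \<open>ApproximatePruning with ordering xs (xs ! (i-1) = x_i), parameter H and radii
  rad (rad v = l_i for v = x_i).\<close>
definition approx_pruning :: "(nat \<Rightarrow> nat \<Rightarrow> bool) \<Rightarrow> nat \<Rightarrow> nat list \<Rightarrow> nat \<Rightarrow> (nat \<Rightarrow> nat) \<Rightarrow> labels" where
  "approx_pruning E n xs H rad =
     (let L1 = phase1 E n (take H xs) {} (\<lambda>_. {})
      in (\<lambda>v. if v \<in> set (drop H xs) then L1 v \<union> phase2_labels E n (rad v) v else L1 v))"

definition is_2hop_cover :: "(nat \<Rightarrow> nat \<Rightarrow> bool) \<Rightarrow> nat \<Rightarrow> labels \<Rightarrow> bool" where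
  "is_2hop_cover E n L \<longleftrightarrow>
     (\<forall>x<n. \<forall>y<n. gdist E x y \<noteq> \<infinity> \<longrightarrow> label_est L x y = gdist E x y)"

definition num_landmarks :: "labels \<Rightarrow> nat \<Rightarrow> nat" where
  "num_landmarks L v = card (fst ` L v)"

definition degree_ordering :: "(nat \<Rightarrow> nat \<Rightarrow> bool) \<Rightarrow> nat \<Rightarrow> nat list \<Rightarrow> bool" where
  "degree_ordering E n xs \<longleftrightarrow>
     distinct xs \<and> set xs = {..<n} \<and> sorted_wrt (\<lambda>a b. deg E n b \<le> deg E n a) xs"

definition plaw_density :: "real \<Rightarrow> real \<Rightarrow> real \<Rightarrow> real" where
  "plaw_density xmin \<beta> t =
     (if xmin \<le> t then (\<beta> - 1) * xmin powr (\<beta> - 1) * t powr (- \<beta>) else 0)"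

definition weight_dist :: "real \<Rightarrow> real \<Rightarrow> real measure" where
  "weight_dist xmin \<beta> = density lborel (\<lambda>t. ennreal (plaw_density xmin \<beta> t))"

text \<open>\<nu>: the mean of the weight distribution (the average degree)\<close>
definition plaw_mean :: "real \<Rightarrow> real \<Rightarrow> real" where
  "plaw_mean xmin \<beta> = integral\<^sup>L (weight_dist xmin \<beta>) (\<lambda>t. t)"

text \<open>Sample space: independent weights p_x ~ f for x < n, and independent uniform [0,1]
  variables c_{x,y} for x < y < n; the edge {x,y} is present iff
  c_{x,y} < min(p_x p_y / vol V, 1), which has the required conditional probability.\<close>
definition rplg :: "real \<Rightarrow> real \<Rightarrow> nat \<Rightarrow> ((nat \<Rightarrow> real) \<times> (nat \<times> nat \<Rightarrow> real)) measure" where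
  "rplg xmin \<beta> n =
     (PiM {..<n} (\<lambda>_. weight_dist xmin \<beta>)) \<Otimes>\<^sub>M
     (PiM {(i, j). i < j \<and> j < n} (\<lambda>_. uniform_measure lborel {0..1::real}))"

definition graph_of :: "nat \<Rightarrow> (nat \<Rightarrow> real) \<times> (nat \<times> nat \<Rightarrow> real) \<Rightarrow> nat \<Rightarrow> nat \<Rightarrow> bool" where
  "graph_of n \<omega> x y =
     (case \<omega> of (p, c) \<Rightarrow>
        x < n \<and> y < n \<and> x \<noteq> y \<and>
        c (min x y, max x y) < min (p x * p y / (\<Sum>v<n. p v)) 1)"

end

theory Submission
  imports Defs "HOL-Real_Asymp.Real_Asymp"
begin

text \<open>
  Pruned breadth-first search labels \<open>s\<close> and \<open>t\<close> with the first processed root that lies on a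
  shortest \<open>s\<close>--\<open>t\<close> path, so pairs with a shortest path through a high-degree vertex are covered.
  For the other pairs let \<open>w\<close> be a vertex of weight about \<open>n powr (1/(\<beta>-1))\<close>.  With high
  probability every vertex \<open>x\<close> whose radius \<open>l x\<close> is reached has \<open>dist x w \<le> l x\<close>: the last
  sphere has weight at least of order \<open>\<theta>\<close> and hence is adjacent to \<open>w\<close>.
  Hence \<open>dist s t \<le> l s + l t\<close>, and equality would put \<open>w\<close> on a shortest path.  So
  \<open>dist s t \<le> l s + l t - 1\<close>, and the two balls meet or are joined by an edge whose endpoint of
  larger degree is stored on both sides.

  For the size of the labels, split the vertices into light ones and heavy ones, of weight at least a
  multiple of \<open>\<theta>\<close>.  Edges between light vertices are independent of edges to heavy vertices, so with
  high probability every ball of at least \<open>\<theta>\<close> light vertices is adjacent to a heavy one, whose degree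
  alone makes the cut larger than \<open>\<theta>\<close>.  This bounds the inner balls by \<open>3 \<theta>\<close> vertices.  On
  the outer sphere, the number of neighbours of \<open>z\<close> with degree between that of \<open>z\<close> and \<open>K\<close> is
  of order \<open>p z powr (3 - \<beta>)\<close>, and the sum of these quantities over the previous sphere has mean
  of order \<open>\<theta> * K powr (5 - 2 \<beta>)\<close> up to a logarithm.

  Given the weights, events about breadth-first search are reduced to a fixed pair of consecutive
  balls \<open>A \<subseteq> B\<close>: the exploration only inspects pairs meeting \<open>A\<close>, so it is independent of the edges
  from \<open>B - A\<close> to the complement of \<open>B\<close>.
\<close>

section \<open>Distances and pruned breadth-first search\<close>

text \<open>The exponents fit because \<open>(b - 2) / (b - 1) = 1 - 1 / (b - 1)\<close>: sphere
  weight of order \<open>\<theta>\<close> times a hub weight \<open>n powr (1 / (b - 1))\<close>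
  exceeds the volume by a logarithmic factor. The largest weight has this order only up to a random
  factor, so the hub is taken lighter by \<open>sqrt (ln n)\<close>, and the squared logarithm in
  \<open>\<theta>\<close> pays for it. For \<open>b < 5/2\<close> the exponent of \<open>K\<close>
  balances the number of vertices of degree at least \<open>K\<close>, of order
  \<open>n * K powr (1 - b)\<close>, against the outer-sphere term
  \<open>\<theta> * K powr (5 - 2 * b)\<close>; up to logarithms both have order
  \<open>n powr ((3 - b) / (4 - b))\<close>. For larger \<open>b\<close> that power of
  \<open>K\<close> is at most 1, and \<open>K = sqrt n\<close> keeps the high-degree count below the
  same rate. The obstacle is that balls are chosen by the random edges, and a union bound over all
  vertex sets would be exponential. Exploration outcomes exclude each other, so conditioning on them
  costs nothing, and only order \<open>n\<close> squared events of probability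
  \<open>n powr -4\<close> remain. The weights enter through a deterministic list of conditions that
  holds with probability tending to 1.\<close>

lemma reach_in_0 [simp]: "reach_in E 0 x y \<longleftrightarrow> x = y"
proof
  assume "reach_in E 0 x y"
  then obtain ps where "length ps = Suc 0" "hd ps = x" "last ps = y"
    unfolding reach_in_def by blast
  then show "x = y" by (cases ps) auto
next
  assume "x = y"
  then show "reach_in E 0 x y" unfolding reach_in_def by (intro exI[of _ "[x]"]) auto
qed

lemma reach_in_Suc: "reach_in E (Suc k) x y \<longleftrightarrow> (\<exists>z. reach_in E k x z \<and> E z y)"
proof
  assume "reach_in E (Suc k) x y"
  then obtain ps where ps: "length ps = Suc (Suc k)" "hd ps = x" "last ps = y"
      "\<forall>i<Suc k. E (ps ! i) (ps ! Suc i)"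
    unfolding reach_in_def by blast
  then have ne: "ps \<noteq> []" "butlast ps \<noteq> []" by (auto simp flip: length_0_conv)
  have "reach_in E k x (ps ! k)"
    unfolding reach_in_def
  proof (intro exI[of _ "butlast ps"] conjI allI impI)
    show "hd (butlast ps) = x" using ne ps(1,2) by (cases ps) auto
    show "last (butlast ps) = ps ! k" using ne ps(1) by (simp add: last_conv_nth nth_butlast)
    show "E (butlast ps ! i) (butlast ps ! Suc i)" if "i < k" for i
      using ps(1,4) that by (simp add: nth_butlast)
  qed (use ps in simp)
  moreover have "E (ps ! k) y"
    using ps ne(1) by (auto simp: last_conv_nth)
  ultimately show "\<exists>z. reach_in E k x z \<and> E z y" by blast
next
  assume "\<exists>z. reach_in E k x z \<and> E z y"
  then obtain z ps where ps: "length ps = Suc k" "hd ps = x" "last ps = z"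
      "\<forall>i<k. E (ps ! i) (ps ! Suc i)" and z: "E z y"
    unfolding reach_in_def by blast
  have ne: "ps \<noteq> []" using ps(1) by auto
  show "reach_in E (Suc k) x y"
    unfolding reach_in_def
  proof (intro exI[of _ "ps @ [y]"] conjI allI impI)
    show "E ((ps @ [y]) ! i) ((ps @ [y]) ! Suc i)" if "i < Suc k" for i
    proof (cases "i = k")
      case True
      then show ?thesis using ps z ne by (auto simp: nth_append last_conv_nth)
    next
      case False
      then show ?thesis using ps that by (auto simp: nth_append)
    qed
  qed (use ps ne in auto)
qed

lemma reach_in_trans: "reach_in E i x z \<Longrightarrow> reach_in E j z y \<Longrightarrow> reach_in E (i + j) x y"
  by (induction j arbitrary: y) (auto simp: reach_in_Suc)

lemma reach_in_split: "reach_in E (i + j) x y \<Longrightarrow> \<exists>z. reach_in E i x z \<and> reach_in E j z y"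
  by (induction j arbitrary: y) (auto simp: reach_in_Suc, blast)

lemma gdist_le_iff: "gdist E x y \<le> enat l \<longleftrightarrow> (\<exists>k\<le>l. reach_in E k x y)"
proof (cases "\<exists>k. reach_in E k x y")
  case True
  then have "reach_in E (LEAST k. reach_in E k x y) x y" by (metis LeastI_ex)
  then show ?thesis using True unfolding gdist_def by (auto intro: Least_le order_trans)
qed (auto simp: gdist_def)

lemma gdist_le: "reach_in E k x y \<Longrightarrow> gdist E x y \<le> enat k"
  using gdist_le_iff by blast

lemma gdist_eq_enatD: "gdist E x y = enat k \<Longrightarrow> reach_in E k x y"
  by (metis LeastI_ex enat.distinct(2) enat.inject gdist_def)

lemma gdist_self [simp]: "gdist E x x = 0"
  by (metis gdist_le_iff reach_in_0 le_zero_eq zero_enat_def)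

lemma gdist_eq_0_iff: "gdist E x y = 0 \<longleftrightarrow> x = y"
  using gdist_eq_enatD[of E x y 0] by (auto simp: zero_enat_def[symmetric])

lemma gdist_triangle: "gdist E x y \<le> gdist E x z + gdist E z y"
proof (cases "gdist E x z = \<infinity> \<or> gdist E z y = \<infinity>")
  case False
  then obtain i j where ij: "gdist E x z = enat i" "gdist E z y = enat j" by auto
  then have "reach_in E (i + j) x y" using gdist_eq_enatD reach_in_trans by metis
  then show ?thesis using ij gdist_le by fastforce
qed auto

lemma gdist_split:
  assumes "gdist E x y = enat k" "i \<le> k"
  shows "\<exists>z. gdist E x z = enat i \<and> gdist E z y = enat (k - i)"
proof -
  obtain z where z: "reach_in E i x z" "reach_in E (k - i) z y"
    using gdist_eq_enatD[OF assms(1)] reach_in_split[of E i "k - i" x y] assms(2) by auto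
  then have le: "gdist E x z \<le> enat i" "gdist E z y \<le> enat (k - i)" by (auto intro: gdist_le)
  then obtain a b where ab: "gdist E x z = enat a" "gdist E z y = enat b"
    by (metis enat_ile)
  have "enat k \<le> gdist E x z + gdist E z y" using assms(1) gdist_triangle by metis
  then have "a = i \<and> b = k - i" using le assms(2) by (auto simp: ab)
  then show ?thesis using ab by blast
qed

lemma gdist_Suc_pred:
  assumes "gdist E x y = enat (Suc k)"
  shows "\<exists>z. gdist E x z = enat k \<and> gdist E z y = enat 1 \<and> E z y"
proof -
  obtain z where z: "gdist E x z = enat k" "gdist E z y = enat 1"
    using gdist_split[OF assms, of k] by auto
  then have "E z y" using gdist_eq_enatD[OF z(2)] by (auto simp: reach_in_Suc)
  then show ?thesis using z by blast
qed

text \<open>\<open>bfs E x i\<close> is the ball of radius \<open>i - 1\<close>, empty for \<open>i = 0\<close>.\<close>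

primrec bfs :: "(nat \<Rightarrow> nat \<Rightarrow> bool) \<Rightarrow> nat \<Rightarrow> nat \<Rightarrow> nat set" where
  "bfs E x 0 = {}"
| "bfs E x (Suc i) = insert x (bfs E x i \<union> {y. \<exists>u\<in>bfs E x i. E u y})"

lemma bfs_iff_reach: "y \<in> bfs E x i \<longleftrightarrow> (\<exists>k<i. reach_in E k x y)"
proof (induction i arbitrary: y)
  case (Suc i)
  have "y \<in> bfs E x (Suc i) \<longleftrightarrow> y = x \<or> (\<exists>k<i. reach_in E k x y) \<or> (\<exists>u. \<exists>k<i. reach_in E k x u \<and> E u y)"
    using Suc by auto
  also have "\<dots> \<longleftrightarrow> (\<exists>k<Suc i. reach_in E k x y)"
  proof
    assume "\<exists>k<Suc i. reach_in E k x y"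
    then obtain k where k: "k < Suc i" "reach_in E k x y" by blast
    then show "y = x \<or> (\<exists>k<i. reach_in E k x y) \<or> (\<exists>u. \<exists>k<i. reach_in E k x u \<and> E u y)"
      by (cases k) (auto simp: reach_in_Suc)
  next
    assume "y = x \<or> (\<exists>k<i. reach_in E k x y) \<or> (\<exists>u. \<exists>k<i. reach_in E k x u \<and> E u y)"
    then consider "y = x" | k where "k < i" "reach_in E k x y"
      | k u where "k < i" "reach_in E k x u" "E u y" by blast
    then show "\<exists>k<Suc i. reach_in E k x y"
    proof cases
      case 1 then show ?thesis by (intro exI[of _ 0]) simp
    next
      case 2 then show ?thesis by (auto intro: less_SucI)
    next
      case 3 then show ?thesis by (intro exI[of _ "Suc k"]) (auto simp: reach_in_Suc)
    qed
  qed
  finally show ?case .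
qed simp

lemma bfs_mono_Suc: "bfs E x i \<subseteq> bfs E x (Suc i)" by auto

lemma bfs_mono: "i \<le> j \<Longrightarrow> bfs E x i \<subseteq> bfs E x j"
  by (rule lift_Suc_mono_le[of "bfs E x"]) auto

lemma bfs_Suc_iff_gdist: "y \<in> bfs E x (Suc i) \<longleftrightarrow> gdist E x y \<le> enat i"
  by (auto simp: bfs_iff_reach gdist_le_iff less_Suc_eq_le simp del: bfs.simps)

locale sym_graph =
  fixes E :: "nat \<Rightarrow> nat \<Rightarrow> bool" and n :: nat
  assumes E_sym: "E x y \<Longrightarrow> E y x" and E_dom: "E x y \<Longrightarrow> x < n"
begin

lemma E_dom2: "E x y \<Longrightarrow> y < n" using E_sym E_dom by blast

lemma reach_in_sym: "reach_in E k x y \<Longrightarrow> reach_in E k y x"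
proof (induction k arbitrary: y)
  case (Suc k)
  then obtain z where "reach_in E k x z" "E z y" by (auto simp: reach_in_Suc)
  then have "reach_in E 1 y z" "reach_in E k z x" using Suc.IH E_sym by (auto simp: reach_in_Suc)
  then show ?case using reach_in_trans[of E 1 y z k x] by simp
qed simp

lemma gdist_sym: "gdist E x y = gdist E y x"
proof -
  have "reach_in E k x y = reach_in E k y x" for k using reach_in_sym by blast
  then show ?thesis unfolding gdist_def by simp
qed

lemma gdist_dom: "gdist E x y \<noteq> \<infinity> \<Longrightarrow> x < n \<Longrightarrow> y < n"
proof -
  assume "gdist E x y \<noteq> \<infinity>" "x < n"
  then obtain k where "reach_in E k x y" using gdist_eq_enatD by fastforce
  then show "y < n" using \<open>x < n\<close> by (cases k) (auto simp: reach_in_Suc dest: E_dom2)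
qed

lemma bfs_dom: "x < n \<Longrightarrow> bfs E x i \<subseteq> {..<n}"
  by (induction i) (auto dest: E_dom2)

lemma finite_bfs: "x < n \<Longrightarrow> finite (bfs E x i)"
  using bfs_dom finite_subset by blast

lemma nball_eq_bfs: "x < n \<Longrightarrow> nball E n l x = bfs E x (Suc l)"
  using bfs_dom[of x "Suc l"] by (auto simp: nball_def bfs_Suc_iff_gdist simp del: bfs.simps)

text \<open>Pigeonhole on a geodesic, whose vertices lie at pairwise different distances from
  \<open>x\<close>. This is why radius \<open>n\<close> stands for the whole component and why
  explorations need only indices below \<open>n\<close>.\<close>

lemma gdist_lt_n:
  assumes "gdist E x y = enat k" "x < n"
  shows "k < n"
proof -
  have "\<exists>z. gdist E x z = enat i" if "i \<le> k" for i
    using gdist_split[OF assms(1) that] by blast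
  then obtain f where f: "\<And>i. i \<le> k \<Longrightarrow> gdist E x (f i) = enat i" by metis
  have "inj_on f {..k}" by (rule inj_onI) (metis f atMost_iff enat.inject)
  moreover have "f ` {..k} \<subseteq> {..<n}" using f gdist_dom assms(2) by force
  ultimately have "card {..k} \<le> card {..<n}" by (metis card_inj_on_le finite_lessThan)
  then show ?thesis by simp
qed

section \<open>Pruned search: which vertices a root labels\<close>

definition on_geodesic :: "nat \<Rightarrow> nat \<Rightarrow> nat \<Rightarrow> bool" where
  "on_geodesic s t z \<longleftrightarrow> gdist E s z + gdist E z t = gdist E s t"

text \<open>The vertices that the pruned search from \<open>r\<close> avoiding \<open>Ov\<close> reaches at their true distance.\<close>

definition unblocked :: "nat set \<Rightarrow> nat \<Rightarrow> nat \<Rightarrow> bool" where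
  "unblocked Ov r u \<longleftrightarrow> gdist E r u \<noteq> \<infinity> \<and> (\<forall>z\<in>Ov. \<not> on_geodesic r u z)"

text \<open>A processed root on an \<open>r\<close>-\<open>v\<close> geodesic would also lie on the
  \<open>r\<close>-\<open>u\<close> geodesic through \<open>v\<close>. Hence unblocked vertices are
  closed under geodesic predecessors, and the pruned search reaches them by induction on the
  distance.\<close>

lemma unblocked_pred:
  assumes "unblocked Ov r u" "gdist E r v + gdist E v u = gdist E r u"
  shows "unblocked Ov r v"
proof -
  have fin: "gdist E r v \<noteq> \<infinity>" "gdist E v u \<noteq> \<infinity>"
    using assms unfolding unblocked_def by (metis plus_enat_simps(2,3))+
  have "\<not> on_geodesic r v z" if "z \<in> Ov" for z
  proof
    assume "on_geodesic r v z"
    then have "gdist E r z + gdist E z v + gdist E v u = gdist E r u"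
      using assms(2) by (simp add: on_geodesic_def)
    moreover have "gdist E z u \<le> gdist E z v + gdist E v u" by (rule gdist_triangle)
    ultimately have "gdist E r z + gdist E z u \<le> gdist E r u"
      by (metis add.assoc add_left_mono)
    then have "on_geodesic r u z" unfolding on_geodesic_def using gdist_triangle[of E r u z] by (simp add: antisym)
    then show False using assms(1) that by (simp add: unblocked_def)
  qed
  then show ?thesis using fin by (auto simp: unblocked_def)
qed

lemma unblocked_notin: "unblocked Ov r u \<Longrightarrow> u \<notin> Ov"
  by (auto simp: unblocked_def on_geodesic_def)

lemma unblocked_step:
  assumes "unblocked Ov r u" "gdist E r u = enat (Suc k)"
  shows "\<exists>v. unblocked Ov r v \<and> gdist E r v = enat k \<and> E v u"
proof -
  obtain v where v: "gdist E r v = enat k" "gdist E v u = enat 1" "E v u"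
    using gdist_Suc_pred[OF assms(2)] by blast
  then have "unblocked Ov r v" using unblocked_pred[OF assms(1), of v] assms(2) by simp
  then show ?thesis using v by blast
qed

text \<open>Priorities and stored values only bound distances from above; for blocked vertices
  nothing more is claimed. The exact statements concern unblocked vertices: once extracted, they
  carry their true distance and have pushed their neighbours outside \<open>Ov\<close>. The last
  clause counts extractions until the queue runs empty, so that \<open>n\<close> steps can be seen
  to suffice.\<close>

definition pbfs_inv :: "nat set \<Rightarrow> nat \<Rightarrow> labels \<Rightarrow> nat \<Rightarrow> (nat \<Rightarrow> nat option) \<times> nat set \<times> labels \<Rightarrow> bool" where
  "pbfs_inv Ov r L0 m st \<longleftrightarrow> (case st of (Q, X, L) \<Rightarrow>
     (\<forall>u q. Q u = Some q \<longrightarrow> u < n \<and> gdist E r u \<le> enat q) \<and>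
     Q r = Some 0 \<and>
     X \<subseteq> {u. Q u \<noteq> None} \<and>
     (\<forall>v. L0 v \<subseteq> L v) \<and>
     (\<forall>v z d. (z, d) \<in> L v \<longrightarrow> (z, d) \<in> L0 v \<or> z = r \<and> v \<in> X \<and> gdist E r v \<le> enat d) \<and>
     (\<forall>u k. unblocked Ov r u \<longrightarrow> gdist E r u = enat k \<longrightarrow> u \<in> X \<longrightarrow> (r, k) \<in> L u) \<and>
     (\<forall>u k y. unblocked Ov r u \<longrightarrow> gdist E r u = enat k \<longrightarrow> u \<in> X \<longrightarrow> E u y \<longrightarrow> y \<notin> Ov \<longrightarrow>
        y \<in> X \<or> (\<exists>q. Q y = Some q \<and> q \<le> k + 1)) \<and>
     (card X = m \<or> {u. u \<notin> X \<and> Q u \<noteq> None} = {}))"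

text \<open>The frontier argument of Dijkstra's algorithm: go back from \<open>u\<close> along
  unblocked geodesic predecessors until one is extracted; its successor was pushed with a priority
  at most its distance. If none is extracted, the walk ends at \<open>r\<close>, which has priority
  0.\<close>

lemma pbfs_inv_front:
  assumes inv: "pbfs_inv Ov r L0 m (Q, X, L)" and u: "unblocked Ov r u" "gdist E r u = enat k" "u \<notin> X"
  shows "\<exists>v q. v \<notin> X \<and> Q v = Some q \<and> q \<le> k"
  using u
proof (induction k arbitrary: u)
  case 0
  then have "u = r" using gdist_eq_0_iff zero_enat_def by metis
  then show ?case using inv 0 by (auto simp: pbfs_inv_def)
next
  case (Suc k)
  obtain v where v: "unblocked Ov r v" "gdist E r v = enat k" "E v u"
    using unblocked_step Suc.prems by blast
  show ?case
  proof (cases "v \<in> X")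
    case True
    have "u \<notin> Ov" using unblocked_notin Suc.prems by blast
    then have "\<exists>q. Q u = Some q \<and> q \<le> k + 1"
      using inv v True Suc.prems(3) unfolding pbfs_inv_def by blast
    then show ?thesis using Suc.prems(3) by auto
  next
    case False
    then show ?thesis using Suc.IH[OF v(1,2)] by (auto intro: le_SucI)
  qed
qed

lemma pbfs_inv_step:
  assumes inv: "pbfs_inv Ov r L0 m st" and r: "r < n" "r \<notin> Ov"
    and L0: "\<And>v z d. (z, d) \<in> L0 v \<Longrightarrow> z \<in> Ov \<and> gdist E z v \<le> enat d"
  shows "pbfs_inv Ov r L0 (Suc m) (pbfs_step E n Ov r st)"
proof -
  obtain Q X L where st: "st = (Q, X, L)" by (cases st)
  define P where "P = {u. u \<notin> X \<and> Q u \<noteq> None}"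
  show ?thesis
  proof (cases "P = {}")
    case True
    then have "pbfs_step E n Ov r st = st" by (simp add: pbfs_step_def st P_def)
    then show ?thesis using inv True by (auto simp: pbfs_inv_def st P_def)
  next
    case False
    have I1: "\<And>u q. Q u = Some q \<Longrightarrow> u < n \<and> gdist E r u \<le> enat q"
      and I2: "Q r = Some 0" and I3: "X \<subseteq> {u. Q u \<noteq> None}"
      and I4: "\<And>v. L0 v \<subseteq> L v"
      and I5: "\<And>v z d. (z, d) \<in> L v \<Longrightarrow> (z, d) \<in> L0 v \<or> z = r \<and> v \<in> X \<and> gdist E r v \<le> enat d"
      and I6: "\<And>u k. unblocked Ov r u \<Longrightarrow> gdist E r u = enat k \<Longrightarrow> u \<in> X \<Longrightarrow> (r, k) \<in> L u"
      and I7: "\<And>u k y. unblocked Ov r u \<Longrightarrow> gdist E r u = enat k \<Longrightarrow> u \<in> X \<Longrightarrow> E u y \<Longrightarrow> y \<notin> Ov \<Longrightarrow>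
        y \<in> X \<or> (\<exists>q. Q y = Some q \<and> q \<le> k + 1)"
      and I8: "card X = m"
      using inv False unfolding pbfs_inv_def st P_def by (auto; blast)+
    have finQ: "finite {u. Q u \<noteq> None}"
      by (rule finite_subset[of _ "{..<n}"]) (use I1 in auto)
    then have finP: "finite P" unfolding P_def by (rule rev_finite_subset) auto
    have finX: "finite X" using finQ I3 finite_subset by blast
    define lv where "lv = Min (the ` Q ` P)"
    define u where "u = (LEAST u. u \<in> P \<and> Q u = Some lv)"
    have "lv \<in> the ` Q ` P" unfolding lv_def using finP False by (intro Min_in) auto
    then have "\<exists>u. u \<in> P \<and> Q u = Some lv" by (auto simp: P_def)
    then have u: "u \<in> P" "Q u = Some lv" unfolding u_def by (metis (mono_tags, lifting) LeastI_ex)+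
    have lv_le: "lv \<le> q" if "v \<notin> X" "Q v = Some q" for v q
      unfolding lv_def using finP that by (intro Min_le) (auto simp: P_def image_iff intro!: bexI[of _ v])
    have uX: "u \<notin> X" using u(1) by (simp add: P_def)
    have un: "u < n" and lvge: "gdist E r u \<le> enat lv" using I1 u(2) by auto
    have card': "card (insert u X) = Suc m" using uX finX I8 by simp
    define Q' where "Q' = (\<lambda>y. if y < n \<and> E u y \<and> y \<notin> Ov \<and> y \<notin> X \<and> y \<noteq> u
                    then Some (case Q y of None \<Rightarrow> lv + 1 | Some q \<Rightarrow> min q (lv + 1))
                    else Q y)"
    have step: "pbfs_step E n Ov r st = (if enat lv < label_est L r u
        then (Q', insert u X, L(u := insert (r, lv) (L u))) else (Q, insert u X, L))"
      using False unfolding pbfs_step_def st prod.case Let_def P_def[symmetric] lv_def[symmetric]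
      by (simp add: u_def[symmetric] Q'_def)
    \<comment> \<open>The pruning test never cuts an unblocked \<open>u\<close>: its labels are
      still those of earlier roots \<open>z\<close>, none of which lies on an
      \<open>r\<close>-\<open>u\<close> geodesic, so every stored detour is strictly longer than
      \<open>k\<close>.\<close>
    have key: "lv = k \<and> enat lv < label_est L r u" if cl: "unblocked Ov r u" "gdist E r u = enat k" for k
    proof -
      obtain v q where "v \<notin> X" "Q v = Some q" "q \<le> k"
        using pbfs_inv_front[of Ov r L0 m Q X L u k] inv cl uX by (auto simp: st)
      then have "lv \<le> k" using lv_le by fastforce
      then have lvk: "lv = k" using lvge cl by simp
      \<comment> \<open>Written with \<open>Suc k\<close> because an infimum preserves only weak
        bounds.\<close>
      have "enat (Suc k) \<le> enat (d1 + d2)" if "(z, d1) \<in> L r" "(z, d2) \<in> L u" for z d1 d2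
      proof -
        have z2: "(z, d2) \<in> L0 u" using I5[OF that(2)] uX by auto
        then have zO: "z \<in> Ov" "gdist E z u \<le> enat d2" using L0 by auto
        then have "(z, d1) \<in> L0 r" using I5[OF that(1)] r(2) by auto
        then have "gdist E r z \<le> enat d1" using L0 gdist_sym by metis
        then have le: "gdist E r z + gdist E z u \<le> enat (d1 + d2)"
          using zO(2) add_mono by (metis plus_enat_simps(1))
        have "\<not> on_geodesic r u z" using cl(1) zO(1) by (simp add: unblocked_def)
        then have "enat k < gdist E r z + gdist E z u"
          using gdist_triangle[of E r u z] cl(2) unfolding on_geodesic_def by (simp add: less_le)
        then have "enat k < enat (d1 + d2)" using le by (rule less_le_trans)
        then show ?thesis by simp
      qed
      then have "enat (Suc k) \<le> label_est L r u"
        unfolding label_est_def by (intro Inf_greatest) auto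
      then show ?thesis using lvk by (metis Suc_ile_eq)
    qed
    show ?thesis
    proof (cases "enat lv < label_est L r u")
      case True
      have Q'mono: "\<exists>q'. Q' y = Some q' \<and> q' \<le> q" if "Q y = Some q" for y q
        using that by (auto simp: Q'_def)
      have J1: "y < n \<and> gdist E r y \<le> enat q" if "Q' y = Some q" for y q
      proof (cases "y < n \<and> E u y \<and> y \<notin> Ov \<and> y \<notin> X \<and> y \<noteq> u")
        case c: True
        have "gdist E u y \<le> enat 1" using c by (intro gdist_le) (auto simp: reach_in_Suc)
        then have g: "gdist E r y \<le> enat (lv + 1)"
          using gdist_triangle[of E r y u] lvge add_mono[OF lvge, of "gdist E u y" "enat 1"]
          by (metis order_trans plus_enat_simps(1))
        show ?thesis
        proof (cases "Q y")
          case None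
          then show ?thesis using c g that by (simp add: Q'_def)
        next
          case (Some q0)
          then have "q = min q0 (lv + 1)" using c that by (simp add: Q'_def)
          then show ?thesis using g I1[OF Some] c by (auto simp: min_def)
        qed
      next
        case False
        then have "Q' y = Q y" unfolding Q'_def by (rule if_not_P)
        then show ?thesis using I1[of y q] that by simp
      qed
      have "pbfs_inv Ov r L0 (Suc m) (Q', insert u X, L(u := insert (r, lv) (L u)))"
        unfolding pbfs_inv_def prod.case
      proof (intro conjI allI impI)
        fix y q assume "Q' y = Some q"
        then show "y < n" "gdist E r y \<le> enat q" using J1 by auto
      next
        show "Q' r = Some 0" using Q'mono[OF I2] by auto
      next
        show "insert u X \<subseteq> {u. Q' u \<noteq> None}"
        proof
          fix y assume "y \<in> insert u X"
          then obtain q where "Q y = Some q" using I3 u(2) by auto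
          then show "y \<in> {u. Q' u \<noteq> None}" using Q'mono by force
        qed
      next
        show "L0 v \<subseteq> (L(u := insert (r, lv) (L u))) v" for v using I4[of v] by auto
      next
        fix v z d assume "(z, d) \<in> (L(u := insert (r, lv) (L u))) v"
        then show "(z, d) \<in> L0 v \<or> z = r \<and> v \<in> insert u X \<and> gdist E r v \<le> enat d"
          using I5[of z d v] lvge by (auto split: if_splits)
      next
        fix v k assume "unblocked Ov r v" "gdist E r v = enat k" "v \<in> insert u X"
        then show "(r, k) \<in> (L(u := insert (r, lv) (L u))) v" using I6[of v k] key[of k] by auto
      next
        fix v k y assume a: "unblocked Ov r v" "gdist E r v = enat k" "v \<in> insert u X" "E v y" "y \<notin> Ov"
        show "y \<in> insert u X \<or> (\<exists>q. Q' y = Some q \<and> q \<le> k + 1)"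
        proof (cases "v = u")
          case True
          then have "lv = k" using key a by blast
          moreover have "y < n" using a(4) E_dom2 by blast
          ultimately show ?thesis using a True by (auto simp: Q'_def split: option.splits)
        next
          case False
          then show ?thesis using I7[of v k y] a Q'mono by (meson insert_iff order_trans)
        qed
      next
        show "card (insert u X) = Suc m \<or> {ua. ua \<notin> insert u X \<and> Q' ua \<noteq> None} = {}"
          using card' by blast
      qed
      then show ?thesis using True step by simp
    next
      case False
      have "pbfs_inv Ov r L0 (Suc m) (Q, insert u X, L)"
        unfolding pbfs_inv_def prod.case
      proof (intro conjI allI impI)
        show "card (insert u X) = Suc m \<or> {ua. ua \<notin> insert u X \<and> Q ua \<noteq> None} = {}"
          using card' by blast
      next
        fix v k assume "unblocked Ov r v" "gdist E r v = enat k" "v \<in> insert u X"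
        then show "(r, k) \<in> L v" using I6[of v k] key[of k] False by auto
      next
        fix v k y assume a: "unblocked Ov r v" "gdist E r v = enat k" "v \<in> insert u X" "E v y" "y \<notin> Ov"
        then show "y \<in> insert u X \<or> (\<exists>q. Q y = Some q \<and> q \<le> k + 1)"
          using I7[of v k y] key[of k] False by blast
      next
        fix v z d assume "(z, d) \<in> L v"
        then show "(z, d) \<in> L0 v \<or> z = r \<and> v \<in> insert u X \<and> gdist E r v \<le> enat d"
          using I5[of z d v] by blast
      qed (use I1 I2 I3 I4 u(2) in auto)
      then show ?thesis using False step by simp
    qed
  qed
qed

lemma pbfs_correct:
  assumes r: "r < n" "r \<notin> Ov"
    and L0: "\<And>v z d. (z, d) \<in> L0 v \<Longrightarrow> z \<in> Ov \<and> gdist E z v \<le> enat d"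
  shows "L0 v \<subseteq> pbfs E n Ov r L0 v"
    and "(z, d) \<in> pbfs E n Ov r L0 v \<Longrightarrow> (z, d) \<in> L0 v \<or> z = r \<and> gdist E r v \<le> enat d"
    and "unblocked Ov r v \<Longrightarrow> gdist E r v = enat k \<Longrightarrow> (r, k) \<in> pbfs E n Ov r L0 v"
proof -
  define S0 where "S0 = (\<lambda>y. if y = r then Some (0::nat) else None, {}::nat set, L0)"
  have "pbfs_inv Ov r L0 m ((pbfs_step E n Ov r ^^ m) S0)" for m
  proof (induction m)
    case 0
    then show ?case using r by (auto simp: S0_def pbfs_inv_def)
  next
    case (Suc m)
    then show ?case using pbfs_inv_step[OF _ r L0] by auto
  qed
  then have inv: "pbfs_inv Ov r L0 n ((pbfs_step E n Ov r ^^ n) S0)" .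
  obtain Q X L where st: "(pbfs_step E n Ov r ^^ n) S0 = (Q, X, L)" by (metis prod_cases3)
  have L: "pbfs E n Ov r L0 = L" using st by (simp add: pbfs_def S0_def)
  note inv = inv[unfolded st]
  \<comment> \<open>If the queue were not empty, the \<open>n\<close> steps would have extracted
    \<open>n\<close> different vertices, hence all of them.\<close>
  have P: "{u. u \<notin> X \<and> Q u \<noteq> None} = {}"
  proof (rule ccontr)
    assume ne: "{u. u \<notin> X \<and> Q u \<noteq> None} \<noteq> {}"
    then have c: "card X = n" and sub: "\<And>u. Q u \<noteq> None \<Longrightarrow> u < n" "X \<subseteq> {u. Q u \<noteq> None}"
      using inv by (auto simp: pbfs_inv_def)
    then have "X \<subseteq> {..<n}" by auto
    then have "X = {..<n}" using c card_subset_eq[of "{..<n}" X] by simp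
    then show False using ne sub(1) by auto
  qed
  show "L0 v \<subseteq> pbfs E n Ov r L0 v" using inv unfolding L pbfs_inv_def by auto
  show "(z, d) \<in> pbfs E n Ov r L0 v \<Longrightarrow> (z, d) \<in> L0 v \<or> z = r \<and> gdist E r v \<le> enat d"
    using inv unfolding L pbfs_inv_def by blast
  assume v: "unblocked Ov r v" "gdist E r v = enat k"
  have "v \<in> X"
  proof (rule ccontr)
    assume "v \<notin> X"
    from pbfs_inv_front[OF inv v this] P show False by auto
  qed
  then show "(r, k) \<in> pbfs E n Ov r L0 v" using inv v unfolding L pbfs_inv_def by auto
qed

lemma phase1_sound_mono:
  assumes "\<And>v z d. (z, d) \<in> L v \<Longrightarrow> z \<in> Ov \<and> gdist E z v \<le> enat d"
    "distinct rs" "set rs \<subseteq> {..<n}" "set rs \<inter> Ov = {}"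
  shows "(\<forall>z d. (z, d) \<in> phase1 E n rs Ov L v \<longrightarrow> z \<in> Ov \<union> set rs \<and> gdist E z v \<le> enat d)
    \<and> L v \<subseteq> phase1 E n rs Ov L v"
  using assms
proof (induction rs arbitrary: Ov L)
  case (Cons r rs)
  have r: "r < n" "r \<notin> Ov" using Cons.prems by auto
  note pc = pbfs_correct[OF r, of L, OF Cons.prems(1)]
  have L': "z \<in> insert r Ov \<and> gdist E z v \<le> enat d" if "(z, d) \<in> pbfs E n Ov r L v" for v z d
    using pc(2)[OF _ that] Cons.prems(1) by auto
  have "(\<forall>z d. (z, d) \<in> phase1 E n rs (insert r Ov) (pbfs E n Ov r L) v
      \<longrightarrow> z \<in> insert r Ov \<union> set rs \<and> gdist E z v \<le> enat d)
    \<and> pbfs E n Ov r L v \<subseteq> phase1 E n rs (insert r Ov) (pbfs E n Ov r L) v"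
    using Cons.IH[of "pbfs E n Ov r L" "insert r Ov"] L' Cons.prems r by auto
  moreover have "L v \<subseteq> pbfs E n Ov r L v" using pc(1) by blast
  ultimately show ?case by auto
qed auto

lemmas phase1_sound = phase1_sound_mono[THEN conjunct1, rule_format]
lemmas phase1_mono = phase1_sound_mono[THEN conjunct2]

text \<open>Induction on the list, keeping the hypothesis that no processed root lies on an
  \<open>s\<close>-\<open>t\<close> geodesic. The first root that does lie on one finds both
  \<open>s\<close> and \<open>t\<close> unblocked, so both store exact distances.\<close>

lemma phase1_complete:
  assumes "\<And>v z d. (z, d) \<in> L v \<Longrightarrow> z \<in> Ov \<and> gdist E z v \<le> enat d"
    "distinct rs" "set rs \<subseteq> {..<n}" "set rs \<inter> Ov = {}"
    and st: "gdist E s t = enat D" "\<And>z. z \<in> Ov \<Longrightarrow> \<not> on_geodesic s t z" "r0 \<in> set rs" "on_geodesic s t r0"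
  shows "\<exists>z d1 d2. (z, d1) \<in> phase1 E n rs Ov L s \<and> (z, d2) \<in> phase1 E n rs Ov L t \<and> d1 + d2 = D"
  using assms
proof (induction rs arbitrary: Ov L)
  case (Cons r rs)
  have r: "r < n" "r \<notin> Ov" using Cons.prems by auto
  note pc = pbfs_correct[OF r, of L, OF Cons.prems(1)]
  have L': "z \<in> insert r Ov \<and> gdist E z v \<le> enat d" if "(z, d) \<in> pbfs E n Ov r L v" for v z d
    using pc(2)[OF _ that] Cons.prems(1) by auto
  show ?case
  proof (cases "on_geodesic s t r")
    case True
    then obtain i j where ij: "gdist E s r = enat i" "gdist E r t = enat j" "i + j = D"
      using Cons.prems(5) unfolding on_geodesic_def
      by (cases "gdist E s r"; cases "gdist E r t") auto
    \<comment> \<open>A geodesic from \<open>s\<close> to \<open>r\<close> extends to one from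
      \<open>s\<close> to \<open>t\<close>, so a blocker of this half would be an earlier root on an
      \<open>s\<close>-\<open>t\<close> geodesic.\<close>
    have "\<not> on_geodesic r s z" if "z \<in> Ov" for z
    proof
      assume "on_geodesic r s z"
      then have *: "gdist E s z + gdist E z r = gdist E s r"
        unfolding on_geodesic_def by (simp add: gdist_sym add.commute)
      have "gdist E s z + gdist E z t \<le> gdist E s z + (gdist E z r + gdist E r t)"
        by (intro add_left_mono gdist_triangle)
      also have "\<dots> = gdist E s t" using * True by (simp add: on_geodesic_def add.assoc[symmetric])
      finally have "on_geodesic s t z" unfolding on_geodesic_def using gdist_triangle[of E s t z] by (simp add: antisym)
      then show False using Cons.prems(6) that by blast
    qed
    then have 1: "unblocked Ov r s" using ij by (auto simp: unblocked_def gdist_sym[of r s])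
    have "\<not> on_geodesic r t z" if "z \<in> Ov" for z
    proof
      assume *: "on_geodesic r t z"
      have "gdist E s z + gdist E z t \<le> (gdist E s r + gdist E r z) + gdist E z t"
        by (intro add_right_mono gdist_triangle)
      also have "\<dots> = gdist E s t" using * True by (simp add: on_geodesic_def add.assoc)
      finally have "on_geodesic s t z" unfolding on_geodesic_def using gdist_triangle[of E s t z] by (simp add: antisym)
      then show False using Cons.prems(6) that by blast
    qed
    then have 2: "unblocked Ov r t" using ij by (auto simp: unblocked_def)
    have "(r, i) \<in> pbfs E n Ov r L s" "(r, j) \<in> pbfs E n Ov r L t"
      using pc(3)[OF _ 1, of i] pc(3)[OF _ 2, of j] ij by (auto simp: gdist_sym)
    moreover have "pbfs E n Ov r L v \<subseteq> phase1 E n rs (insert r Ov) (pbfs E n Ov r L) v" for v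
      by (rule phase1_mono) (use L' Cons.prems in auto)
    ultimately have "(r, i) \<in> phase1 E n (r # rs) Ov L s" "(r, j) \<in> phase1 E n (r # rs) Ov L t"
      by auto
    then show ?thesis using ij(3) by blast
  next
    case False
    then have r0: "r0 \<in> set rs" using Cons.prems by auto
    have "\<exists>z d1 d2. (z, d1) \<in> phase1 E n rs (insert r Ov) (pbfs E n Ov r L) s \<and>
        (z, d2) \<in> phase1 E n rs (insert r Ov) (pbfs E n Ov r L) t \<and> d1 + d2 = D"
    proof (rule Cons.IH)
      fix z assume "z \<in> insert r Ov"
      then show "\<not> on_geodesic s t z" using Cons.prems(6) False by auto
    qed (use L' r0 Cons.prems in auto)
    then show ?thesis by simp
  qed
qed auto

section \<open>The two-hop cover property from a common hub\<close>

lemma approx_pruning_sound: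
  assumes "degree_ordering E n xs" "(z, d) \<in> approx_pruning E n xs H rad v" "v < n"
  shows "gdist E z v \<le> enat d"
proof -
  have xs: "distinct xs" "set xs = {..<n}" using assms(1) by (auto simp: degree_ordering_def)
  have "gdist E z v \<le> enat d" if "(z, d) \<in> phase1 E n (take H xs) {} (\<lambda>_. {}) v"
  proof -
    have "z \<in> {} \<union> set (take H xs) \<and> gdist E z v \<le> enat d"
      by (rule phase1_sound[OF _ _ _ _ that]) (use xs set_take_subset[of H xs] in auto)
    then show ?thesis by simp
  qed
  moreover have "gdist E z v \<le> enat d" if "(z, d) \<in> phase2_labels E n (rad v) v"
    using that unfolding phase2_labels_def
    by (auto simp: gdist_sym[of v]) (metis enat_ord_simps(4) order.refl enat_ile the_enat.simps)
  ultimately show ?thesis using assms(2) by (auto simp: approx_pruning_def Let_def split: if_splits)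
qed

lemma phase2_ball:
  assumes "gdist E v y = enat k" "k \<le> l - 1" "v < n"
  shows "(y, k) \<in> phase2_labels E n l v"
proof -
  have "y < n" using gdist_dom assms by (metis enat.distinct(2))
  then show ?thesis using assms unfolding phase2_labels_def by force
qed

text \<open>The disjunction in \<open>rad\<close> mirrors the definition of the radius. Either the
  whole component is stored, which settles every pair with this endpoint that no root covers, or the
  hub lies within the radius.\<close>

lemma approx_pruning_cover:
  assumes xs: "degree_ordering E n xs" and w: "w \<in> set (take H xs)"
    and rad: "\<And>x. x < n \<Longrightarrow> (\<forall>y. gdist E x y \<noteq> \<infinity> \<longrightarrow> gdist E x y \<le> enat (rad x - 1))
      \<or> (1 \<le> rad x \<and> gdist E x w \<le> enat (rad x))"
  shows "is_2hop_cover E n (approx_pruning E n xs H rad)"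
  unfolding is_2hop_cover_def
proof (intro allI impI)
  fix s t assume s: "s < n" and t: "t < n" and "gdist E s t \<noteq> \<infinity>"
  then obtain D where D: "gdist E s t = enat D" by auto
  define L where "L = approx_pruning E n xs H rad"
  have xs': "distinct xs" "set xs = {..<n}" using xs by (auto simp: degree_ordering_def)
  have "\<exists>z d1 d2. (z, d1) \<in> L s \<and> (z, d2) \<in> L t \<and> d1 + d2 = D"
  proof (cases "\<exists>r0\<in>set (take H xs). on_geodesic s t r0")
    case True
    then obtain r0 where r0: "r0 \<in> set (take H xs)" "on_geodesic s t r0" by blast
    have "\<exists>z d1 d2. (z, d1) \<in> phase1 E n (take H xs) {} (\<lambda>_. {}) s \<and>
        (z, d2) \<in> phase1 E n (take H xs) {} (\<lambda>_. {}) t \<and> d1 + d2 = D"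
      by (rule phase1_complete[OF _ _ _ _ D _ r0]) (use xs' set_take_subset[of H xs] in auto)
    then show ?thesis unfolding L_def approx_pruning_def Let_def by auto
  next
    case False
    \<comment> \<open>The endpoints lie on their own geodesic, so in this case neither is a root and
      both carry second-phase labels.\<close>
    have "on_geodesic s t s" "on_geodesic s t t" by (auto simp: on_geodesic_def)
    then have "s \<in> set (drop H xs)" "t \<in> set (drop H xs)"
      using False s t xs'(2) by (metis append_take_drop_id set_append Un_iff lessThan_iff)+
    then have sub: "phase2_labels E n (rad s) s \<subseteq> L s" "phase2_labels E n (rad t) t \<subseteq> L t"
      unfolding L_def approx_pruning_def Let_def by auto
    have tt: "(t, 0) \<in> phase2_labels E n (rad t) t" "(s, 0) \<in> phase2_labels E n (rad s) s"
      using phase2_ball[of t t 0] phase2_ball[of s s 0] s t by (auto simp: zero_enat_def)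
    have D': "gdist E t s = enat D" using D gdist_sym by metis
    consider (S) "\<forall>y. gdist E s y \<noteq> \<infinity> \<longrightarrow> gdist E s y \<le> enat (rad s - 1)"
      | (T) "\<forall>y. gdist E t y \<noteq> \<infinity> \<longrightarrow> gdist E t y \<le> enat (rad t - 1)"
      | (W) "1 \<le> rad s" "gdist E s w \<le> enat (rad s)" "1 \<le> rad t" "gdist E t w \<le> enat (rad t)"
      using rad[OF s] rad[OF t] by blast
    then show ?thesis
    proof cases
      case S
      then have "gdist E s t \<le> enat (rad s - 1)" using D by auto
      then have "(t, D) \<in> phase2_labels E n (rad s) s" using phase2_ball[of s t D] D s by simp
      then show ?thesis using tt sub by (intro exI[of _ t] exI[of _ D] exI[of _ 0]) auto
    next
      case T
      then have "gdist E t s \<le> enat (rad t - 1)" using D' by auto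
      then have "(s, D) \<in> phase2_labels E n (rad t) t" using phase2_ball[of t s D] D' t by simp
      then show ?thesis using tt sub by (intro exI[of _ s] exI[of _ 0] exI[of _ D]) auto
    next
      case W
      obtain ls lt where l: "rad s = Suc ls" "rad t = Suc lt" using W(1,3) by (metis Suc_le_D One_nat_def)
      obtain i j where ij: "gdist E s w = enat i" "gdist E w t = enat j" "i \<le> Suc ls" "j \<le> Suc lt"
        using W(2,4) l gdist_sym[of t w] by (metis enat_ile enat_ord_simps(1))
      \<comment> \<open>Equality would put the root \<open>w\<close> on an
        \<open>s\<close>-\<open>t\<close> geodesic, contrary to the case. This one saved step is
        what makes the stored part of the outer spheres sufficient.\<close>
      have "D \<le> i + j" using gdist_triangle[of E s t w] D ij by simp
      moreover have "D \<noteq> i + j" using False w D ij unfolding on_geodesic_def by auto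
      ultimately have Dlt: "D \<le> ls + lt + 1" using ij by simp
      show ?thesis
      proof (cases "D \<le> ls + lt")
        case True
        \<comment> \<open>The fully stored balls have radii \<open>ls\<close> and \<open>lt\<close>,
          one less than \<open>rad\<close>. The minimum covers the case that \<open>t\<close>
          already lies inside the ball of \<open>s\<close>.\<close>
        define k where "k = min D ls"
        obtain z where z: "gdist E s z = enat k" "gdist E z t = enat (D - k)"
          using gdist_split[OF D, of k] by (auto simp: k_def)
        have "(z, k) \<in> phase2_labels E n (rad s) s"
          using phase2_ball[OF z(1), of "rad s"] s l by (simp add: k_def)
        moreover have "(z, D - k) \<in> phase2_labels E n (rad t) t"
          using phase2_ball[of t z "D - k" "rad t"] z(2) t l True gdist_sym[of z t] by (auto simp: k_def)
        ultimately show ?thesis using sub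
          by (intro exI[of _ z] exI[of _ k] exI[of _ "D - k"]) (auto simp: k_def)
      next
        case F: False
        \<comment> \<open>The full balls just miss each other, and the geodesic crosses the gap by a
          single edge from \<open>a\<close>, on the last full sphere of \<open>s\<close>, to
          \<open>b\<close>, on that of \<open>t\<close>.\<close>
        then have Deq: "D = ls + Suc lt" using Dlt by simp
        obtain a where a: "gdist E s a = enat ls" "gdist E a t = enat (Suc lt)"
          using gdist_split[OF D, of ls] Deq by auto
        obtain b where b: "gdist E t b = enat lt" "E b a"
          using gdist_Suc_pred[of E t a lt] a(2) gdist_sym[of t a] by auto
        have ab: "a < n" "b < n" "E a b" using E_dom E_dom2 E_sym b(2) by blast+
        have "gdist E a b \<le> enat 1" using ab(3) by (intro gdist_le) (auto simp: reach_in_Suc)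
        then have "gdist E s b \<le> enat ls + enat 1"
          using gdist_triangle[of E s b a] a(1) by (metis add_left_mono order_trans)
        then obtain m where m: "gdist E s b = enat m" "m \<le> Suc ls" by (cases "gdist E s b") auto
        have "D \<le> m + lt" using gdist_triangle[of E s t b] D m b(1) gdist_sym[of t b] by simp
        then have sb: "gdist E s b = enat (Suc ls)" using m Deq by (auto simp: le_antisym)
        show ?thesis
        proof (cases "deg E n a \<le> deg E n b")
          case True
          have "(b, Suc ls) \<in> phase2_labels E n (rad s) s"
            using True a(1) ab sb b unfolding phase2_labels_def l by auto
          moreover have "(b, lt) \<in> phase2_labels E n (rad t) t"
            using phase2_ball[OF b(1)] t l by simp
          ultimately show ?thesis using sub Deq
            by (intro exI[of _ b] exI[of _ "Suc ls"] exI[of _ lt]) auto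
        next
          case False
          have "(a, Suc lt) \<in> phase2_labels E n (rad t) t"
            using False a(2) ab b gdist_sym[of a t] unfolding phase2_labels_def l by auto
          moreover have "(a, ls) \<in> phase2_labels E n (rad s) s"
            using phase2_ball[OF a(1)] s l by simp
          ultimately show ?thesis using sub Deq
            by (intro exI[of _ a] exI[of _ ls] exI[of _ "Suc lt"]) auto
        qed
      qed
    qed
  qed
  then have "label_est L s t \<le> enat D"
    unfolding label_est_def by (intro Inf_lower) auto
  moreover have "enat D \<le> label_est L s t"
    unfolding label_est_def
  proof (intro Inf_greatest, clarify)
    fix z d1 d2 assume "(z, d1) \<in> L s" "(z, d2) \<in> L t"
    then have "gdist E z s \<le> enat d1" "gdist E z t \<le> enat d2"
      using approx_pruning_sound[OF xs] s t by (auto simp: L_def)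
    then have "gdist E s z + gdist E z t \<le> enat (d1 + d2)"
      using add_mono gdist_sym[of s z] by (metis plus_enat_simps(1))
    then show "enat D \<le> enat (d1 + d2)" using gdist_triangle[of E s t z] D by (metis order_trans)
  qed
  ultimately show "label_est (approx_pruning E n xs H rad) s t = gdist E s t" using D L_def by simp
qed

end

section \<open>Product Bernoulli measures\<close>

definition bern :: "'a set \<Rightarrow> ('a \<Rightarrow> real) \<Rightarrow> ('a \<Rightarrow> bool) pmf" where
  "bern P q = Pi_pmf P False (\<lambda>e. bernoulli_pmf (q e))"

text \<open>Stands in for measurability with respect to the coordinates in \<open>J\<close>; the set
  \<open>J\<close> need not lie inside the index set of the measure.\<close>

definition dep_on :: "'a set \<Rightarrow> (('a \<Rightarrow> bool) \<Rightarrow> bool) \<Rightarrow> bool" where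
  "dep_on J Q \<longleftrightarrow> (\<forall>g g'. (\<forall>e\<in>J. g e = g' e) \<longrightarrow> Q g = Q g')"

abbreviation bprob :: "'a set \<Rightarrow> ('a \<Rightarrow> real) \<Rightarrow> (('a \<Rightarrow> bool) \<Rightarrow> bool) \<Rightarrow> real" where
  "bprob P q Q \<equiv> measure_pmf.prob (bern P q) {g. Q g}"

lemma dep_onD: "dep_on J Q \<Longrightarrow> (\<And>e. e \<in> J \<Longrightarrow> g e = g' e) \<Longrightarrow> Q g = Q g'"
  unfolding dep_on_def by blast

lemma prob_pair_pmf_Times:
  "measure_pmf.prob (pair_pmf M N) (S \<times> T) = measure_pmf.prob M S * measure_pmf.prob N T"
proof -
  have "measure_pmf.prob (pair_pmf M N) (S \<times> T) =
      measure_pmf.prob (pair_pmf M N) ((S \<inter> set_pmf M) \<times> (T \<inter> set_pmf N))"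
    by (subst measure_Int_set_pmf[symmetric]) (auto intro!: arg_cong2[where f = measure])
  also have "\<dots> = measure_pmf.prob M (S \<inter> set_pmf M) * measure_pmf.prob N (T \<inter> set_pmf N)"
    by (intro measure_pmf_prob_product countable_Int2 countable_set_pmf)
  finally show ?thesis by (simp add: measure_Int_set_pmf)
qed

text \<open>The measure is split along \<open>P \<inter> A\<close> and \<open>P - A\<close>.
  Coordinates of \<open>A\<close> outside \<open>P\<close> almost surely have the default value
  \<open>False\<close>, so \<open>Q1\<close> can be evaluated on the first factor alone.\<close>

lemma bern_indep:
  assumes P: "finite P" and dep: "dep_on A Q1" "dep_on B Q2" and AB: "A \<inter> B = {}"
  shows "bprob P q (\<lambda>g. Q1 g \<and> Q2 g) = bprob P q Q1 * bprob P q Q2"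
proof -
  define A' where "A' = P \<inter> A"
  define B' where "B' = P - A"
  have P': "P = A' \<union> B'" "finite A'" "finite B'" "A' \<inter> B' = {}"
    using P by (auto simp: A'_def B'_def)
  define h where "h = (\<lambda>(f :: 'a \<Rightarrow> bool, g) x. if x \<in> A' then f x else g x)"
  have u: "bern P q = map_pmf h (pair_pmf (bern A' q) (bern B' q))"
    unfolding bern_def h_def P'(1) by (rule Pi_pmf_union) (use P' in auto)
  have out: "f x = False" if "f \<in> set_pmf (bern J q)" "x \<notin> J" "finite J" for f x J
    using that set_Pi_pmf_subset[of J False] unfolding bern_def by fastforce
  have key: "bprob P q (\<lambda>g. R1 g \<and> R2 g) = bprob A' q R1 * bprob B' q R2"
    if R: "dep_on A R1" "dep_on B R2" for R1 R2
  proof -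
    have "bprob P q (\<lambda>g. R1 g \<and> R2 g) = measure_pmf.prob (pair_pmf (bern A' q) (bern B' q)) (h -` {g. R1 g \<and> R2 g})"
      unfolding u by simp
    also have "\<dots> = measure_pmf.prob (pair_pmf (bern A' q) (bern B' q)) ({f. R1 f} \<times> {g. R2 g})"
    proof (rule measure_pmf.finite_measure_eq_AE, goal_cases)
      case 1
      show ?case
      proof (rule AE_pmfI, clarify)
        fix f g assume "(f, g) \<in> set_pmf (pair_pmf (bern A' q) (bern B' q))"
        then have fg: "\<And>x. x \<notin> A' \<Longrightarrow> f x = False" "\<And>x. x \<notin> B' \<Longrightarrow> g x = False"
          using out P' by auto
        have "R1 (h (f, g)) = R1 f"
          by (rule dep_onD[OF R(1)]) (auto simp: h_def A'_def fg B'_def)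
        moreover have "R2 (h (f, g)) = R2 g"
          by (rule dep_onD[OF R(2)]) (use AB in \<open>auto simp: h_def A'_def\<close>)
        ultimately show "((f, g) \<in> h -` {g. R1 g \<and> R2 g}) = ((f, g) \<in> {f. R1 f} \<times> {g. R2 g})"
          by auto
      qed
    qed auto
    finally show ?thesis by (simp add: prob_pair_pmf_Times)
  qed
  \<comment> \<open>Pairing with the trivial event turns \<open>key\<close> into formulas for the
    two marginals over \<open>P\<close>.\<close>
  have T: "dep_on J (\<lambda>_. True)" for J :: "'a set" by (simp add: dep_on_def)
  show ?thesis
    using key[OF dep] key[OF dep(1) T] key[OF T dep(2)] by simp
qed

text \<open>The outcomes \<open>D i\<close> exclude each other, so their probabilities sum to at
  most 1 and the bound \<open>\<epsilon>\<close> is not multiplied by the number of outcomes, which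
  is exponential in the applications.\<close>

lemma bern_explore:
  assumes P: "finite P" and K: "finite K"
    and dep: "\<And>i. i \<in> K \<Longrightarrow> dep_on (J i) (D i)" "\<And>i. i \<in> K \<Longrightarrow> dep_on (J' i) (F i)"
    and J: "\<And>i. i \<in> K \<Longrightarrow> J i \<inter> J' i = {}"
    and disj: "\<And>i j g. i \<in> K \<Longrightarrow> j \<in> K \<Longrightarrow> D i g \<Longrightarrow> D j g \<Longrightarrow> i = j"
    and F: "\<And>i. i \<in> K \<Longrightarrow> bprob P q (F i) \<le> \<epsilon>" and e: "0 \<le> \<epsilon>"
  shows "bprob P q (\<lambda>g. \<exists>i\<in>K. D i g \<and> F i g) \<le> \<epsilon>"
proof -
  have "bprob P q (\<lambda>g. \<exists>i\<in>K. D i g \<and> F i g) = measure_pmf.prob (bern P q) (\<Union>i\<in>K. {g. D i g \<and> F i g})"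
    by (rule arg_cong[where f = "measure_pmf.prob _"]) auto
  also have "\<dots> \<le> (\<Sum>i\<in>K. bprob P q (\<lambda>g. D i g \<and> F i g))"
    by (rule measure_pmf.finite_measure_subadditive_finite) (use K in auto)
  also have "\<dots> = (\<Sum>i\<in>K. bprob P q (D i) * bprob P q (F i))"
    by (intro sum.cong refl bern_indep[OF P dep J])
  also have "\<dots> \<le> (\<Sum>i\<in>K. bprob P q (D i) * \<epsilon>)"
    by (intro sum_mono mult_left_mono F) auto
  also have "\<dots> = (\<Sum>i\<in>K. bprob P q (D i)) * \<epsilon>" by (simp add: sum_distrib_right)
  also have "(\<Sum>i\<in>K. bprob P q (D i)) = measure_pmf.prob (bern P q) (\<Union>i\<in>K. {g. D i g})"
    by (rule measure_pmf.finite_measure_finite_Union[symmetric])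
       (use K disj in \<open>auto simp: disjoint_family_on_def\<close>)
  also have "\<dots> * \<epsilon> \<le> 1 * \<epsilon>" by (intro mult_right_mono e measure_pmf.prob_le_1)
  finally show ?thesis by simp
qed

lemma bern_expectation_prod:
  fixes f :: "'a \<Rightarrow> bool \<Rightarrow> real"
  assumes P: "finite P" and q: "\<And>e. e \<in> T \<Longrightarrow> 0 \<le> q e \<and> q e \<le> 1" and T: "T \<subseteq> P"
    and f: "\<And>e v. e \<in> T \<Longrightarrow> 0 \<le> f e v"
  shows "measure_pmf.expectation (bern P q) (\<lambda>g. \<Prod>e\<in>T. f e (g e)) =
    (\<Prod>e\<in>T. q e * f e True + (1 - q e) * f e False)"
proof -
  define f' where "f' = (\<lambda>e v. if e \<in> T then f e v else 1)"
  have 1: "(\<Prod>e\<in>T. f e (g e)) = (\<Prod>e\<in>P. f' e (g e))" for g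
    using T P unfolding f'_def by (intro prod.mono_neutral_cong_left) auto
  have "measure_pmf.expectation (bern P q) (\<lambda>g. \<Prod>e\<in>T. f e (g e)) =
    (\<Prod>e\<in>P. measure_pmf.expectation (bernoulli_pmf (q e)) (f' e))"
    unfolding 1 bern_def
    by (intro expectation_prod_Pi_pmf P integrable_measure_pmf_finite) (auto simp: f'_def f)
  also have "\<dots> = (\<Prod>e\<in>T. measure_pmf.expectation (bernoulli_pmf (q e)) (f e))"
    using T P by (intro prod.mono_neutral_cong_right) (auto simp: f'_def fun_eq_iff)
  also have "\<dots> = (\<Prod>e\<in>T. q e * f e True + (1 - q e) * f e False)"
    using q by (intro prod.cong refl) (simp add: integral_bernoulli_pmf mult.commute)
  finally show ?thesis .
qed

lemma finite_set_pmf_bern: "finite P \<Longrightarrow> finite (set_pmf (bern P q))"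
proof -
  assume P: "finite P"
  have "set_pmf (bern P q) \<subseteq> PiE_dflt P False (\<lambda>_. UNIV)"
    unfolding bern_def using set_Pi_pmf_subset[OF P, of False] by (auto simp: PiE_dflt_def)
  moreover have "finite (PiE_dflt P False (\<lambda>_. UNIV :: bool set))" using P by auto
  ultimately show ?thesis by (rule finite_subset)
qed

lemma bern_markov_exp:
  fixes f :: "'a \<Rightarrow> bool \<Rightarrow> real"
  assumes P: "finite P"
  shows "bprob P q (\<lambda>g. t \<le> X g) \<le> measure_pmf.expectation (bern P q) (\<lambda>g. exp (X g)) / exp t"
proof -
  have "bprob P q (\<lambda>g. t \<le> X g) = measure_pmf.prob (bern P q) {g \<in> space (measure_pmf (bern P q)). exp t \<le> exp (X g)}"
    by simp
  also have "\<dots> \<le> measure_pmf.expectation (bern P q) (\<lambda>g. exp (X g)) / exp t"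
    by (rule integral_Markov_inequality_measure[where A = "{}"])
       (auto intro!: integrable_measure_pmf_finite finite_set_pmf_bern P)
  finally show ?thesis .
qed

text \<open>Exponential Markov inequality at parameter \<open>1 / b\<close>, where every summand in
  the exponent lies in the unit interval. The factor 2 in front of \<open>m\<close> is that of
  \<open>exp x \<le> 1 + 2 * x\<close>. The map \<open>\<phi>\<close> lets ordered pairs index the
  coordinates.\<close>

lemma bern_chernoff_upper:
  fixes a :: "'b \<Rightarrow> real"
  assumes P: "finite P" and T: "finite T" "inj_on \<phi> T" "\<phi> ` T \<subseteq> P"
    and q: "\<And>t. t \<in> T \<Longrightarrow> 0 \<le> q (\<phi> t) \<and> q (\<phi> t) \<le> 1"
    and a: "\<And>t. t \<in> T \<Longrightarrow> 0 \<le> a t \<and> a t \<le> b" and b: "0 < b"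
    and m: "(\<Sum>t\<in>T. a t * q (\<phi> t)) \<le> m"
  shows "bprob P q (\<lambda>g. 2 * m + b * s \<le> (\<Sum>t\<in>T. a t * of_bool (g (\<phi> t)))) \<le> exp (- s)"
proof -
  define \<psi> where "\<psi> = the_inv_into T \<phi>"
  have \<psi>: "\<psi> (\<phi> t) = t" if "t \<in> T" for t using that T by (simp add: \<psi>_def the_inv_into_f_f)
  define f where "f = (\<lambda>e v. exp (a (\<psi> e) * of_bool v / b))"
  have eq: "exp ((\<Sum>t\<in>T. a t * of_bool (g (\<phi> t))) / b) = (\<Prod>e\<in>\<phi>`T. f e (g e))" for g
  proof -
    have "exp ((\<Sum>t\<in>T. a t * of_bool (g (\<phi> t))) / b) = (\<Prod>t\<in>T. exp (a t * of_bool (g (\<phi> t)) / b))"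
      unfolding sum_divide_distrib using T(1) by (rule exp_sum)
    then show ?thesis unfolding f_def by (simp add: prod.reindex[OF T(2)] \<psi> cong: prod.cong)
  qed
  have ex: "exp x \<le> 1 + 2 * x" if "0 \<le> x" "x \<le> 1" for x :: real
    using exp_bound[OF that] that mult_left_le[of x x] by (simp add: power2_eq_square)
  have "measure_pmf.expectation (bern P q) (\<lambda>g. exp ((\<Sum>t\<in>T. a t * of_bool (g (\<phi> t))) / b))
     = (\<Prod>e\<in>\<phi>`T. q e * f e True + (1 - q e) * f e False)"
    unfolding eq by (rule bern_expectation_prod[OF P _ T(3)]) (use q in \<open>auto simp: f_def\<close>)
  also have "\<dots> = (\<Prod>t\<in>T. q (\<phi> t) * exp (a t / b) + (1 - q (\<phi> t)))"
    by (simp add: prod.reindex[OF T(2)] f_def \<psi> cong: prod.cong)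
  also have "\<dots> \<le> (\<Prod>t\<in>T. exp (2 * (a t * q (\<phi> t)) / b))"
  proof (intro prod_mono conjI)
    fix t assume t: "t \<in> T"
    show "0 \<le> q (\<phi> t) * exp (a t / b) + (1 - q (\<phi> t))" using q[OF t] by simp
    have "q (\<phi> t) * exp (a t / b) \<le> q (\<phi> t) * (1 + 2 * (a t / b))"
      using q[OF t] a[OF t] b by (intro mult_left_mono ex) (auto simp: divide_simps)
    then have "q (\<phi> t) * exp (a t / b) + (1 - q (\<phi> t)) \<le> 1 + 2 * (a t * q (\<phi> t)) / b"
      by (simp add: algebra_simps)
    also have "\<dots> \<le> exp (2 * (a t * q (\<phi> t)) / b)" by (rule exp_ge_add_one_self)
    finally show "q (\<phi> t) * exp (a t / b) + (1 - q (\<phi> t)) \<le> exp (2 * (a t * q (\<phi> t)) / b)" .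
  qed
  also have "\<dots> = exp (2 * (\<Sum>t\<in>T. a t * q (\<phi> t)) / b)"
    using T(1) by (simp add: exp_sum sum_divide_distrib sum_distrib_left)
  also have "\<dots> \<le> exp (2 * m / b)" using m b by (simp add: divide_right_mono)
  finally have E: "measure_pmf.expectation (bern P q) (\<lambda>g. exp ((\<Sum>t\<in>T. a t * of_bool (g (\<phi> t))) / b)) \<le> exp (2 * m / b)" .
  have "bprob P q (\<lambda>g. 2 * m + b * s \<le> (\<Sum>t\<in>T. a t * of_bool (g (\<phi> t)))) =
     bprob P q (\<lambda>g. 2 * m / b + s \<le> (\<Sum>t\<in>T. a t * of_bool (g (\<phi> t))) / b)"
  proof -
    have "2 * m / b + s = (2 * m + b * s) / b" using b by (simp add: field_simps)
    then show ?thesis using b by (simp add: divide_le_cancel)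
  qed
  also have "\<dots> \<le> exp (2 * m / b) / exp (2 * m / b + s)"
    using bern_markov_exp[OF P] E by (rule order_trans[OF _ divide_right_mono]) simp_all
  also have "\<dots> = exp (- s)" by (simp add: exp_add exp_minus field_simps)
  finally show ?thesis .
qed

text \<open>The same method with parameter -1: \<open>exp (- 1) \<le> 1 / 2\<close> bounds each
  factor by \<open>1 - q / 2\<close>, whence the loss from \<open>m\<close> to
  \<open>m / 2\<close>.\<close>

lemma bern_chernoff_lower:
  assumes P: "finite P" and T: "finite T" "inj_on \<phi> T" "\<phi> ` T \<subseteq> P"
    and q: "\<And>t. t \<in> T \<Longrightarrow> 0 \<le> q (\<phi> t) \<and> q (\<phi> t) \<le> 1"
    and m: "m \<le> (\<Sum>t\<in>T. q (\<phi> t))"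
  shows "bprob P q (\<lambda>g. (\<Sum>t\<in>T. of_bool (g (\<phi> t))) \<le> m / 2 - s) \<le> exp (- s)"
proof -
  define f where "f = (\<lambda>(e::'a) v. exp (- of_bool v :: real))"
  have eq: "exp (- (\<Sum>t\<in>T. of_bool (g (\<phi> t)))) = (\<Prod>e\<in>\<phi>`T. f e (g e))" for g
  proof -
    have "exp (- (\<Sum>t\<in>T. of_bool (g (\<phi> t)) :: real)) = (\<Prod>t\<in>T. exp (- of_bool (g (\<phi> t))))"
      unfolding sum_negf[symmetric] using T(1) by (rule exp_sum)
    then show ?thesis unfolding f_def by (simp add: prod.reindex[OF T(2)])
  qed
  have e1: "exp (- 1 :: real) \<le> 1 / 2"
    using exp_ge_add_one_self[of 1] by (simp add: exp_minus field_simps)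
  have "measure_pmf.expectation (bern P q) (\<lambda>g. exp (- (\<Sum>t\<in>T. of_bool (g (\<phi> t)))))
     = (\<Prod>e\<in>\<phi>`T. q e * f e True + (1 - q e) * f e False)"
    unfolding eq by (rule bern_expectation_prod[OF P _ T(3)]) (use q in \<open>auto simp: f_def\<close>)
  also have "\<dots> = (\<Prod>t\<in>T. q (\<phi> t) * exp (- 1) + (1 - q (\<phi> t)))"
    by (simp add: prod.reindex[OF T(2)] f_def)
  also have "\<dots> \<le> (\<Prod>t\<in>T. exp (- q (\<phi> t) / 2))"
  proof (intro prod_mono conjI)
    fix t assume t: "t \<in> T"
    show "0 \<le> q (\<phi> t) * exp (- 1) + (1 - q (\<phi> t))" using q[OF t] by simp
    have "q (\<phi> t) * exp (- 1) \<le> q (\<phi> t) * (1 / 2)"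
      using q[OF t] by (intro mult_left_mono e1) auto
    then have "q (\<phi> t) * exp (- 1) + (1 - q (\<phi> t)) \<le> 1 + (- q (\<phi> t) / 2)"
      by (simp add: algebra_simps)
    also have "\<dots> \<le> exp (- q (\<phi> t) / 2)" by (rule exp_ge_add_one_self)
    finally show "q (\<phi> t) * exp (- 1) + (1 - q (\<phi> t)) \<le> exp (- q (\<phi> t) / 2)" .
  qed
  also have "\<dots> = exp (- (\<Sum>t\<in>T. q (\<phi> t)) / 2)"
    using T(1) by (simp add: exp_sum sum_divide_distrib sum_negf[symmetric])
  also have "\<dots> \<le> exp (- m / 2)" using m by simp
  finally have E: "measure_pmf.expectation (bern P q) (\<lambda>g. exp (- (\<Sum>t\<in>T. of_bool (g (\<phi> t))))) \<le> exp (- m / 2)" .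
  have "bprob P q (\<lambda>g. (\<Sum>t\<in>T. of_bool (g (\<phi> t))) \<le> m / 2 - s) =
     bprob P q (\<lambda>g. s - m / 2 \<le> - (\<Sum>t\<in>T. of_bool (g (\<phi> t))))"
    by (rule arg_cong[where f = "measure_pmf.prob _"]) (auto simp: algebra_simps)
  also have "\<dots> \<le> exp (- m / 2) / exp (s - m / 2)"
    using bern_markov_exp[OF P] E by (rule order_trans[OF _ divide_right_mono]) simp_all
  also have "\<dots> = exp (- s)" by (simp flip: exp_diff)
  finally show ?thesis .
qed

lemma bern_none:
  assumes P: "finite P" and T: "finite T" "inj_on \<phi> T" "\<phi> ` T \<subseteq> P"
    and q: "\<And>t. t \<in> T \<Longrightarrow> 0 \<le> q (\<phi> t) \<and> q (\<phi> t) \<le> 1"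
  shows "bprob P q (\<lambda>g. \<forall>t\<in>T. \<not> g (\<phi> t)) = (\<Prod>t\<in>T. 1 - q (\<phi> t))"
proof -
  have eq: "indicator {g. \<forall>t\<in>T. \<not> g (\<phi> t)} g = (\<Prod>e\<in>\<phi>`T. of_bool (\<not> g e) :: real)" for g
  proof (cases "\<forall>t\<in>T. \<not> g (\<phi> t)")
    case True
    then show ?thesis by (simp add: prod.reindex[OF T(2)])
  next
    case False
    then obtain t where "t \<in> T" "g (\<phi> t)" by blast
    then have "(\<Prod>e\<in>\<phi>`T. of_bool (\<not> g e) :: real) = 0"
      using T(1) by (intro prod_zero) auto
    then show ?thesis using False by simp
  qed
  have "bprob P q (\<lambda>g. \<forall>t\<in>T. \<not> g (\<phi> t)) =
      measure_pmf.expectation (bern P q) (indicator {g. \<forall>t\<in>T. \<not> g (\<phi> t)})" by simp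
  also have "\<dots> = measure_pmf.expectation (bern P q) (\<lambda>g. \<Prod>e\<in>\<phi>`T. of_bool (\<not> g e) :: real)"
    by (intro Bochner_Integration.integral_cong refl eq)
  also have "\<dots> = (\<Prod>e\<in>\<phi>`T. q e * of_bool (\<not> True) + (1 - q e) * of_bool (\<not> False))"
    by (rule bern_expectation_prod[OF P _ T(3)]) (use q in auto)
  also have "\<dots> = (\<Prod>t\<in>T. 1 - q (\<phi> t))" by (simp add: prod.reindex[OF T(2)])
  finally show ?thesis .
qed

text \<open>A predicate of finitely many independent indicators depends only on the pattern of hits,
  so its event is a finite disjoint union of boxes. Used both for weights above a threshold and for
  the uniform variables that decide the edges.\<close>

lemma PiM_bern:
  assumes I: "finite I" and M: "\<And>i. prob_space (M i)" and A: "\<And>i. i \<in> I \<Longrightarrow> A i \<in> sets (M i)"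
  shows "{x \<in> space (PiM I M). Q (\<lambda>i. i \<in> I \<and> x i \<in> A i)} \<in> sets (PiM I M)"
    and "measure (PiM I M) {x \<in> space (PiM I M). Q (\<lambda>i. i \<in> I \<and> x i \<in> A i)} =
      bprob I (\<lambda>i. measure (M i) (A i)) Q"
proof -
  interpret product_prob_space M I by (rule product_prob_spaceI) (rule M)
  define box where "box g = (\<Pi>\<^sub>E i\<in>I. if g i then A i else space (M i) - A i)" for g
  \<comment> \<open>Patterns are pinned to \<open>False\<close> off \<open>I\<close>, which makes
    them finitely many and matches the default of \<open>bern\<close>.\<close>
  define G where "G = {g. Q g \<and> (\<forall>i. i \<notin> I \<longrightarrow> \<not> g i)}"
  have finG: "finite G"
  proof (rule finite_subset)
    show "G \<subseteq> PiE_dflt I False (\<lambda>_. UNIV)" by (auto simp: G_def PiE_dflt_def)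
  qed (use I in auto)
  have eq: "{x \<in> space (PiM I M). Q (\<lambda>i. i \<in> I \<and> x i \<in> A i)} = (\<Union>g\<in>G. box g)"
  proof (intro set_eqI iffI)
    fix x assume x: "x \<in> {x \<in> space (PiM I M). Q (\<lambda>i. i \<in> I \<and> x i \<in> A i)}"
    then have "x \<in> box (\<lambda>i. i \<in> I \<and> x i \<in> A i)" "(\<lambda>i. i \<in> I \<and> x i \<in> A i) \<in> G"
      by (auto simp: box_def G_def space_PiM PiE_iff)
    then show "x \<in> (\<Union>g\<in>G. box g)" by blast
  next
    fix x assume "x \<in> (\<Union>g\<in>G. box g)"
    then obtain g where g: "g \<in> G" "x \<in> box g" by blast
    then have x: "x i \<in> (if g i then A i else space (M i) - A i)" if "i \<in> I" for i
      using that by (auto simp: box_def PiE_iff split: if_splits)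
    then have "g = (\<lambda>i. i \<in> I \<and> x i \<in> A i)" using g(1) by (fastforce simp: G_def split: if_splits)
    moreover have "x \<in> space (PiM I M)"
      using g(2) A sets.sets_into_space by (fastforce simp: box_def space_PiM PiE_iff split: if_splits)
    ultimately show "x \<in> {x \<in> space (PiM I M). Q (\<lambda>i. i \<in> I \<and> x i \<in> A i)}"
      using g(1) by (auto simp: G_def)
  qed
  have box: "box g \<in> sets (PiM I M)" for g
    unfolding box_def using A I by (intro sets_PiM_I_finite) auto
  show "{x \<in> space (PiM I M). Q (\<lambda>i. i \<in> I \<and> x i \<in> A i)} \<in> sets (PiM I M)"
    unfolding eq using finG box by blast
  have disj: "disjoint_family_on box G"
    unfolding disjoint_family_on_def
  proof (intro ballI impI)
    fix g g' assume g: "g \<in> G" "g' \<in> G" "g \<noteq> g'"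
    then obtain i where i: "g i \<noteq> g' i" by auto
    then have "i \<in> I" using g by (auto simp: G_def)
    then show "box g \<inter> box g' = {}" using i by (fastforce simp: box_def PiE_iff split: if_splits)
  qed
  have "measure (PiM I M) (\<Union>g\<in>G. box g) = (\<Sum>g\<in>G. measure (PiM I M) (box g))"
    by (rule finite_measure_finite_Union) (use finG box disj in auto)
  also have "\<dots> = (\<Sum>g\<in>G. pmf (bern I (\<lambda>i. measure (M i) (A i))) g)"
  proof (intro sum.cong refl)
    fix g assume g: "g \<in> G"
    interpret F: finite_product_prob_space M I by unfold_locales (rule I)
    have "measure (PiM I M) (box g) = (\<Prod>i\<in>I. measure (M i) (if g i then A i else space (M i) - A i))"
      unfolding box_def using A by (intro F.finite_measure_PiM_emb) auto
    also have "\<dots> = (\<Prod>i\<in>I. pmf (bernoulli_pmf (measure (M i) (A i))) (g i))"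
    proof (intro prod.cong refl)
      fix i assume i: "i \<in> I"
      show "measure (M i) (if g i then A i else space (M i) - A i) = pmf (bernoulli_pmf (measure (M i) (A i))) (g i)"
        using A[OF i] by (auto simp: prob_space.prob_compl[OF M])
    qed
    also have "\<dots> = pmf (bern I (\<lambda>i. measure (M i) (A i))) g"
      using g unfolding bern_def by (subst pmf_Pi) (use I in \<open>auto simp: G_def\<close>)
    finally show "measure (PiM I M) (box g) = pmf (bern I (\<lambda>i. measure (M i) (A i))) g" .
  qed
  also have "\<dots> = measure_pmf.prob (bern I (\<lambda>i. measure (M i) (A i))) G"
    by (rule measure_measure_pmf_finite[symmetric]) (rule finG)
  also have "\<dots> = bprob I (\<lambda>i. measure (M i) (A i)) Q"
  proof (rule measure_pmf.finite_measure_eq_AE, goal_cases)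
    case 1
    show ?case
    proof (rule AE_pmfI)
      fix g assume "g \<in> set_pmf (bern I (\<lambda>i. measure (M i) (A i)))"
      then have "\<forall>i. i \<notin> I \<longrightarrow> \<not> g i" unfolding bern_def using set_Pi_pmf_subset[OF I, of False] by auto
      then show "(g \<in> G) = (g \<in> {g. Q g})" by (simp add: G_def)
    qed
  qed auto
  finally show "measure (PiM I M) {x \<in> space (PiM I M). Q (\<lambda>i. i \<in> I \<and> x i \<in> A i)} =
      bprob I (\<lambda>i. measure (M i) (A i)) Q" unfolding eq .
qed

section \<open>Random graphs with given weights\<close>

definition vpairs :: "nat \<Rightarrow> (nat \<times> nat) set" where
  "vpairs n = {(i, j). i < j \<and> j < n}"

definition upair :: "nat \<times> nat \<Rightarrow> nat \<times> nat" where
  "upair e = (min (fst e) (snd e), max (fst e) (snd e))"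

definition egraph :: "nat \<Rightarrow> (nat \<times> nat \<Rightarrow> bool) \<Rightarrow> nat \<Rightarrow> nat \<Rightarrow> bool" where
  "egraph n g x y \<longleftrightarrow> x < n \<and> y < n \<and> x \<noteq> y \<and> g (upair (x, y))"

lemma finite_vpairs [simp]: "finite (vpairs n)"
  by (rule finite_subset[of _ "{..<n} \<times> {..<n}"]) (auto simp: vpairs_def)

lemma upair_sym: "upair (x, y) = upair (y, x)" by (auto simp: upair_def)

lemma egraph_sym_graph: "sym_graph (egraph n g) n"
  by unfold_locales (auto simp: egraph_def upair_sym)

text \<open>Disjointness ensures that no unordered pair occurs in both orders, so summing over
  \<open>S \<times> T\<close> uses distinct, hence independent, coordinates.\<close>

lemma upair_inj: "S \<inter> T = {} \<Longrightarrow> inj_on upair (S \<times> T)"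
  by (rule inj_onI) (auto simp: upair_def min_def max_def split: if_splits)

lemma upair_vpairs: "S \<subseteq> {..<n} \<Longrightarrow> T \<subseteq> {..<n} \<Longrightarrow> S \<inter> T = {} \<Longrightarrow> upair ` (S \<times> T) \<subseteq> vpairs n"
  by (auto simp: upair_def vpairs_def min_def max_def) (metis IntI empty_iff nat_neq_iff not_le)+

definition touch :: "nat set \<Rightarrow> (nat \<times> nat) set" where
  "touch A = {e. fst e \<in> A \<or> snd e \<in> A}"

lemma egraph_touch:
  fixes g g' :: "nat \<times> nat \<Rightarrow> bool"
  shows "(\<And>e. e \<in> touch A \<Longrightarrow> g e = g' e) \<Longrightarrow> u \<in> A \<Longrightarrow> egraph n g u y = egraph n g' u y"
  by (auto simp: egraph_def touch_def upair_def min_def max_def)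

lemma bfs_cong_aux:
  assumes "\<And>u y. u \<in> bfs E x i \<Longrightarrow> E u y = E' u y" "j \<le> Suc i"
  shows "bfs E' x j = bfs E x j"
  using assms(2)
proof (induction j)
  case (Suc j)
  then have "bfs E x j \<subseteq> bfs E x i" using bfs_mono[of j i E x] by auto
  then have "E u y = E' u y" if "u \<in> bfs E x j" for u y using assms(1) that by blast
  then have "{y. \<exists>u\<in>bfs E x j. E' u y} = {y. \<exists>u\<in>bfs E x j. E u y}" by blast
  then show ?case using Suc by simp
qed simp

text \<open>Both balls are computed from the neighbourhoods of vertices of \<open>A\<close> alone,
  since the step to \<open>Suc i\<close> only follows edges that start in the ball at
  \<open>i\<close>.\<close>

lemma dep_explore:
  "dep_on (touch A) (\<lambda>g. bfs (egraph n g) x i = A \<and> bfs (egraph n g) x (Suc i) = B)"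
proof -
  have *: "bfs (egraph n g') x i = A \<and> bfs (egraph n g') x (Suc i) = B"
    if "\<forall>e\<in>touch A. g e = g' e" "bfs (egraph n g) x i = A \<and> bfs (egraph n g) x (Suc i) = B" for g g'
  proof -
    have "egraph n g u y = egraph n g' u y" if "u \<in> bfs (egraph n g) x i" for u y
      using egraph_touch[of A g g' u n y] that \<open>\<forall>e\<in>touch A. g e = g' e\<close>
        \<open>bfs (egraph n g) x i = A \<and> bfs (egraph n g) x (Suc i) = B\<close> by blast
    then have "bfs (egraph n g') x j = bfs (egraph n g) x j" if "j \<le> Suc i" for j
      using bfs_cong_aux[of "egraph n g" x i "egraph n g'" j] that by blast
    then show ?thesis using that(2) by (metis le_SucI order_refl)
  qed
  show ?thesis unfolding dep_on_def
  proof (intro allI impI iffI)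
    fix g g' :: "nat \<times> nat \<Rightarrow> bool" assume a: "\<forall>e\<in>touch A. g e = g' e"
    { assume "bfs (egraph n g) x i = A \<and> bfs (egraph n g) x (Suc i) = B"
      then show "bfs (egraph n g') x i = A \<and> bfs (egraph n g') x (Suc i) = B" using * a by blast
    next
      assume "bfs (egraph n g') x i = A \<and> bfs (egraph n g') x (Suc i) = B"
      moreover have "\<forall>e\<in>touch A. g' e = g e" using a by auto
      ultimately show "bfs (egraph n g) x i = A \<and> bfs (egraph n g) x (Suc i) = B" using *[of g' g] by blast }
  qed
qed

text \<open>There are exponentially many candidate pairs \<open>(A, B)\<close>, but each graph
  realizes exactly one. The edges on which \<open>F\<close> depends have no endpoint in
  \<open>A\<close>, so the exploration has not revealed them.\<close>

lemma bfs_explore: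
  assumes P: "finite P" and x: "x < n" and e: "0 \<le> \<epsilon>"
    and F: "\<And>A B. A \<subseteq> B \<Longrightarrow> B \<subseteq> {..<n} \<Longrightarrow> dep_on (upair ` ((B - A) \<times> ({..<n} - B))) (F A B)"
       "\<And>A B. A \<subseteq> B \<Longrightarrow> B \<subseteq> {..<n} \<Longrightarrow> bprob P q (F A B) \<le> \<epsilon>"
  shows "bprob P q (\<lambda>g. F (bfs (egraph n g) x i) (bfs (egraph n g) x (Suc i)) g) \<le> \<epsilon>"
proof -
  define Kx where "Kx = {(A, B). A \<subseteq> B \<and> B \<subseteq> {..<n}}"
  have "finite (Pow {..<n} \<times> Pow {..<n})" by simp
  then have fin: "finite Kx" by (rule rev_finite_subset) (auto simp: Kx_def)
  have "bprob P q (\<lambda>g. F (bfs (egraph n g) x i) (bfs (egraph n g) x (Suc i)) g) =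
    bprob P q (\<lambda>g. \<exists>k\<in>Kx. (bfs (egraph n g) x i = fst k \<and> bfs (egraph n g) x (Suc i) = snd k) \<and> F (fst k) (snd k) g)"
  proof (rule arg_cong[where f = "measure_pmf.prob _"], intro Collect_cong iffI)
    fix g assume "F (bfs (egraph n g) x i) (bfs (egraph n g) x (Suc i)) g"
    moreover have "(bfs (egraph n g) x i, bfs (egraph n g) x (Suc i)) \<in> Kx"
      using sym_graph.bfs_dom[OF egraph_sym_graph x, of g "Suc i"] bfs_mono_Suc unfolding Kx_def by blast
    ultimately show "\<exists>k\<in>Kx. (bfs (egraph n g) x i = fst k \<and> bfs (egraph n g) x (Suc i) = snd k) \<and> F (fst k) (snd k) g"
      by (intro bexI[of _ "(bfs (egraph n g) x i, bfs (egraph n g) x (Suc i))"]) auto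
  qed auto
  also have "\<dots> \<le> \<epsilon>"
  proof (rule bern_explore[OF P fin, where J = "\<lambda>k. touch (fst k)" and J' = "\<lambda>k. upair ` ((snd k - fst k) \<times> ({..<n} - snd k))"])
    fix k assume k: "k \<in> Kx"
    show "dep_on (touch (fst k)) (\<lambda>g. bfs (egraph n g) x i = fst k \<and> bfs (egraph n g) x (Suc i) = snd k)"
      by (rule dep_explore)
    show "dep_on (upair ` ((snd k - fst k) \<times> ({..<n} - snd k))) (F (fst k) (snd k))"
      using F(1) k by (auto simp: Kx_def)
    show "bprob P q (F (fst k) (snd k)) \<le> \<epsilon>" using F(2) k by (auto simp: Kx_def)
    show "touch (fst k) \<inter> upair ` ((snd k - fst k) \<times> ({..<n} - snd k)) = {}"
      using k by (auto simp: Kx_def touch_def upair_def min_def max_def split: if_splits)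
  qed (use e in \<open>auto simp: prod_eq_iff\<close>)
  finally show ?thesis .
qed

lemma dep_on_sum:
  "(\<And>t. t \<in> T \<Longrightarrow> \<phi> t \<in> J) \<Longrightarrow> dep_on J (\<lambda>g. R (\<Sum>t\<in>T. a t * of_bool (g (\<phi> t)) :: real))"
proof -
  assume "\<And>t. t \<in> T \<Longrightarrow> \<phi> t \<in> J"
  then have "(\<Sum>t\<in>T. a t * of_bool (g (\<phi> t)) :: real) = (\<Sum>t\<in>T. a t * of_bool (g' (\<phi> t)))"
    if "\<forall>e\<in>J. g e = g' e" for g g'
    using that by (intro sum.cong refl) simp
  then show ?thesis unfolding dep_on_def by metis
qed

lemma dep_on_none: "dep_on J (\<lambda>g. \<forall>e\<in>J'. \<not> g e)" if "J' \<subseteq> J"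
  using that unfolding dep_on_def by blast

lemma dep_on_conj: "dep_on J Q \<Longrightarrow> dep_on J R \<Longrightarrow> dep_on J (\<lambda>g. Q g \<and> R g)"
  unfolding dep_on_def by metis

lemma dep_on_const: "dep_on J (\<lambda>g. Q)"
  unfolding dep_on_def by metis

definition eprob :: "nat \<Rightarrow> (nat \<Rightarrow> real) \<Rightarrow> nat \<times> nat \<Rightarrow> real" where
  "eprob n p e = min (p (fst e) * p (snd e) / (\<Sum>v<n. p v)) 1"

text \<open>The weight sits on the second endpoint: for \<open>a = 1\<close> this counts the edges
  between \<open>S\<close> and \<open>T\<close>; in general a vertex of \<open>T\<close> is counted
  once for each of its edges to \<open>S\<close>.\<close>

definition esum :: "(nat \<Rightarrow> real) \<Rightarrow> nat set \<Rightarrow> nat set \<Rightarrow> (nat \<times> nat \<Rightarrow> bool) \<Rightarrow> real" where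
  "esum a S T g = (\<Sum>t\<in>S \<times> T. a (snd t) * of_bool (g (upair t)))"

lemma dep_on_esum: "S \<times> T \<subseteq> U \<Longrightarrow> dep_on (upair ` U) (\<lambda>g. R (esum a S T g))"
  unfolding esum_def by (rule dep_on_sum) auto

locale weighted_graph =
  fixes n :: nat and p :: "nat \<Rightarrow> real" and xmin C1 :: real
  assumes xmin: "0 < xmin" and n2: "2 \<le> n"
    and p_ge: "\<And>v. v < n \<Longrightarrow> xmin \<le> p v" and p_le: "\<And>v. v < n \<Longrightarrow> p v \<le> real n"
    and vol_le: "(\<Sum>v<n. p v) \<le> C1 * real n"
begin

definition vol where "vol = (\<Sum>v<n. p v)"
abbreviation q where "q \<equiv> eprob n p"
abbreviation Pr where "Pr \<equiv> bprob (vpairs n) q"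

text \<open>The expected degree of \<open>v\<close> lies between \<open>c0 * p v\<close> and \<open>p v\<close>.\<close>

definition c0 where "c0 = xmin / (2 * C1)"

lemma p_pos: "v < n \<Longrightarrow> 0 < p v" using p_ge[of v] xmin by simp

lemma vol_ge: "real n * xmin \<le> vol"
  using sum_mono[of "{..<n}" "\<lambda>_. xmin" p] p_ge by (simp add: vol_def)

lemma vol_pos: "0 < vol"
  using vol_ge xmin n2 by (smt (verit) mult_pos_pos of_nat_0_less_iff of_nat_less_iff pos2 order_less_le_trans)

lemma C1_pos: "0 < C1"
proof -
  have "0 < C1 * real n" using vol_le vol_pos by (simp add: vol_def)
  then show ?thesis using n2 by (simp add: zero_less_mult_iff)
qed

lemma c0_pos: "0 < c0" using xmin C1_pos by (simp add: c0_def)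

lemma q_upair: "q (upair (u, y)) = min (p u * p y / vol) 1"
  by (auto simp: eprob_def upair_def vol_def min_def max_def mult.commute)

lemma q_range: "u < n \<Longrightarrow> y < n \<Longrightarrow> 0 \<le> q (upair (u, y)) \<and> q (upair (u, y)) \<le> 1"
  using p_pos[of u] p_pos[of y] vol_pos by (simp add: q_upair)

lemma q_le: "q (upair (u, y)) \<le> p u * p y / vol" by (simp add: q_upair)

text \<open>The cap at 1 is harmless against a partner of minimal weight, because
  \<open>p u \<le> n\<close> and the volume is at least \<open>n * xmin\<close>.\<close>

lemma q_ge:
  assumes "u < n" "y < n"
  shows "p u * xmin / vol \<le> q (upair (u, y))"
proof -
  have "p u * xmin \<le> vol" using p_le[OF assms(1)] vol_ge xmin
    by (meson mult_right_mono order_trans less_imp_le)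
  moreover have "p u * xmin \<le> p u * p y" using p_ge[OF assms(2)] p_pos[OF assms(1)] by simp
  ultimately show ?thesis using vol_pos by (simp add: q_upair divide_right_mono)
qed

lemma esum_upper:
  assumes S: "S \<subseteq> {..<n}" and T: "T \<subseteq> {..<n}" and ST: "S \<inter> T = {}"
    and a: "\<And>t. t \<in> T \<Longrightarrow> 0 \<le> a t \<and> a t \<le> b" and b: "0 < b"
    and m: "(\<Sum>u\<in>S. p u) * (\<Sum>y\<in>T. a y * p y) / vol \<le> m"
  shows "Pr (\<lambda>g. 2 * m + b * s \<le> esum a S T g) \<le> exp (- s)"
  unfolding esum_def
proof (rule bern_chernoff_upper)
  show "finite (S \<times> T)" using S T finite_subset by blast
  show "inj_on upair (S \<times> T)" using ST by (rule upair_inj)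
  show "upair ` (S \<times> T) \<subseteq> vpairs n" using upair_vpairs S T ST by blast
  show "0 \<le> q (upair t) \<and> q (upair t) \<le> 1" if "t \<in> S \<times> T" for t
    using that S T q_range by (cases t) auto
  have "(\<Sum>t\<in>S \<times> T. a (snd t) * q (upair t)) \<le> (\<Sum>t\<in>S \<times> T. p (fst t) * (a (snd t) * p (snd t)) / vol)"
  proof (rule sum_mono)
    fix t assume "t \<in> S \<times> T"
    then have "a (snd t) * q (upair t) \<le> a (snd t) * (p (fst t) * p (snd t) / vol)"
      using a q_le by (intro mult_left_mono) auto
    then show "a (snd t) * q (upair t) \<le> p (fst t) * (a (snd t) * p (snd t)) / vol"
      by (simp add: algebra_simps)
  qed
  also have "\<dots> = (\<Sum>u\<in>S. p u) * (\<Sum>y\<in>T. a y * p y) / vol"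
    by (simp add: sum_divide_distrib[symmetric] sum.cartesian_product' sum_product)
  finally show "(\<Sum>t\<in>S \<times> T. a (snd t) * q (upair t)) \<le> m" using m by simp
qed (use a b in auto)

text \<open>The constant \<open>c0\<close> absorbs three losses: partners are counted with the
  minimal weight \<open>xmin\<close>, only half of the vertices need to lie in \<open>T\<close>, and
  the volume is only known to be at most \<open>C1 * n\<close>.\<close>

lemma esum_lower:
  assumes S: "S \<subseteq> {..<n}" and T: "T \<subseteq> {..<n}" and ST: "S \<inter> T = {}"
    and T2: "real n \<le> 2 * real (card T)"
    and m: "m \<le> c0 * (\<Sum>u\<in>S. p u)"
  shows "Pr (\<lambda>g. esum (\<lambda>_. 1) S T g \<le> m / 2 - s) \<le> exp (- s)"
proof -
  have "Pr (\<lambda>g. (\<Sum>t\<in>S \<times> T. of_bool (g (upair t))) \<le> m / 2 - s) \<le> exp (- s)"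
  proof (rule bern_chernoff_lower)
    show "finite (S \<times> T)" using S T finite_subset by blast
    show "inj_on upair (S \<times> T)" using ST by (rule upair_inj)
    show "upair ` (S \<times> T) \<subseteq> vpairs n" using upair_vpairs S T ST by blast
    show "0 \<le> q (upair t) \<and> q (upair t) \<le> 1" if "t \<in> S \<times> T" for t
      using that S T q_range by (cases t) auto
    have ps: "0 \<le> (\<Sum>u\<in>S. p u)" using S p_pos by (intro sum_nonneg) (auto simp: less_imp_le)
    have "c0 * (\<Sum>u\<in>S. p u) \<le> card T * xmin / vol * (\<Sum>u\<in>S. p u)"
    proof (rule mult_right_mono[OF _ ps])
      have "xmin * vol \<le> xmin * (C1 * n)" using vol_le xmin by (simp add: vol_def)
      also have "\<dots> \<le> xmin * (C1 * (2 * real (card T)))"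
        using T2 xmin C1_pos by (intro mult_left_mono) auto
      finally show "c0 \<le> card T * xmin / vol"
        using vol_pos C1_pos by (simp add: c0_def field_simps)
    qed
    also have "\<dots> = (\<Sum>t\<in>S \<times> T. p (fst t) * xmin / vol)"
      by (simp add: sum_divide_distrib[symmetric] sum.cartesian_product' sum_distrib_right[symmetric] sum_distrib_left[symmetric] field_simps)
    also have "\<dots> \<le> (\<Sum>t\<in>S \<times> T. q (upair t))"
    proof (rule sum_mono)
      fix t assume "t \<in> S \<times> T"
      then show "p (fst t) * xmin / vol \<le> q (upair t)" using S T q_ge by (cases t) auto
    qed
    finally show "m \<le> (\<Sum>t\<in>S \<times> T. q (upair t))" using m by simp
  qed simp
  then show ?thesis by (simp add: esum_def)
qed

lemma esum_none:
  assumes S: "S \<subseteq> {..<n}" and T: "T \<subseteq> {..<n}" and ST: "S \<inter> T = {}"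
  shows "Pr (\<lambda>g. \<forall>e\<in>upair ` (S \<times> T). \<not> g e) \<le> exp (- ((\<Sum>u\<in>S. p u) * (\<Sum>y\<in>T. p y) / vol))"
proof -
  have "Pr (\<lambda>g. \<forall>e\<in>upair ` (S \<times> T). \<not> g e) = Pr (\<lambda>g. \<forall>t\<in>S \<times> T. \<not> g (upair t))" by simp
  also have "\<dots> = (\<Prod>t\<in>S \<times> T. 1 - q (upair t))"
  proof (rule bern_none)
    show "finite (S \<times> T)" using S T finite_subset by blast
    show "inj_on upair (S \<times> T)" using ST by (rule upair_inj)
    show "upair ` (S \<times> T) \<subseteq> vpairs n" using upair_vpairs S T ST by blast
    show "0 \<le> q (upair t) \<and> q (upair t) \<le> 1" if "t \<in> S \<times> T" for t
      using that S T q_range by (cases t) auto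
  qed simp
  also have "\<dots> \<le> (\<Prod>t\<in>S \<times> T. exp (- (p (fst t) * p (snd t) / vol)))"
  proof (intro prod_mono conjI)
    fix t assume t: "t \<in> S \<times> T"
    then have r: "0 \<le> q (upair t) \<and> q (upair t) \<le> 1" using S T q_range by (cases t) auto
    then show "0 \<le> 1 - q (upair t)" by simp
    have qe: "q (upair t) = min (p (fst t) * p (snd t) / vol) 1" using q_upair[of "fst t" "snd t"] by simp
    \<comment> \<open>If the probability is capped at 1, the left side is 0, so the uncapped product
      may stand in the exponent.\<close>
    show "1 - q (upair t) \<le> exp (- (p (fst t) * p (snd t) / vol))"
      using exp_ge_add_one_self[of "- (p (fst t) * p (snd t) / vol)"]
      by (auto simp: qe min_def)
  qed
  also have "\<dots> = exp (- (\<Sum>t\<in>S \<times> T. p (fst t) * p (snd t) / vol))"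
    using S T finite_subset[of S "{..<n}"] finite_subset[of T "{..<n}"] by (simp add: exp_sum sum_negf[symmetric])
  also have "(\<Sum>t\<in>S \<times> T. p (fst t) * p (snd t) / vol) = (\<Sum>u\<in>S. p u) * (\<Sum>y\<in>T. p y) / vol"
    by (simp add: sum_divide_distrib[symmetric] sum.cartesian_product' sum_product)
  finally show ?thesis .
qed

end

section \<open>Exceptional events for regular weights\<close>

lemma pmf_union_bound:
  assumes "finite I" "\<And>i. i \<in> I \<Longrightarrow> measure_pmf.prob M {g. Q i g} \<le> c"
  shows "measure_pmf.prob M {g. \<exists>i\<in>I. Q i g} \<le> real (card I) * c"
proof -
  have "measure_pmf.prob M {g. \<exists>i\<in>I. Q i g} = measure_pmf.prob M (\<Union>i\<in>I. {g. Q i g})"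
    by (rule arg_cong[where f = "measure_pmf.prob M"]) auto
  also have "\<dots> \<le> (\<Sum>i\<in>I. measure_pmf.prob M {g. Q i g})"
    by (rule measure_pmf.finite_measure_subadditive_finite) (use assms in auto)
  also have "\<dots> \<le> (\<Sum>i\<in>I. c)" by (intro sum_mono assms)
  finally show ?thesis by simp
qed

lemma pmf_union2:
  assumes "measure_pmf.prob M {g. Q g} \<le> c" "measure_pmf.prob M {g. R g} \<le> d"
  shows "measure_pmf.prob M {g. Q g \<or> R g} \<le> c + d"
proof -
  have "measure_pmf.prob M {g. Q g \<or> R g} = measure_pmf.prob M ({g. Q g} \<union> {g. R g})"
    by (rule arg_cong[where f = "measure_pmf.prob M"]) auto
  also have "\<dots> \<le> measure_pmf.prob M {g. Q g} + measure_pmf.prob M {g. R g}"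
    by (rule measure_Un_le) auto
  finally show ?thesis using assms by simp
qed

lemma pmf_prob_mono:
  "(\<And>g. Q g \<Longrightarrow> R g) \<Longrightarrow> measure_pmf.prob M {g. Q g} \<le> measure_pmf.prob M {g. R g}"
  by (rule measure_pmf.finite_measure_mono) auto

text \<open>All that the edge estimates need to know about the weights. The conditions on
  \<open>w\<close> give the hub degree at least \<open>K\<close> and let a given sphere of weight
  above \<open>\<theta> / 4\<close> miss it with probability at most \<open>n powr -4\<close>;
  \<open>heavy\<close> does the same for a given set of at least \<open>\<theta>\<close> light
  vertices against all heavy ones together. \<open>M\<close> is a normalized moment of order
  \<open>4 - b\<close>, and \<open>Hb\<close> bounds the number of vertices that can have degree at
  least \<open>K\<close>.\<close>

locale regular_weights = weighted_graph +
  fixes b K \<theta> L C2 M Hb :: real and w :: nat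
  assumes b: "2 < b" "b < 3" and L: "L = ln (real n)"
    and K_ge: "8 * L \<le> K" and \<theta>_ge: "8 * L \<le> \<theta>" and \<theta>_le: "6 * \<theta> \<le> real n" and L_ge: "xmin \<le> 4 * L"
    and w: "w < n" "4 * K \<le> c0 * p w" "16 * C1 * real n * L \<le> \<theta> * p w"
    and heavy: "4 * C1 * real n * L \<le> \<theta> * xmin * (\<Sum>v | v < n \<and> 16 * \<theta> / c0 \<le> p v. p v)"
    and C2: "0 \<le> C2" and tail_vol: "\<And>t. xmin \<le> t \<Longrightarrow> t \<le> 4 * K / c0 \<Longrightarrow>
      (\<Sum>v | v < n \<and> t \<le> p v \<and> p v \<le> 4 * K / c0. p v) \<le> C2 * real n * t powr (2 - b)"
    and M: "(\<Sum>v | v < n \<and> p v \<le> 4 * K / c0. p v powr (4 - b)) \<le> real n * M"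
    and Hb: "real (card {v. v < n \<and> K / 4 \<le> p v}) \<le> Hb"
begin

text \<open>Vertices of degree less than \<open>K\<close> have weight at most \<open>wcap\<close>, and vertices of weight at least
  \<open>th\<close> have degree at least \<open>4 * \<theta>\<close>.\<close>

definition wcap where "wcap = 4 * K / c0"
definition th where "th = 16 * \<theta> / c0"
definition Light where "Light = {v. v < n \<and> p v < th}"
definition Heavy where "Heavy = {v. v < n \<and> th \<le> p v}"
definition light_graph where "light_graph g u v \<longleftrightarrow> egraph n g u v \<and> u \<in> Light \<and> v \<in> Light"
definition nbr_const where "nbr_const = C2 / xmin * (c0 / 8) powr (2 - b)"
text \<open>A sphere weight of \<open>4 * \<theta> / c0\<close> times \<open>M / xmin\<close>, which
  bounds the mean spread per unit of sphere weight.\<close>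

definition spread_mean where "spread_mean = 4 * \<theta> * M / (c0 * xmin)"

text \<open>Up to constants, \<open>spread_weight z\<close> is the mean number of neighbours of \<open>z\<close> whose degree is
  between that of \<open>z\<close> and \<open>K\<close>.\<close>

definition spread_weight where "spread_weight y = (if p y \<le> wcap then p y powr (3 - b) else 0)"
text \<open>Twice the mean plus the largest summand times the slack \<open>4 * L\<close>: the form
  delivered by \<open>esum_upper\<close>.\<close>

definition spread_bound where "spread_bound = 2 * spread_mean + wcap powr (3 - b) * (4 * L)"

lemma L_pos: "0 < L" using n2 by (simp add: L)
lemma \<theta>_pos: "0 < \<theta>" using L_pos \<theta>_ge by simp
lemma K_pos: "0 < K" using L_pos K_ge by simp
lemma wcap_pos: "0 < wcap" using K_pos c0_pos by (simp add: wcap_def)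

lemma M_nonneg: "0 \<le> M"
proof -
  have "0 \<le> real n * M" by (rule order_trans[OF _ M]) (auto intro!: sum_nonneg)
  then show ?thesis using n2 by (simp add: zero_le_mult_iff)
qed

lemma expL: "exp (- 4 * L) = 1 / real n ^ 4"
proof -
  have "exp (4 * L) = real n ^ 4" using n2 by (simp add: L exp_of_nat_mult[of 4, simplified])
  then show ?thesis by (simp add: exp_minus inverse_eq_divide)
qed

lemma prob_deg_upper:
  assumes "v < n"
  shows "Pr (\<lambda>g. 2 * p v + 4 * L \<le> esum (\<lambda>_. 1) {v} ({..<n} - {v}) g) \<le> exp (- 4 * L)"
proof -
  have "(\<Sum>y\<in>{..<n} - {v}. p y) \<le> vol" unfolding vol_def
    by (rule sum_mono2) (use p_pos in \<open>auto simp: less_imp_le\<close>)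
  then have m: "(\<Sum>u\<in>{v}. p u) * (\<Sum>y\<in>{..<n} - {v}. 1 * p y) / vol \<le> p v"
    using p_pos[OF assms] vol_pos by (simp add: field_simps)
  show ?thesis
    using esum_upper[of "{v}" "{..<n} - {v}" "\<lambda>_. 1" 1 "p v" "4 * L", OF _ _ _ _ _ m] assms by auto
qed

lemma prob_deg_lower:
  assumes "v < n"
  shows "Pr (\<lambda>g. esum (\<lambda>_. 1) {v} ({..<n} - {v}) g \<le> c0 * p v / 2 - 4 * L) \<le> exp (- 4 * L)"
  using esum_lower[of "{v}" "{..<n} - {v}" "c0 * p v" "4 * L"] assms n2 by auto

text \<open>The thresholds come from comparing degrees: if \<open>y\<close> has at least the degree
  of \<open>z\<close>, the degree bounds give \<open>c0 * p z / 2 - 4 * L < 2 * p y + 4 * L\<close>,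
  hence \<open>c0 / 8 * p z \<le> p y\<close> once \<open>32 * L \<le> c0 * p z\<close>. The mean is
  \<open>p z\<close> times a tail volume over \<open>vol\<close>, at most of order
  \<open>p z * p z powr (2 - b)\<close>.\<close>

lemma prob_upper_nbrs:
  assumes z: "z < n" "32 * L / c0 \<le> p z"
  shows "Pr (\<lambda>g. 2 * (nbr_const * p z powr (3 - b)) + 4 * L \<le>
     esum (\<lambda>_. 1) {z} {y. y < n \<and> y \<noteq> z \<and> c0 / 8 * p z \<le> p y \<and> p y \<le> wcap} g) \<le> exp (- 4 * L)"
proof -
  define t where "t = c0 / 8 * p z"
  define T where "T = {y. y < n \<and> y \<noteq> z \<and> t \<le> p y \<and> p y \<le> wcap}"
  have "4 * L \<le> t" using z(2) c0_pos by (simp add: t_def field_simps)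
  then have tx: "xmin \<le> t" using L_ge by simp
  have s: "(\<Sum>y\<in>T. p y) \<le> C2 * real n * t powr (2 - b)"
  proof (cases "t \<le> wcap")
    case True
    have "(\<Sum>y\<in>T. p y) \<le> (\<Sum>v | v < n \<and> t \<le> p v \<and> p v \<le> wcap. p v)"
      by (rule sum_mono2) (use p_pos in \<open>auto simp: T_def less_imp_le\<close>)
    then show ?thesis using tail_vol[OF tx] True by (simp add: wcap_def)
  next
    case False
    then have "T = {}" by (auto simp: T_def)
    then show ?thesis using C2 by simp
  qed
  have pz: "p z > 0" using p_pos z by simp
  have "p z * (\<Sum>y\<in>T. p y) / vol \<le> p z * (C2 * real n * t powr (2 - b)) / (real n * xmin)"
    using s pz vol_ge n2 xmin C2 by (intro frac_le mult_left_mono) auto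
  also have "\<dots> = C2 / xmin * (p z * t powr (2 - b))" using n2 by (simp add: field_simps)
  also have "p z * t powr (2 - b) = (c0 / 8) powr (2 - b) * (p z powr 1 * p z powr (2 - b))"
    unfolding t_def powr_mult using pz by simp
  also have "p z powr 1 * p z powr (2 - b) = p z powr (3 - b)"
    using powr_add[of "p z" 1 "2 - b"] by (simp add: algebra_simps)
  finally have m: "(\<Sum>u\<in>{z}. p u) * (\<Sum>y\<in>T. 1 * p y) / vol \<le> nbr_const * p z powr (3 - b)"
    by (simp add: nbr_const_def)
  show ?thesis
    using esum_upper[of "{z}" T "\<lambda>_. 1" 1 _ "4 * L", OF _ _ _ _ _ m] z(1)
    unfolding T_def t_def by auto
qed

section \<open>Rare outcomes of explorations: missed hub, large spread, isolated light ball\<close>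

definition hub_missed where "hub_missed A B g \<longleftrightarrow> \<theta> \<le> esum (\<lambda>_. 1) (B - A) ({..<n} - B) g \<and> w \<notin> B
    \<and> (\<forall>e\<in>upair ` ((B - A) \<times> {w}). \<not> g e)"

lemma sum_p_nonneg: "S \<subseteq> {..<n} \<Longrightarrow> 0 \<le> (\<Sum>u\<in>S. p u)"
  by (rule sum_nonneg) (use p_pos in \<open>auto simp: less_imp_le\<close>)

lemma sum_p_le_vol: "S \<subseteq> {..<n} \<Longrightarrow> (\<Sum>u\<in>S. p u) \<le> vol"
  unfolding vol_def by (rule sum_mono2) (use p_pos in \<open>auto simp: less_imp_le\<close>)

lemma vol_le': "vol \<le> C1 * real n" using vol_le by (simp add: vol_def)

text \<open>Dichotomy on the weight of the last sphere \<open>S\<close>. If it is at most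
  \<open>\<theta> / 4\<close>, a cut of size \<open>\<theta>\<close> is an upper deviation; if it is
  larger, the absence of all edges to \<open>w\<close> is unlikely by itself.\<close>

lemma prob_hub_missed:
  assumes "x < n"
  shows "Pr (\<lambda>g. hub_missed (bfs (egraph n g) x i) (bfs (egraph n g) x (Suc i)) g) \<le> exp (- 4 * L)"
proof (rule bfs_explore)
  fix A B assume AB: "A \<subseteq> B" "B \<subseteq> {..<n}"
  define S where "S = B - A"
  have S: "S \<subseteq> {..<n}" "S \<inter> ({..<n} - B) = {}" using AB by (auto simp: S_def)
  show "dep_on (upair ` ((B - A) \<times> ({..<n} - B))) (hub_missed A B)"
  \<comment> \<open>Only for \<open>w\<close> outside \<open>B\<close> are the pairs with
    \<open>w\<close> among the unrevealed ones; otherwise the event is false by definition.\<close>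
  proof (cases "w \<in> B")
    case True
    then have "hub_missed A B = (\<lambda>_. False)" by (simp add: hub_missed_def fun_eq_iff)
    then show ?thesis by (simp add: dep_on_const)
  next
    case False
    then show ?thesis unfolding hub_missed_def using w(1)
      by (intro dep_on_conj dep_on_const dep_on_none dep_on_esum) auto
  qed
  show "Pr (hub_missed A B) \<le> exp (- 4 * L)"
  proof (cases "w \<in> B")
    case True
    then show ?thesis by (simp add: hub_missed_def)
  next
    case wB: False
    show ?thesis
    proof (cases "(\<Sum>u\<in>S. p u) \<le> \<theta> / 4")
      case True
      have "(\<Sum>u\<in>S. p u) * (\<Sum>y\<in>{..<n} - B. 1 * p y) / vol \<le> (\<Sum>u\<in>S. p u) * vol / vol"
        using sum_p_nonneg[OF S(1)] sum_p_le_vol[of "{..<n} - B"] vol_pos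
        by (intro divide_right_mono mult_left_mono) auto
      also have "\<dots> \<le> \<theta> / 4" using True vol_pos by simp
      finally have m: "(\<Sum>u\<in>S. p u) * (\<Sum>y\<in>{..<n} - B. 1 * p y) / vol \<le> \<theta> / 4" .
      have "Pr (hub_missed A B) \<le> Pr (\<lambda>g. 2 * (\<theta> / 4) + 1 * (\<theta> / 2) \<le> esum (\<lambda>_. 1) S ({..<n} - B) g)"
        by (rule pmf_prob_mono) (auto simp: hub_missed_def S_def)
      also have "\<dots> \<le> exp (- (\<theta> / 2))"
        by (rule esum_upper[OF S(1) _ S(2) _ _ m]) auto
      also have "\<dots> \<le> exp (- 4 * L)" using \<theta>_ge by simp
      finally show ?thesis .
    next
      case False
      have "Pr (hub_missed A B) \<le> Pr (\<lambda>g. \<forall>e\<in>upair ` (S \<times> {w}). \<not> g e)"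
        by (rule pmf_prob_mono) (auto simp: hub_missed_def S_def)
      also have "\<dots> \<le> exp (- ((\<Sum>u\<in>S. p u) * (\<Sum>y\<in>{w}. p y) / vol))"
        by (rule esum_none) (use S w wB in \<open>auto simp: S_def\<close>)
      also have "\<dots> \<le> exp (- 4 * L)"
      proof -
        have "4 * L * vol \<le> 4 * L * (C1 * real n)" using vol_le' L_pos by (intro mult_left_mono) auto
        also have "\<dots> \<le> \<theta> / 4 * p w" using w(3) by (simp add: algebra_simps)
        also have "\<dots> \<le> (\<Sum>u\<in>S. p u) * p w" using False p_pos[OF w(1)] by (intro mult_right_mono) auto
        finally show ?thesis using vol_pos by (simp add: field_simps)
      qed
      finally show ?thesis .
    qed
  qed
qed (use assms in auto)

definition spread_exceeded where "spread_exceeded A B g \<longleftrightarrow> esum (\<lambda>_. 1) (B - A) ({..<n} - B) g < \<theta> \<and> 2 * card B \<le> n \<and>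
  spread_bound \<le> esum spread_weight (B - A) ({..<n} - B) g"

text \<open>A vertex is met as an endpoint with probability at most proportional to its weight,
  which raises the exponent from \<open>3 - b\<close> to \<open>4 - b\<close>.\<close>

lemma spread_weight_sum:
  assumes "T \<subseteq> {..<n}"
  shows "(\<Sum>y\<in>T. spread_weight y * p y) \<le> real n * M"
proof -
  have "(\<Sum>y\<in>T. spread_weight y * p y) \<le> (\<Sum>y<n. spread_weight y * p y)"
    by (rule sum_mono2) (use assms p_pos in \<open>auto simp: spread_weight_def less_imp_le\<close>)
  also have "\<dots> = (\<Sum>y | y < n \<and> p y \<le> wcap. p y powr (4 - b))"
  proof (rule sum.mono_neutral_cong_right)
    fix y assume "y \<in> {y. y < n \<and> p y \<le> wcap}"
    then have y: "0 < p y" "p y \<le> wcap" using p_pos by auto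
    have "p y powr (3 - b) * p y = p y powr (4 - b)"
      using y powr_add[of "p y" "3 - b" 1] by (simp add: algebra_simps)
    then show "spread_weight y * p y = p y powr (4 - b)" using y by (simp add: spread_weight_def)
  qed (auto simp: spread_weight_def)
  finally show ?thesis using M by (simp add: wcap_def)
qed

text \<open>Again a dichotomy: a sphere of weight at least \<open>4 * \<theta> / c0\<close> would
  have a cut of at least \<open>\<theta>\<close>, where the lower tail needs half of the vertices
  outside \<open>B\<close>; a lighter sphere keeps the mean of the spread sum below
  \<open>spread_mean\<close>.\<close>

lemma prob_spread_exceeded:
  assumes "x < n"
  shows "Pr (\<lambda>g. spread_exceeded (bfs (egraph n g) x i) (bfs (egraph n g) x (Suc i)) g) \<le> exp (- 4 * L)"
proof (rule bfs_explore)
  fix A B assume AB: "A \<subseteq> B" "B \<subseteq> {..<n}"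
  define S where "S = B - A"
  have S: "S \<subseteq> {..<n}" "S \<inter> ({..<n} - B) = {}" using AB by (auto simp: S_def)
  show "dep_on (upair ` ((B - A) \<times> ({..<n} - B))) (spread_exceeded A B)"
    unfolding spread_exceeded_def by (intro dep_on_conj dep_on_const dep_on_esum) auto
  show "Pr (spread_exceeded A B) \<le> exp (- 4 * L)"
  proof (cases "2 * card B \<le> n")
    case False
    then show ?thesis by (simp add: spread_exceeded_def)
  next
    case cB: True
    show ?thesis
    proof (cases "4 * \<theta> \<le> c0 * (\<Sum>u\<in>S. p u)")
      case True
      have "Pr (spread_exceeded A B) \<le> Pr (\<lambda>g. esum (\<lambda>_. 1) S ({..<n} - B) g \<le> 4 * \<theta> / 2 - \<theta>)"
        by (rule pmf_prob_mono) (auto simp: spread_exceeded_def S_def)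
      also have "\<dots> \<le> exp (- \<theta>)"
      proof (rule esum_lower[OF S(1) _ S(2) _ True])
        have "card ({..<n} - B) = n - card B" using AB by (simp add: card_Diff_subset finite_subset)
        then show "real n \<le> 2 * real (card ({..<n} - B))" using cB by simp
      qed auto
      also have "\<dots> \<le> exp (- 4 * L)" using \<theta>_ge L_pos by simp
      finally show ?thesis .
    next
      case False
      then have S4: "(\<Sum>u\<in>S. p u) \<le> 4 * \<theta> / c0" using c0_pos by (simp add: field_simps)
      have s0: "0 \<le> (\<Sum>y\<in>{..<n} - B. spread_weight y * p y)"
        by (rule sum_nonneg) (use p_pos in \<open>auto simp: spread_weight_def less_imp_le\<close>)
      have "(\<Sum>u\<in>S. p u) * (\<Sum>y\<in>{..<n} - B. spread_weight y * p y) / vol \<le> (4 * \<theta> / c0) * (real n * M) / (real n * xmin)"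
        using S4 s0 spread_weight_sum[of "{..<n} - B"] vol_ge n2 xmin \<theta>_pos c0_pos sum_p_nonneg[OF S(1)] M_nonneg
        by (intro frac_le mult_mono mult_nonneg_nonneg) auto
      also have "\<dots> = spread_mean" using n2 by (simp add: spread_mean_def field_simps)
      finally have m: "(\<Sum>u\<in>S. p u) * (\<Sum>y\<in>{..<n} - B. spread_weight y * p y) / vol \<le> spread_mean" .
      have "Pr (spread_exceeded A B) \<le> Pr (\<lambda>g. 2 * spread_mean + wcap powr (3 - b) * (4 * L) \<le> esum spread_weight S ({..<n} - B) g)"
        by (rule pmf_prob_mono) (auto simp: spread_exceeded_def S_def spread_bound_def)
      also have "\<dots> \<le> exp (- (4 * L))"
      proof (rule esum_upper[OF S(1) _ S(2) _ _ m])
        fix y assume "y \<in> {..<n} - B"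
        then show "0 \<le> spread_weight y \<and> spread_weight y \<le> wcap powr (3 - b)"
          using p_pos[of y] b by (auto simp: spread_weight_def intro: powr_mono2)
      qed (use wcap_pos in auto)
      finally show ?thesis by simp
    qed
  qed
qed (use assms in auto)

lemma bfs_light: "x \<in> Light \<Longrightarrow> bfs (light_graph g) x j \<subseteq> Light"
  by (induction j) (auto simp: light_graph_def)

lemma bfs_light_cong:
  assumes "\<And>u v. u \<in> Light \<Longrightarrow> v \<in> Light \<Longrightarrow> g (upair (u, v)) = g' (upair (u, v))"
  shows "bfs (light_graph g) x j = bfs (light_graph g') x j"
proof -
  have "light_graph g = light_graph g'" using assms by (auto simp: light_graph_def egraph_def fun_eq_iff)
  then show ?thesis by simp
qed

text \<open>In the full graph the edges that leave the inner balls have already been revealed. The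
  search inside \<open>Light\<close> reveals only light-light pairs, so all pairs between the ball
  and \<open>Heavy\<close> remain fresh, not only those at its last sphere.\<close>

lemma prob_light_isolated:
  assumes x: "x \<in> Light"
  shows "Pr (\<lambda>g. \<theta> \<le> card (bfs (light_graph g) x j) \<and> (\<forall>e\<in>upair ` (bfs (light_graph g) x j \<times> Heavy). \<not> g e)) \<le> exp (- 4 * L)"
proof -
  define F where "F B g \<longleftrightarrow> \<theta> \<le> card B \<and> (\<forall>e\<in>upair ` (B \<times> Heavy). \<not> g e)" for B g
  have fin: "finite (Pow Light)" unfolding Light_def by simp
  have "Pr (\<lambda>g. \<theta> \<le> card (bfs (light_graph g) x j) \<and> (\<forall>e\<in>upair ` (bfs (light_graph g) x j \<times> Heavy). \<not> g e))
      = Pr (\<lambda>g. \<exists>B\<in>Pow Light. bfs (light_graph g) x j = B \<and> F B g)"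
    by (rule arg_cong[where f = "measure_pmf.prob _"]) (use bfs_light[OF x] in \<open>auto simp: F_def\<close>)
  also have "\<dots> \<le> exp (- 4 * L)"
  proof (rule bern_explore[OF finite_vpairs fin, where J = "\<lambda>_. {e. fst e \<in> Light \<and> snd e \<in> Light}" and J' = "\<lambda>B. upair ` (B \<times> Heavy)"])
    fix B assume B: "B \<in> Pow Light"
    show "dep_on {e. fst e \<in> Light \<and> snd e \<in> Light} (\<lambda>g. bfs (light_graph g) x j = B)"
      unfolding dep_on_def
    proof (intro allI impI)
      fix g g' :: "nat \<times> nat \<Rightarrow> bool" assume a: "\<forall>e\<in>{e. fst e \<in> Light \<and> snd e \<in> Light}. g e = g' e"
      have "bfs (light_graph g) x j = bfs (light_graph g') x j"
        by (rule bfs_light_cong) (use a in \<open>auto simp: upair_def min_def max_def\<close>)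
      then show "(bfs (light_graph g) x j = B) = (bfs (light_graph g') x j = B)" by simp
    qed
    show "dep_on (upair ` (B \<times> Heavy)) (F B)"
      unfolding F_def by (intro dep_on_conj dep_on_const dep_on_none) auto
    show "{e. fst e \<in> Light \<and> snd e \<in> Light} \<inter> upair ` (B \<times> Heavy) = {}"
      by (auto simp: Light_def Heavy_def upair_def min_def max_def split: if_splits)
    show "Pr (F B) \<le> exp (- 4 * L)"
    proof (cases "\<theta> \<le> card B")
      case False
      then show ?thesis by (simp add: F_def)
    next
      case True
      have Bn: "B \<subseteq> {..<n}" using B by (auto simp: Light_def)
      have "Pr (F B) \<le> Pr (\<lambda>g. \<forall>e\<in>upair ` (B \<times> Heavy). \<not> g e)"
        by (rule pmf_prob_mono) (auto simp: F_def)
      also have "\<dots> \<le> exp (- ((\<Sum>u\<in>B. p u) * (\<Sum>y\<in>Heavy. p y) / vol))"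
        by (rule esum_none) (use B in \<open>auto simp: Light_def Heavy_def\<close>)
      also have "\<dots> \<le> exp (- 4 * L)"
      proof -
        have H0: "0 \<le> (\<Sum>y\<in>Heavy. p y)" by (rule sum_p_nonneg) (auto simp: Heavy_def)
        have "\<theta> * xmin \<le> card B * xmin" using True xmin by simp
        also have "\<dots> \<le> (\<Sum>u\<in>B. p u)" using sum_mono[of B "\<lambda>_. xmin" p] p_ge Bn by auto
        finally have 1: "\<theta> * xmin \<le> (\<Sum>u\<in>B. p u)" .
        have "4 * L * vol \<le> 4 * L * (C1 * real n)" using vol_le' L_pos by (intro mult_left_mono) auto
        also have "\<dots> \<le> \<theta> * xmin * (\<Sum>y\<in>Heavy. p y)" using heavy by (simp add: Heavy_def th_def algebra_simps)
        also have "\<dots> \<le> (\<Sum>u\<in>B. p u) * (\<Sum>y\<in>Heavy. p y)" by (rule mult_right_mono[OF 1 H0])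
        finally show ?thesis using vol_pos by (simp add: field_simps)
      qed
      finally show ?thesis .
    qed
  qed auto
  finally show ?thesis .
qed

definition good where "good g \<longleftrightarrow>
  (\<forall>v<n. esum (\<lambda>_. 1) {v} ({..<n} - {v}) g < 2 * p v + 4 * L) \<and>
  (\<forall>v<n. c0 * p v / 2 - 4 * L < esum (\<lambda>_. 1) {v} ({..<n} - {v}) g) \<and>
  (\<forall>z<n. 32 * L / c0 \<le> p z \<longrightarrow> esum (\<lambda>_. 1) {z} {y. y < n \<and> y \<noteq> z \<and> c0 / 8 * p z \<le> p y \<and> p y \<le> wcap} g
      < 2 * (nbr_const * p z powr (3 - b)) + 4 * L) \<and>
  (\<forall>x<n. \<forall>i<n. \<not> hub_missed (bfs (egraph n g) x i) (bfs (egraph n g) x (Suc i)) g) \<and>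
  (\<forall>x<n. \<forall>i<n. \<not> spread_exceeded (bfs (egraph n g) x i) (bfs (egraph n g) x (Suc i)) g) \<and>
  (\<forall>x\<in>Light. \<forall>j<n. \<theta> \<le> card (bfs (light_graph g) x j) \<longrightarrow> (\<exists>e\<in>upair ` (bfs (light_graph g) x j \<times> Heavy). g e))"

text \<open>Three families of at most \<open>n\<close> events and three of at most \<open>n\<close>
  squared. The slack \<open>4 * L\<close> in every tail bound makes each event have probability at
  most \<open>n powr -4\<close>.\<close>

lemma prob_good: "1 - 6 / real n ^ 2 \<le> Pr good"
proof -
  let ?e = "exp (- 4 * L)"
  let ?I = "{..<n}" and ?I2 = "{..<n} \<times> {..<n}" and ?IL = "Light \<times> {..<n}"
  let ?Q1 = "\<lambda>v g. 2 * p v + 4 * L \<le> esum (\<lambda>_. 1) {v} ({..<n} - {v}) g"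
  let ?Q2 = "\<lambda>v g. esum (\<lambda>_. 1) {v} ({..<n} - {v}) g \<le> c0 * p v / 2 - 4 * L"
  let ?Q3 = "\<lambda>z g. 32 * L / c0 \<le> p z \<and> 2 * (nbr_const * p z powr (3 - b)) + 4 * L \<le>
     esum (\<lambda>_. 1) {z} {y. y < n \<and> y \<noteq> z \<and> c0 / 8 * p z \<le> p y \<and> p y \<le> wcap} g"
  let ?Q4 = "\<lambda>(x, i) g. hub_missed (bfs (egraph n g) x i) (bfs (egraph n g) x (Suc i)) g"
  let ?Q5 = "\<lambda>(x, i) g. spread_exceeded (bfs (egraph n g) x i) (bfs (egraph n g) x (Suc i)) g"
  let ?Q6 = "\<lambda>(x, j) g. \<theta> \<le> card (bfs (light_graph g) x j) \<and> (\<forall>e\<in>upair ` (bfs (light_graph g) x j \<times> Heavy). \<not> g e)"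
  have u1: "Pr (\<lambda>g. \<exists>v\<in>?I. ?Q1 v g) \<le> real (card ?I) * ?e"
    by (rule pmf_union_bound) (use prob_deg_upper in auto)
  have u2: "Pr (\<lambda>g. \<exists>v\<in>?I. ?Q2 v g) \<le> real (card ?I) * ?e"
    by (rule pmf_union_bound) (use prob_deg_lower in auto)
  have u3: "Pr (\<lambda>g. \<exists>v\<in>?I. ?Q3 v g) \<le> real (card ?I) * ?e"
  proof (rule pmf_union_bound)
    fix z assume "z \<in> ?I"
    then show "Pr (?Q3 z) \<le> ?e" using prob_upper_nbrs[of z] by (cases "32 * L / c0 \<le> p z") auto
  qed auto
  have u4: "Pr (\<lambda>g. \<exists>k\<in>?I2. ?Q4 k g) \<le> real (card ?I2) * ?e"
    by (rule pmf_union_bound) (use prob_hub_missed in auto)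
  have u5: "Pr (\<lambda>g. \<exists>k\<in>?I2. ?Q5 k g) \<le> real (card ?I2) * ?e"
    by (rule pmf_union_bound) (use prob_spread_exceeded in auto)
  have u6: "Pr (\<lambda>g. \<exists>k\<in>?IL. ?Q6 k g) \<le> real (card ?IL) * ?e"
    by (rule pmf_union_bound) (use prob_light_isolated in \<open>auto simp: Light_def\<close>)
  have IL: "real (card ?IL) \<le> real n ^ 2"
  proof -
    have "card ?IL \<le> card ?I2" by (rule card_mono) (auto simp: Light_def)
    then have "card ?IL \<le> n * n" by (simp add: card_cartesian_product)
    then show ?thesis by (metis of_nat_le_iff of_nat_power power2_eq_square)
  qed
  define bad where "bad g \<longleftrightarrow> (\<exists>v\<in>?I. ?Q1 v g) \<or> (\<exists>v\<in>?I. ?Q2 v g) \<or> (\<exists>v\<in>?I. ?Q3 v g) \<or>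
    (\<exists>k\<in>?I2. ?Q4 k g) \<or> (\<exists>k\<in>?I2. ?Q5 k g) \<or> (\<exists>k\<in>?IL. ?Q6 k g)" for g
  have "Pr bad \<le> real (card ?I) * ?e + (real (card ?I) * ?e + (real (card ?I) * ?e +
     (real (card ?I2) * ?e + (real (card ?I2) * ?e + real (card ?IL) * ?e))))"
    unfolding bad_def by (intro pmf_union2 u1 u2 u3 u4 u5 u6)
  also have "\<dots> \<le> 6 * real n ^ 2 * ?e"
  proof -
    have "real n \<le> real n ^ 2" using n2 by (simp add: power2_eq_square)
    then have "real (card ?I) + (real (card ?I) + (real (card ?I) + (real (card ?I2) + (real (card ?I2) + real (card ?IL)))))
      \<le> 6 * real n ^ 2" using IL by (simp add: card_cartesian_product power2_eq_square)
    then show ?thesis unfolding distrib_right[symmetric] by (intro mult_right_mono) auto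
  qed
  also have "\<dots> = 6 / real n ^ 2" using n2 unfolding expL by (simp add: power_numeral_reduce field_simps)
  finally have bad: "Pr bad \<le> 6 / real n ^ 2" .
  have "good g \<longleftrightarrow> \<not> bad g" for g
  proof -
    have "(\<exists>v\<in>?I. ?Q1 v g) \<longleftrightarrow> \<not> (\<forall>v<n. esum (\<lambda>_. 1) {v} ({..<n} - {v}) g < 2 * p v + 4 * L)"
      by (simp add: Bex_def not_less)
    moreover have "(\<exists>v\<in>?I. ?Q2 v g) \<longleftrightarrow> \<not> (\<forall>v<n. c0 * p v / 2 - 4 * L < esum (\<lambda>_. 1) {v} ({..<n} - {v}) g)"
      by (simp add: Bex_def not_less)
    moreover have "(\<exists>v\<in>?I. ?Q3 v g) \<longleftrightarrow> \<not> (\<forall>z<n. 32 * L / c0 \<le> p z \<longrightarrow>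
        esum (\<lambda>_. 1) {z} {y. y < n \<and> y \<noteq> z \<and> c0 / 8 * p z \<le> p y \<and> p y \<le> wcap} g
        < 2 * (nbr_const * p z powr (3 - b)) + 4 * L)"
      by (simp only: Bex_def not_all not_imp not_less lessThan_iff)
    moreover have "(\<exists>k\<in>?I2. ?Q4 k g) \<longleftrightarrow> \<not> (\<forall>x<n. \<forall>i<n. \<not> hub_missed (bfs (egraph n g) x i) (bfs (egraph n g) x (Suc i)) g)"
      by (simp only: bex_simps Bex_def not_all not_imp not_not lessThan_iff mem_Times_iff split_paired_Ex fst_conv snd_conv prod.case) blast
    moreover have "(\<exists>k\<in>?I2. ?Q5 k g) \<longleftrightarrow> \<not> (\<forall>x<n. \<forall>i<n. \<not> spread_exceeded (bfs (egraph n g) x i) (bfs (egraph n g) x (Suc i)) g)"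
      by (simp only: bex_simps Bex_def not_all not_imp not_not lessThan_iff mem_Times_iff split_paired_Ex fst_conv snd_conv prod.case) blast
    moreover have "(\<exists>k\<in>?IL. ?Q6 k g) \<longleftrightarrow> \<not> (\<forall>x\<in>Light. \<forall>j<n. \<theta> \<le> card (bfs (light_graph g) x j) \<longrightarrow>
        (\<exists>e\<in>upair ` (bfs (light_graph g) x j \<times> Heavy). g e))"
    proof -
      define R' where "R' x j \<longleftrightarrow> (\<exists>e\<in>upair ` (bfs (light_graph g) x j \<times> Heavy). g e)" for x j
      have "(\<forall>e\<in>upair ` (bfs (light_graph g) x j \<times> Heavy). \<not> g e) \<longleftrightarrow> \<not> R' x j" for x j
        unfolding R'_def by blast
      then show ?thesis unfolding R'_def[symmetric] by auto
    qed
    ultimately show ?thesis unfolding good_def bad_def by argo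
  qed
  then have "Pr good = Pr (\<lambda>g. \<not> bad g)" by simp
  also have "\<dots> = 1 - Pr bad"
    using measure_pmf.prob_compl[of "{g. bad g}" "bern (vpairs n) q"] by (simp add: Collect_neg_eq Compl_eq_Diff_UNIV)
  finally show ?thesis using bad by simp
qed

end

section \<open>Deterministic consequences of the good event\<close>

lemma esum_single: "esum a {v} T g = (\<Sum>y\<in>T. a y * of_bool (g (upair (v, y))))"
  unfolding esum_def by (simp add: sum.cartesian_product')

lemma esum_one_card:
  assumes "finite S" "finite T"
  shows "esum (\<lambda>_. 1) S T g = real (card {t \<in> S \<times> T. g (upair t)})"
  using assms by (simp add: esum_def Int_def)

lemma esum_one_single:
  assumes "finite T"
  shows "esum (\<lambda>_. 1) {v} T g = real (card {y \<in> T. g (upair (v, y))})"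
  using assms by (simp add: esum_single Int_def)

context regular_weights begin

text \<open>The degree bound \<open>2 * p v + 4 * L\<close> at the weight
  \<open>32 * L / c0\<close>, divided by \<open>L\<close>.\<close>

definition deg_const where "deg_const = 64 / c0 + 4"
text \<open>\<open>Hb\<close> enters twice, for the roots of the first phase and for high-degree
  vertices on the outer sphere. The last two terms belong to radius 1, where the previous sphere is
  the vertex itself.\<close>

definition label_bound where "label_bound = 2 * Hb + 3 * \<theta> + deg_const * \<theta> * L + 2 * nbr_const * spread_bound + 2 * nbr_const * wcap powr (3 - b) + deg_const * L"

lemma \<theta>_ge1: "1 \<le> \<theta>"
proof -
  have "ln 2 \<le> ln (real n)" using n2 by (subst ln_le_cancel_iff) auto
  then show ?thesis using \<theta>_ge ln2_ge_two_thirds by (simp add: L)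
qed

lemma nbr_const_nonneg: "0 \<le> nbr_const" using C2 xmin by (simp add: nbr_const_def)

context
  fixes g :: "nat \<times> nat \<Rightarrow> bool"
  assumes good: "good g"
begin

abbreviation E where "E \<equiv> egraph n g"
abbreviation dg where "dg v \<equiv> real (deg E n v)"

interpretation sym_graph E n by (rule egraph_sym_graph)

lemma deg_esum: "v < n \<Longrightarrow> dg v = esum (\<lambda>_. 1) {v} ({..<n} - {v}) g"
  by (subst esum_one_single) (auto simp: deg_def egraph_def intro!: arg_cong[where f = card])

lemma deg_upper: "v < n \<Longrightarrow> dg v < 2 * p v + 4 * L"
  using good by (auto simp: good_def deg_esum)

lemma deg_lower: "v < n \<Longrightarrow> c0 * p v / 2 - 4 * L < dg v"
  using good by (auto simp: good_def deg_esum)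

lemma deg_less_K: "v < n \<Longrightarrow> dg v < K \<Longrightarrow> p v \<le> wcap"
  using deg_lower[of v] K_ge K_pos c0_pos by (simp add: wcap_def field_simps)

lemma deg_w: "K \<le> dg w"
  using deg_lower[OF w(1)] w(2) K_ge by simp

text \<open>Degree at least \<open>K\<close> forces weight at least \<open>K / 4\<close>, since
  \<open>4 * L \<le> K / 2\<close>.\<close>

lemma card_high: "real (card {v. v < n \<and> K \<le> dg v}) \<le> Hb"
proof -
  have "card {v. v < n \<and> K \<le> dg v} \<le> card {v. v < n \<and> K / 4 \<le> p v}"
    by (rule card_mono) (use deg_upper K_ge in fastforce)+
  then show ?thesis using Hb by simp
qed

text \<open>Below the weight \<open>32 * L / c0\<close> comparing degrees no longer controls the
  weight of \<open>y\<close>; there the whole degree of \<open>z\<close> is only of order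
  \<open>L\<close> and serves as the bound.\<close>

lemma high_nbrs:
  assumes z: "z < n" "dg z < K"
  shows "real (card {y. E z y \<and> dg z \<le> dg y \<and> dg y < K}) \<le> 2 * nbr_const * p z powr (3 - b) + deg_const * L"
proof (cases "32 * L / c0 \<le> p z")
  case True
  define T where "T = {y. y < n \<and> y \<noteq> z \<and> c0 / 8 * p z \<le> p y \<and> p y \<le> wcap}"
  have "{y. E z y \<and> dg z \<le> dg y \<and> dg y < K} \<subseteq> {y \<in> T. g (upair (z, y))}"
  proof
    fix y assume y: "y \<in> {y. E z y \<and> dg z \<le> dg y \<and> dg y < K}"
    then have yn: "y < n" "y \<noteq> z" "g (upair (z, y))" by (auto simp: egraph_def)
    have "c0 * p z / 2 - 4 * L < 2 * p y + 4 * L"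
      using deg_lower[OF z(1)] deg_upper[OF yn(1)] y by simp
    moreover have "32 * L \<le> c0 * p z" using True c0_pos by (simp add: field_simps)
    ultimately have "c0 / 8 * p z \<le> p y" by simp
    then show "y \<in> {y \<in> T. g (upair (z, y))}" using yn deg_less_K y by (auto simp: T_def)
  qed
  then have "card {y. E z y \<and> dg z \<le> dg y \<and> dg y < K} \<le> card {y \<in> T. g (upair (z, y))}"
    by (intro card_mono) (auto simp: T_def)
  then have "real (card {y. E z y \<and> dg z \<le> dg y \<and> dg y < K}) \<le> esum (\<lambda>_. 1) {z} T g"
    by (subst esum_one_single) (auto simp: T_def)
  also have "\<dots> < 2 * (nbr_const * p z powr (3 - b)) + 4 * L"
    using good True z(1) unfolding good_def T_def by blast
  also have "\<dots> \<le> 2 * nbr_const * p z powr (3 - b) + deg_const * L"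
    using c0_pos L_pos by (simp add: deg_const_def field_simps)
  finally show ?thesis by simp
next
  case False
  have "card {y. E z y \<and> dg z \<le> dg y \<and> dg y < K} \<le> deg E n z"
    unfolding deg_def by (rule card_mono) (auto simp: egraph_def)
  then have "real (card {y. E z y \<and> dg z \<le> dg y \<and> dg y < K}) \<le> dg z" by simp
  also have "\<dots> \<le> 2 * (32 * L / c0) + 4 * L" using deg_upper[OF z(1)] False by simp
  also have "\<dots> = deg_const * L" using c0_pos by (simp add: deg_const_def field_simps)
  also have "\<dots> \<le> 2 * nbr_const * p z powr (3 - b) + deg_const * L" using nbr_const_nonneg by simp
  finally show ?thesis .
qed

section \<open>Growth of balls and the radius\<close>

abbreviation cut where "cut B \<equiv> real (cut_edges E n B)"

lemma cut_finite: "finite B \<Longrightarrow> finite {(u, v). u \<in> B \<and> v < n \<and> v \<notin> B \<and> E u v}"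
  by (rule finite_subset[of _ "B \<times> {..<n}"]) auto

text \<open>Neighbours of the inner ball lie in the outer one, so only the last sphere contributes
  to the cut. This expresses the cut by edges that the exploration has not revealed.\<close>

lemma cut_bfs:
  assumes "x < n"
  shows "cut (bfs E x (Suc i)) = esum (\<lambda>_. 1) (bfs E x (Suc i) - bfs E x i) ({..<n} - bfs E x (Suc i)) g"
proof -
  have "{(u, v). u \<in> bfs E x (Suc i) \<and> v < n \<and> v \<notin> bfs E x (Suc i) \<and> E u v} =
    {t \<in> (bfs E x (Suc i) - bfs E x i) \<times> ({..<n} - bfs E x (Suc i)). g (upair t)}" (is "?X = ?Y")
  proof (intro set_eqI iffI)
    fix t assume t: "t \<in> ?X"
    moreover have "fst t \<notin> bfs E x i" using t by auto
    ultimately show "t \<in> ?Y" by (auto simp: egraph_def)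
  next
    fix t assume t: "t \<in> ?Y"
    then have "fst t < n" using bfs_dom[OF assms, of "Suc i"] by (auto simp del: bfs.simps)
    then show "t \<in> ?X" using t by (auto simp: egraph_def simp del: bfs.simps)
  qed
  then show ?thesis unfolding cut_edges_def
    by (subst esum_one_card) (use finite_bfs[OF assms] in \<open>auto simp del: bfs.simps\<close>)
qed

text \<open>Each vertex of the new sphere receives at least one cut edge. Index 0 is excluded: the
  ball there is empty, yet the next one contains \<open>x\<close>.\<close>

lemma sphere_le_cut:
  assumes "x < n" "0 < i"
  shows "card (bfs E x (Suc i) - bfs E x i) \<le> cut_edges E n (bfs E x i)"
proof -
  have "bfs E x (Suc i) - bfs E x i \<subseteq> snd ` {(u, v). u \<in> bfs E x i \<and> v < n \<and> v \<notin> bfs E x i \<and> E u v}"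
  proof
    fix y assume y: "y \<in> bfs E x (Suc i) - bfs E x i"
    have "x \<in> bfs E x i" using assms(2) by (cases i) auto
    then obtain u where "u \<in> bfs E x i" "E u y" using y by auto
    then have "(u, y) \<in> {(u, v). u \<in> bfs E x i \<and> v < n \<and> v \<notin> bfs E x i \<and> E u v}"
      using y E_dom2 by auto
    then show "y \<in> snd ` {(u, v). u \<in> bfs E x i \<and> v < n \<and> v \<notin> bfs E x i \<and> E u v}" by force
  qed
  then have "card (bfs E x (Suc i) - bfs E x i) \<le> card (snd ` {(u, v). u \<in> bfs E x i \<and> v < n \<and> v \<notin> bfs E x i \<and> E u v})"
    using cut_finite[OF finite_bfs[OF assms(1)]] by (intro card_mono) auto
  also have "\<dots> \<le> cut_edges E n (bfs E x i)"
    unfolding cut_edges_def using cut_finite[OF finite_bfs[OF assms(1)]] by (rule card_image_le)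
  finally show ?thesis .
qed

lemma card_bfs_Suc:
  assumes "x < n" "0 < i"
  shows "real (card (bfs E x (Suc i))) \<le> real (card (bfs E x i)) + cut (bfs E x i)"
proof -
  have "card (bfs E x (Suc i)) = card (bfs E x i) + card (bfs E x (Suc i) - bfs E x i)"
    using bfs_mono_Suc[of E x i] finite_bfs[OF assms(1)]
    by (metis card_Diff_subset card_mono le_add_diff_inverse)
  then show ?thesis using sphere_le_cut[OF assms] by linarith
qed

lemma bfs_eq_light:
  assumes "bfs E x i \<inter> Heavy = {}" "x < n" "x \<notin> Heavy"
  shows "bfs (light_graph g) x i = bfs E x i"
  using assms(1)
proof (induction i)
  case (Suc i)
  then have IH: "bfs (light_graph g) x i = bfs E x i" by auto
  have "light_graph g u y = E u y" if "u \<in> bfs E x i" for u y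
  proof -
    have "y \<notin> Heavy" if "E u y" using Suc.prems \<open>u \<in> bfs E x i\<close> that by auto
    moreover have "u \<notin> Heavy" using Suc.prems that by auto
    ultimately show ?thesis by (auto simp: light_graph_def egraph_def Light_def Heavy_def)
  qed
  then show ?case using IH by auto
qed simp

text \<open>Without heavy vertices the ball is also a ball of the light graph. With
  \<open>\<theta>\<close> or more vertices it would have a heavy neighbour, and that neighbour would
  lie in the next ball, contrary to \<open>no\<close>.\<close>

lemma small_light:
  assumes x: "x < n" and i: "i < n" and no: "bfs E x (Suc i) \<inter> Heavy = {}"
  shows "real (card (bfs E x i)) < \<theta>"
proof (rule ccontr)
  assume "\<not> real (card (bfs E x i)) < \<theta>"
  then have big: "\<theta> \<le> real (card (bfs E x i))" by simp
  have xH: "x \<notin> Heavy" using no by auto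
  then have xL: "x \<in> Light" using x by (auto simp: Heavy_def Light_def)
  have eq: "bfs (light_graph g) x i = bfs E x i" using bfs_eq_light[OF _ x xH] no by auto
  then obtain e where e: "e \<in> upair ` (bfs E x i \<times> Heavy)" "g e"
    using good xL i big unfolding good_def by metis
  then obtain u h where uh: "u \<in> bfs E x i" "h \<in> Heavy" "g (upair (u, h))" by auto
  have "u \<noteq> h" using uh no by auto
  moreover have "u < n" "h < n" using uh bfs_dom[OF x] by (auto simp: Heavy_def)
  ultimately have "E u h" using uh by (simp add: egraph_def)
  then show False using uh no by auto
qed

text \<open>The factor 3 adds up the ball two steps earlier and two cuts, each contributing at most
  \<open>\<theta>\<close>.\<close>

lemma small_ball_step:
  assumes x: "x < n" and i: "i < n" and no: "bfs E x (Suc i) \<inter> Heavy = {}"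
    and c: "cut (bfs E x i) < \<theta>" "cut (bfs E x (Suc i)) < \<theta>"
  shows "real (card (bfs E x (Suc (Suc i)))) \<le> 3 * \<theta>"
proof -
  have 1: "real (card (bfs E x (Suc i))) \<le> 2 * \<theta>"
  proof (cases i)
    case 0
    then show ?thesis using \<theta>_ge1 by simp
  next
    case (Suc j)
    then show ?thesis using card_bfs_Suc[OF x, of i] small_light[OF x i no] c(1) by simp
  qed
  show ?thesis using card_bfs_Suc[OF x, of "Suc i"] 1 c(2) by simp
qed

text \<open>A heavy vertex has at least \<open>4 * \<theta>\<close> neighbours, of which at most
  \<open>3 * \<theta>\<close> fit into \<open>B\<close>.\<close>

lemma heavy_cut:
  assumes x: "x < n" and B: "B \<subseteq> {..<n}" "real (card B) \<le> 3 * \<theta>" and h: "h \<in> B" "h \<in> Heavy"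
  shows "\<theta> \<le> cut B"
proof -
  have hn: "h < n" using h by (simp add: Heavy_def)
  have "c0 * th = 16 * \<theta>" using c0_pos by (simp add: th_def)
  then have "16 * \<theta> \<le> c0 * p h" using h c0_pos by (metis (mono_tags, lifting) Heavy_def mem_Collect_eq mult_left_mono less_imp_le)
  then have d: "4 * \<theta> \<le> dg h" using deg_lower[OF hn] \<theta>_ge by simp
  have fB: "finite B" using B finite_subset by blast
  have "{y. y < n \<and> E h y} \<subseteq> B \<union> {y. y < n \<and> y \<notin> B \<and> E h y}" by auto
  then have "deg E n h \<le> card (B \<union> {y. y < n \<and> y \<notin> B \<and> E h y})"
    unfolding deg_def using fB by (intro card_mono) auto
  also have "\<dots> \<le> card B + card {y. y < n \<and> y \<notin> B \<and> E h y}" by (rule card_Un_le)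
  also have "card {y. y < n \<and> y \<notin> B \<and> E h y} = card (Pair h ` {y. y < n \<and> y \<notin> B \<and> E h y})"
    by (rule card_image[symmetric]) (auto simp: inj_on_def)
  also have "\<dots> \<le> cut_edges E n B" unfolding cut_edges_def
    by (rule card_mono[OF cut_finite[OF fB]]) (use h in auto)
  finally have "dg h \<le> real (card B) + cut B" by simp
  then show ?thesis using d B(2) by simp
qed

text \<open>Size and absence of heavy vertices are proved alternately: a heavy-free ball bounds the
  next one by \<open>3 * \<theta>\<close>, and in a ball of that size a heavy vertex would push the
  cut to \<open>\<theta>\<close>.\<close>

lemma small_ball:
  assumes x: "x < n" and j: "j \<le> n" and c: "\<And>i. 1 \<le> i \<Longrightarrow> i < j \<Longrightarrow> cut (bfs E x i) < \<theta>"
  shows "real (card (bfs E x j)) \<le> 3 * \<theta>"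
proof -
  have c0: "cut (bfs E x i) < \<theta>" if "i < j" for i
    using c[of i] that \<theta>_pos by (cases i) (auto simp: cut_edges_def)
  have t1: "1 \<le> 3 * \<theta>" using \<theta>_ge1 by simp
  have no: "bfs E x i \<inter> Heavy = {}" if "i < j" for i
    using that
  proof (induction i)
    case (Suc i)
    have "real (card (bfs E x (Suc i))) \<le> 3 * \<theta>"
    proof (cases i)
      case 0
      then show ?thesis using t1 by simp
    next
      case (Suc k)
      then show ?thesis using small_ball_step[OF x, of k] Suc.IH Suc.prems j c0 by (simp del: bfs.simps)
    qed
    then have "\<theta> \<le> cut (bfs E x (Suc i))" if "h \<in> bfs E x (Suc i)" "h \<in> Heavy" for h
      using heavy_cut[OF x bfs_dom[OF x] _ that] by blast
    then show ?case using c0[OF Suc.prems] by fastforce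
  qed simp
  show ?thesis
  proof (cases j)
    case 0
    then show ?thesis using \<theta>_pos by simp
  next
    case (Suc k)
    show ?thesis
    proof (cases k)
      case 0
      then show ?thesis using Suc t1 by simp
    next
      case (Suc i)
      then show ?thesis using small_ball_step[OF x, of i] no[of "Suc i"] c0 j \<open>j = Suc k\<close> by (simp del: bfs.simps)
    qed
  qed
qed

text \<open>A cut edge ends at distance exactly \<open>Suc i\<close>, so the first large cut occurs
  among the indices that \<open>good\<close> covers.\<close>

lemma cut_pos_lt_n:
  assumes "x < n" "0 < cut (bfs E x (Suc i))"
  shows "Suc i < n"
proof -
  have "cut_edges E n (bfs E x (Suc i)) \<noteq> 0" using assms(2) by simp
  then obtain u v where uv: "u \<in> bfs E x (Suc i)" "v \<notin> bfs E x (Suc i)" "E u v"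
    unfolding cut_edges_def by (metis (mono_tags, lifting) Collect_empty_eq card.empty case_prodE)
  then have "v \<in> bfs E x (Suc (Suc i))" by auto
  then have "gdist E x v \<le> enat (Suc i)" "\<not> gdist E x v \<le> enat i"
    using uv(2) unfolding bfs_Suc_iff_gdist by auto
  then have "gdist E x v = enat (Suc i)" by (cases "gdist E x v") auto
  then show ?thesis using gdist_lt_n assms(1) by blast
qed

abbreviation rad where "rad \<equiv> radius E n \<theta>"

text \<open>Index shift: the ball of radius \<open>l - 1\<close> is \<open>bfs E x l\<close>, so the
  radius is the first positive index at which the cut of \<open>bfs\<close> reaches
  \<open>\<theta>\<close>. The first alternative is the default value \<open>n\<close> for vertices
  where this never happens.\<close>

lemma radius_cases:
  assumes x: "x < n"
  obtains (none) "rad x = n" "\<And>i. 1 \<le> i \<Longrightarrow> cut (bfs E x i) < \<theta>"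
    | (real) i where "rad x = Suc i" "Suc i < n" "\<theta> \<le> cut (bfs E x (Suc i))" "\<And>j. 1 \<le> j \<Longrightarrow> j < Suc i \<Longrightarrow> cut (bfs E x j) < \<theta>"
proof -
  define R where "R l \<longleftrightarrow> 1 \<le> l \<and> \<theta> \<le> cut (nball E n (l - 1) x)" for l
  have R: "R l \<longleftrightarrow> 1 \<le> l \<and> \<theta> \<le> cut (bfs E x l)" for l
    using nball_eq_bfs[OF x, of "l - 1"] by (cases l) (auto simp: R_def)
  have rad: "rad x = (if \<exists>l. R l then LEAST l. R l else n)"
    unfolding radius_def R_def by simp
  show ?thesis
  proof (cases "\<exists>l. R l")
    case True
    then have l: "R (rad x)" "\<And>j. j < rad x \<Longrightarrow> \<not> R j"
      unfolding rad by (auto intro: LeastI_ex dest: not_less_Least)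
    then obtain i where i: "rad x = Suc i" using R by (cases "rad x") auto
    have c: "\<theta> \<le> cut (bfs E x (Suc i))" using l(1) R i by auto
    show ?thesis
    proof (rule that(2)[OF i _ c])
      show "Suc i < n" using cut_pos_lt_n[OF x] c \<theta>_pos by (metis less_le_trans)
      show "cut (bfs E x j) < \<theta>" if "1 \<le> j" "j < Suc i" for j
        using l(2)[of j] R[of j] i that by auto
    qed
  next
    case False
    show ?thesis
    proof (rule that(1))
      show "rad x = n" using rad False by simp
      show "cut (bfs E x i) < \<theta>" if "1 \<le> i" for i
        using False R[of i] that by auto
    qed
  qed
qed

lemma radius_reaches_w:
  assumes x: "x < n"
  shows "(\<forall>y. gdist E x y \<noteq> \<infinity> \<longrightarrow> gdist E x y \<le> enat (rad x - 1))
      \<or> (1 \<le> rad x \<and> gdist E x w \<le> enat (rad x))"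
  using x
proof (cases rule: radius_cases)
  case none
  have "gdist E x y \<le> enat (rad x - 1)" if "gdist E x y \<noteq> \<infinity>" for y
    using that gdist_lt_n[of x y] x none(1) by (cases "gdist E x y") auto
  then show ?thesis by blast
next
  case (real i)
  \<comment> \<open>The cut of \<open>bfs E x (Suc i)\<close> is large, so its last sphere is
    adjacent to \<open>w\<close> unless \<open>w\<close> already lies inside; one more step gives
    distance at most \<open>Suc i\<close>.\<close>
  have "\<not> hub_missed (bfs E x i) (bfs E x (Suc i)) g" using good x real(2) unfolding good_def by auto
  then have "w \<in> bfs E x (Suc i) \<or> (\<exists>e\<in>upair ` ((bfs E x (Suc i) - bfs E x i) \<times> {w}). g e)"
    using real(3) cut_bfs[OF x] by (auto simp: hub_missed_def simp del: bfs.simps)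
  then have "w \<in> bfs E x (Suc (Suc i))"
  proof
    assume "w \<in> bfs E x (Suc i)"
    then show ?thesis by auto
  next
    assume "\<exists>e\<in>upair ` ((bfs E x (Suc i) - bfs E x i) \<times> {w}). g e"
    then obtain u where u: "u \<in> bfs E x (Suc i)" "g (upair (u, w))" by blast
    then have "u = w \<or> E u w" using bfs_dom[OF x] w(1) by (auto simp: egraph_def simp del: bfs.simps)
    then show ?thesis using u by auto
  qed
  then show ?thesis using real(1) by (simp add: bfs_Suc_iff_gdist del: bfs.simps)
qed

text \<open>Ties do not matter: the first \<open>H\<close> vertices and those at or above the degree
  threshold are sets of equal size, so if they differed, a vertex below the threshold would precede
  one above it.\<close>

lemma take_drop_high:
  assumes xs: "degree_ordering E n xs" and H: "H = card {v. v < n \<and> K \<le> dg v}"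
  shows "set (take H xs) = {v. v < n \<and> K \<le> dg v}" "v \<in> set (drop H xs) \<Longrightarrow> v < n \<and> dg v < K"
proof -
  have d: "distinct xs" "set xs = {..<n}" and s: "sorted_wrt (\<lambda>a b. deg E n b \<le> deg E n a) xs"
    using xs by (auto simp: degree_ordering_def)
  define X where "X = {v. v < n \<and> K \<le> dg v}"
  have X: "X \<subseteq> set xs" "finite X" using d(2) by (auto simp: X_def)
  have "H \<le> card (set xs)" unfolding H X_def[symmetric] using X by (intro card_mono) auto
  then have lenH: "H \<le> length xs" using d(1) by (simp add: distinct_card)
  have split: "set xs = set (take H xs) \<union> set (drop H xs)" by (metis append_take_drop_id set_append)
  have disj: "set (take H xs) \<inter> set (drop H xs) = {}" using d(1)
    by (metis append_take_drop_id distinct_append)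
  have cT: "card (set (take H xs)) = H" using lenH d(1) by (simp add: distinct_card)
  have le: "deg E n b \<le> deg E n a" if "a \<in> set (take H xs)" "b \<in> set (drop H xs)" for a b
    using s that by (metis append_take_drop_id sorted_wrt_append)
  have "set (take H xs) = X"
  proof (rule ccontr)
    assume ne: "set (take H xs) \<noteq> X"
    have "\<not> X \<subseteq> set (take H xs)"
      using ne cT H X_def card_subset_eq[of "set (take H xs)" X] by auto
    then obtain y where y: "y \<in> X" "y \<in> set (drop H xs)" using X split by blast
    have "\<not> set (take H xs) \<subseteq> X"
      using ne cT H X_def card_subset_eq[of X "set (take H xs)"] X by auto
    then obtain a where a: "a \<in> set (take H xs)" "a \<notin> X" by blast
    have "a < n" using a(1) d(2) set_take_subset[of H xs] by auto
    then have "dg a < K" using a(2) by (auto simp: X_def)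
    moreover have "K \<le> dg y" using y(1) by (auto simp: X_def)
    ultimately show False using le[OF a(1) y(2)] by simp
  qed
  then show "set (take H xs) = {v. v < n \<and> K \<le> dg v}" by (simp add: X_def)
  show "v < n \<and> dg v < K" if "v \<in> set (drop H xs)"
    using that \<open>set (take H xs) = X\<close> disj split d(2) by (auto simp: X_def not_le)
qed

lemma good_cover:
  assumes xs: "degree_ordering E n xs" and H: "H = card {v. v < n \<and> K \<le> dg v}"
  shows "is_2hop_cover E n (approx_pruning E n xs H rad)"
proof (rule approx_pruning_cover[OF xs])
  show "w \<in> set (take H xs)" using take_drop_high(1)[OF xs H] w(1) deg_w by auto
qed (use radius_reaches_w in auto)

section \<open>Size of the labels\<close>

definition stored_sphere where "stored_sphere v l = {y. y < n \<and> gdist E v y = enat l \<and>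
    (\<exists>z<n. E y z \<and> gdist E v z = enat (l - 1) \<and> deg E n z \<le> deg E n y)}"

lemma card_UN_bound:
  assumes "finite S" "\<And>z. z \<in> S \<Longrightarrow> real (card (f z)) \<le> h z"
  shows "real (card (\<Union>z\<in>S. f z)) \<le> (\<Sum>z\<in>S. h z)"
proof -
  have "card (\<Union>z\<in>S. f z) \<le> (\<Sum>z\<in>S. card (f z))" by (rule card_UN_le[OF assms(1)])
  then have "real (card (\<Union>z\<in>S. f z)) \<le> (\<Sum>z\<in>S. real (card (f z)))" by (metis of_nat_le_iff of_nat_sum)
  also have "\<dots> \<le> (\<Sum>z\<in>S. h z)" by (intro sum_mono assms)
  finally show ?thesis .
qed

text \<open>A stored vertex of degree less than \<open>K\<close> has a neighbour \<open>z\<close> on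
  the previous sphere of no larger degree, so \<open>z\<close> also has degree less than
  \<open>K\<close> and \<open>high_nbrs\<close> applies to it.\<close>

lemma stored_sphere_sub:
  assumes S: "{z. z < n \<and> gdist E v z = enat (l - 1)} \<subseteq> S"
  shows "stored_sphere v l \<subseteq> {y. y < n \<and> K \<le> dg y} \<union> (\<Union>z\<in>{z\<in>S. dg z < K}. {y. E z y \<and> dg z \<le> dg y \<and> dg y < K})"
proof
  fix y assume "y \<in> stored_sphere v l"
  then obtain z where z: "y < n" "z < n" "E y z" "gdist E v z = enat (l - 1)" "deg E n z \<le> deg E n y"
    unfolding stored_sphere_def by blast
  show "y \<in> {y. y < n \<and> K \<le> dg y} \<union> (\<Union>z\<in>{z\<in>S. dg z < K}. {y. E z y \<and> dg z \<le> dg y \<and> dg y < K})"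
  proof (cases "K \<le> dg y")
    case False
    moreover have "z \<in> S" using z S by blast
    ultimately show ?thesis using z E_sym by force
  qed (use z in auto)
qed

lemma card_stored_sphere:
  assumes S: "{z. z < n \<and> gdist E v z = enat (l - 1)} \<subseteq> S" "S \<subseteq> {..<n}"
  shows "real (card (stored_sphere v l)) \<le> Hb + (\<Sum>z\<in>{z\<in>S. dg z < K}. 2 * nbr_const * p z powr (3 - b) + deg_const * L)"
proof -
  let ?U = "\<Union>z\<in>{z\<in>S. dg z < K}. {y. E z y \<and> dg z \<le> dg y \<and> dg y < K}"
  have fS: "finite {z\<in>S. dg z < K}" using S(2) finite_subset by fastforce
  have "?U \<subseteq> {..<n}" using E_dom2 by auto
  then have fU: "finite ?U" using finite_subset by blast
  have "card (stored_sphere v l) \<le> card ({y. y < n \<and> K \<le> dg y} \<union> ?U)"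
    by (rule card_mono[OF _ stored_sphere_sub[OF S(1)]]) (use fU in auto)
  also have "\<dots> \<le> card {y. y < n \<and> K \<le> dg y} + card ?U" by (rule card_Un_le)
  finally have "real (card (stored_sphere v l)) \<le> real (card {y. y < n \<and> K \<le> dg y}) + real (card ?U)" by simp
  also have "\<dots> \<le> Hb + (\<Sum>z\<in>{z\<in>S. dg z < K}. 2 * nbr_const * p z powr (3 - b) + deg_const * L)"
    by (intro add_mono card_high card_UN_bound fS high_nbrs) (use S(2) in auto)
  finally show ?thesis .
qed

lemma Hb_nonneg: "0 \<le> Hb" using Hb by (meson of_nat_0_le_iff order_trans)

lemma deg_const_pos: "0 < deg_const" using c0_pos by (auto simp: deg_const_def intro: add_pos_pos)

lemma spread_bound_nonneg: "0 \<le> spread_bound" using M_nonneg \<theta>_pos c0_pos xmin L_pos by (simp add: spread_bound_def spread_mean_def)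

text \<open>With the default radius the outer sphere is empty; with radius 1 the previous sphere is
  \<open>v\<close> alone; otherwise the previous sphere is controlled by the cut and the spread sum
  of the ball before it, both still below their bounds.\<close>

lemma stored_sphere_bound:
  assumes v: "v < n" "dg v < K"
  shows "real (card (stored_sphere v (rad v))) \<le> Hb + deg_const * \<theta> * L + 2 * nbr_const * spread_bound + 2 * nbr_const * wcap powr (3 - b) + deg_const * L"
  using v(1)
proof (cases rule: radius_cases)
  case none
  have "stored_sphere v (rad v) = {}" unfolding stored_sphere_def none(1) using gdist_lt_n[OF _ v(1)] by blast
  then show ?thesis using Hb_nonneg deg_const_pos L_pos \<theta>_pos spread_bound_nonneg nbr_const_nonneg by simp
next
  case (real i)
  have nn: "0 \<le> deg_const * \<theta> * L + 2 * nbr_const * spread_bound" "0 \<le> 2 * nbr_const * wcap powr (3 - b) + deg_const * L"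
    using deg_const_pos L_pos \<theta>_pos spread_bound_nonneg nbr_const_nonneg by auto
  show ?thesis
  proof (cases i)
    case 0
    have "{z. z < n \<and> gdist E v z = enat (rad v - 1)} \<subseteq> {v}"
      using real(1) 0 gdist_eq_0_iff zero_enat_def by auto
    then have "real (card (stored_sphere v (rad v))) \<le> Hb + (\<Sum>z\<in>{z\<in>{v}. dg z < K}. 2 * nbr_const * p z powr (3 - b) + deg_const * L)"
      by (rule card_stored_sphere) (use v in auto)
    also have "{z\<in>{v}. dg z < K} = {v}" using v by auto
    also have "(\<Sum>z\<in>{v}. 2 * nbr_const * p z powr (3 - b) + deg_const * L) \<le> 2 * nbr_const * wcap powr (3 - b) + deg_const * L"
      using deg_less_K[OF v] p_pos[OF v(1)] nbr_const_nonneg b by (auto intro!: mult_left_mono powr_mono2)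
    finally show ?thesis using nn by simp
  next
    case (Suc j)
    define A where "A = bfs E v j"
    define B where "B = bfs E v (Suc j)"
    define S where "S = bfs E v (Suc (Suc j)) - B"
    have cutB: "cut B < \<theta>" unfolding B_def using real(4)[of "Suc j"] Suc by simp
    have "real (card B) \<le> 3 * \<theta>"
      unfolding B_def by (rule small_ball) (use v real Suc in auto)
    \<comment> \<open>Here \<open>6 * \<theta> \<le> n\<close> enters: the ball fills at most half
      of the vertices, as \<open>spread_exceeded\<close> requires.\<close>
    then have cB: "2 * card B \<le> n" using \<theta>_le by linarith
    have "\<not> spread_exceeded A B g" using good v(1) real(2) Suc unfolding good_def A_def B_def by auto
    then have \<Phi>: "esum spread_weight (B - A) ({..<n} - B) g < spread_bound"
      using cB cutB cut_bfs[OF v(1), of j] by (auto simp: spread_exceeded_def A_def B_def simp del: bfs.simps)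
    have Sn: "S \<subseteq> {..<n}" using bfs_dom[OF v(1)] by (auto simp: S_def simp del: bfs.simps)
    have fS: "finite S" using Sn finite_subset by blast
    have cS: "real (card S) < \<theta>"
      using sphere_le_cut[OF v(1), of "Suc j"] cutB by (simp add: S_def B_def del: bfs.simps)
    have a5n: "0 \<le> spread_weight y" for y by (simp add: spread_weight_def)
    have "(\<Sum>z\<in>S. spread_weight z) \<le> esum spread_weight (B - A) ({..<n} - B) g"
    proof -
      have ex: "\<exists>u. u \<in> B - A \<and> g (upair (u, z))" if "z \<in> S" for z
      proof -
        have "z \<in> bfs E v (Suc (Suc j))" "z \<notin> B" using that by (auto simp: S_def simp del: bfs.simps)
        moreover have "v \<in> B" by (auto simp: B_def)
        ultimately obtain u where u: "u \<in> B" "E u z" unfolding B_def by auto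
        have "u \<notin> A" using u(2) \<open>z \<notin> B\<close> by (auto simp: A_def B_def)
        then show ?thesis using u by (auto simp: egraph_def)
      qed
      \<comment> \<open>Each vertex of the sphere is charged to one edge from \<open>B - A\<close>;
        the edge sum counts it at least once.\<close>
      then obtain \<rho> where \<rho>: "\<And>z. z \<in> S \<Longrightarrow> \<rho> z \<in> B - A \<and> g (upair (\<rho> z, z))" by metis
      have fin: "finite ((B - A) \<times> ({..<n} - B))" using finite_bfs[OF v(1)] by (simp add: B_def del: bfs.simps)
      have "(\<Sum>z\<in>S. spread_weight z) = (\<Sum>t\<in>(\<lambda>z. (\<rho> z, z)) ` S. spread_weight (snd t) * of_bool (g (upair t)))"
        using \<rho> by (subst sum.reindex) (auto simp: inj_on_def)
      also have "\<dots> \<le> esum spread_weight (B - A) ({..<n} - B) g"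
        unfolding esum_def using \<rho> Sn a5n by (intro sum_mono2 fin) (auto simp: S_def)
      finally show ?thesis .
    qed
    then have aS: "(\<Sum>z\<in>S. spread_weight z) \<le> spread_bound" using \<Phi> by simp
    have "{z. z < n \<and> gdist E v z = enat (rad v - 1)} \<subseteq> S"
      unfolding S_def B_def bfs_Suc_iff_gdist real(1) Suc
      by (auto simp: bfs_Suc_iff_gdist simp del: bfs.simps)
    then have "real (card (stored_sphere v (rad v))) \<le> Hb + (\<Sum>z\<in>{z\<in>S. dg z < K}. 2 * nbr_const * p z powr (3 - b) + deg_const * L)"
      by (rule card_stored_sphere) (rule Sn)
    also have "(\<Sum>z\<in>{z\<in>S. dg z < K}. 2 * nbr_const * p z powr (3 - b) + deg_const * L) \<le> (\<Sum>z\<in>{z\<in>S. dg z < K}. 2 * nbr_const * spread_weight z + deg_const * L)"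
      using deg_less_K Sn by (intro sum_mono) (auto simp: spread_weight_def)
    also have "\<dots> \<le> (\<Sum>z\<in>S. 2 * nbr_const * spread_weight z + deg_const * L)"
      by (rule sum_mono2[OF fS]) (use a5n nbr_const_nonneg deg_const_pos L_pos in auto)
    also have "\<dots> = 2 * nbr_const * (\<Sum>z\<in>S. spread_weight z) + real (card S) * (deg_const * L)"
      by (simp add: sum.distrib sum_distrib_left)
    also have "\<dots> \<le> 2 * nbr_const * spread_bound + \<theta> * (deg_const * L)"
      using aS cS nbr_const_nonneg deg_const_pos L_pos by (intro add_mono mult_left_mono mult_right_mono) auto
    finally show ?thesis using nn by (simp add: algebra_simps)
  qed
qed

lemma good_landmarks:
  assumes xs: "degree_ordering E n xs" and H: "H = card {v. v < n \<and> K \<le> dg v}" and v: "v < n"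
  shows "real (num_landmarks (approx_pruning E n xs H rad) v) \<le> label_bound"
proof -
  have d: "distinct xs" "set xs = {..<n}" using xs by (auto simp: degree_ordering_def)
  define P1 where "P1 = phase1 E n (take H xs) {} (\<lambda>_. {}) v"
  \<comment> \<open>Whatever the searches prune, the landmarks of the first phase are roots.\<close>
  have P1: "fst ` P1 \<subseteq> {v. v < n \<and> K \<le> dg v}"
  proof
    fix z assume "z \<in> fst ` P1"
    then obtain e where "(z, e) \<in> phase1 E n (take H xs) {} (\<lambda>_. {}) v" by (auto simp: P1_def)
    then have "z \<in> {} \<union> set (take H xs) \<and> gdist E z v \<le> enat e"
      by (intro phase1_sound) (use d set_take_subset[of H xs] in auto)
    then show "z \<in> {v. v < n \<and> K \<le> dg v}" using take_drop_high(1)[OF xs H] by auto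
  qed
  then have c1: "real (card (fst ` P1)) \<le> Hb"
    using card_high card_mono[OF _ P1] by (force intro: order_trans)
  have nn: "0 \<le> Hb" "0 \<le> 3 * \<theta>" "0 \<le> deg_const * \<theta> * L" "0 \<le> 2 * nbr_const * spread_bound" "0 \<le> 2 * nbr_const * wcap powr (3 - b)" "0 \<le> deg_const * L"
    using Hb_nonneg deg_const_pos L_pos \<theta>_pos spread_bound_nonneg nbr_const_nonneg by auto
  show ?thesis
  proof (cases "v \<in> set (drop H xs)")
    case False
    then have "num_landmarks (approx_pruning E n xs H rad) v = card (fst ` P1)"
      by (simp add: num_landmarks_def approx_pruning_def P1_def Let_def)
    then show ?thesis using c1 nn by (simp add: label_bound_def)
  next
    case True
    then have vK: "dg v < K" using take_drop_high(2)[OF xs H] by blast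
    have "fst ` phase2_labels E n (rad v) v \<subseteq> nball E n (rad v - 1) v \<union> stored_sphere v (rad v)"
      by (auto simp: phase2_labels_def nball_def stored_sphere_def)
    then have sub: "fst ` (P1 \<union> phase2_labels E n (rad v) v) \<subseteq> fst ` P1 \<union> (nball E n (rad v - 1) v \<union> stored_sphere v (rad v))"
      by auto
    have fin: "finite (nball E n (rad v - 1) v)" "finite (stored_sphere v (rad v))" "finite (fst ` P1)"
      using finite_subset[OF P1] by (auto simp: nball_def stored_sphere_def)
    have "num_landmarks (approx_pruning E n xs H rad) v = card (fst ` (P1 \<union> phase2_labels E n (rad v) v))"
      using True by (simp add: num_landmarks_def approx_pruning_def P1_def Let_def)
    also have "\<dots> \<le> card (fst ` P1 \<union> (nball E n (rad v - 1) v \<union> stored_sphere v (rad v)))"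
      using fin by (intro card_mono sub) auto
    also have "\<dots> \<le> card (fst ` P1) + (card (nball E n (rad v - 1) v) + card (stored_sphere v (rad v)))"
      by (meson add_left_mono card_Un_le order_trans)
    finally have "real (num_landmarks (approx_pruning E n xs H rad) v) \<le>
      real (card (fst ` P1)) + (real (card (nball E n (rad v - 1) v)) + real (card (stored_sphere v (rad v))))" by linarith
    moreover have "real (card (nball E n (rad v - 1) v)) \<le> 3 * \<theta>"
      using v
    proof (cases rule: radius_cases)
      case none
      then have "nball E n (rad v - 1) v = bfs E v n" using nball_eq_bfs[OF v, of "n - 1"] n2 by (simp del: bfs.simps)
      then show ?thesis using small_ball[OF v, of n] none(2) by simp
    next
      case (real i)
      then have "nball E n (rad v - 1) v = bfs E v (Suc i)" using nball_eq_bfs[OF v, of i] by (simp del: bfs.simps)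
      then show ?thesis using small_ball[OF v, of "Suc i"] real by (simp del: bfs.simps)
    qed
    ultimately show ?thesis using c1 stored_sphere_bound[OF v vK] by (simp add: label_bound_def)
  qed
qed

end

end

section \<open>The weight distribution\<close>

definition tail_prob :: "real \<Rightarrow> real \<Rightarrow> real \<Rightarrow> real" where
  "tail_prob xmin b t = (xmin / t) powr (b - 1)"

lemma space_weight_dist [simp]: "space (weight_dist xmin b) = UNIV"
  and sets_weight_dist [simp]: "sets (weight_dist xmin b) = sets borel"
  by (simp_all add: weight_dist_def)

lemma plaw_density_measurable [measurable]: "plaw_density xmin b \<in> borel_measurable borel"
proof -
  have "plaw_density xmin b = (\<lambda>t. if t \<in> {xmin..} then (b - 1) * xmin powr (b - 1) * t powr (- b) else 0)"
    by (auto simp: plaw_density_def fun_eq_iff)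
  then show ?thesis by simp
qed

lemma emeasure_weight_tail:
  assumes "0 < xmin" "1 < b" "xmin \<le> t"
  shows "emeasure (weight_dist xmin b) {t..} = ennreal (tail_prob xmin b t)"
proof -
  have t: "0 < t" using assms by simp
  define F where "F s = - (xmin powr (b - 1) * s powr (1 - b))" for s
  have "emeasure (weight_dist xmin b) {t..} = (\<integral>\<^sup>+s. ennreal (plaw_density xmin b s) * indicator {t..} s \<partial>lborel)"
    unfolding weight_dist_def by (subst emeasure_density) auto
  also have "\<dots> = (\<integral>\<^sup>+s. ennreal ((b - 1) * xmin powr (b - 1) * s powr (- b)) * indicator {t..} s \<partial>lborel)"
    using assms by (intro nn_integral_cong) (auto simp: plaw_density_def indicator_def)
  also have "\<dots> = ennreal (0 - F t)"
  proof (rule nn_integral_FTC_atLeast)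
    show "(\<lambda>s. (b - 1) * xmin powr (b - 1) * s powr (- b)) \<in> borel_measurable borel" by measurable
    show "(F has_real_derivative (b - 1) * xmin powr (b - 1) * s powr (- b)) (at s)" if "t \<le> s" for s
      unfolding F_def using t that by (auto intro!: derivative_eq_intros simp: algebra_simps)
    show "0 \<le> (b - 1) * xmin powr (b - 1) * s powr (- b)" if "t \<le> s" for s
      using assms by simp
    have "((\<lambda>s. s powr (1 - b)) \<longlongrightarrow> 0) at_top"
      using tendsto_neg_powr[of "1 - b" "\<lambda>s. s" at_top] assms(2) filterlim_ident by auto
    then have "((\<lambda>s. - (xmin powr (b - 1) * s powr (1 - b))) \<longlongrightarrow> - (xmin powr (b - 1) * 0)) at_top"
      by (intro tendsto_intros)
    then show "(F \<longlongrightarrow> 0) at_top" by (simp add: F_def[abs_def])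
  qed
  also have "0 - F t = tail_prob xmin b t"
    using assms t by (simp add: F_def tail_prob_def powr_divide powr_diff field_simps)
  finally show ?thesis .
qed

lemma prob_space_weight_dist:
  assumes "0 < xmin" "1 < b"
  shows "prob_space (weight_dist xmin b)"
proof (rule prob_spaceI)
  have "emeasure (weight_dist xmin b) (space (weight_dist xmin b)) = (\<integral>\<^sup>+s. ennreal (plaw_density xmin b s) * indicator UNIV s \<partial>lborel)"
    unfolding weight_dist_def by (subst emeasure_density) auto
  also have "\<dots> = (\<integral>\<^sup>+s. ennreal (plaw_density xmin b s) * indicator {xmin..} s \<partial>lborel)"
    by (intro nn_integral_cong) (auto simp: plaw_density_def indicator_def)
  also have "\<dots> = emeasure (weight_dist xmin b) {xmin..}"
    unfolding weight_dist_def by (subst emeasure_density) auto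
  also have "\<dots> = 1" using emeasure_weight_tail[OF assms, of xmin] assms(1) by (simp add: tail_prob_def)
  finally show "emeasure (weight_dist xmin b) (space (weight_dist xmin b)) = 1" .
qed

lemma measure_weight_tail:
  assumes "0 < xmin" "1 < b" "xmin \<le> t"
  shows "measure (weight_dist xmin b) {t..} = tail_prob xmin b t"
  using emeasure_weight_tail[OF assms] assms by (simp add: measure_def tail_prob_def)

lemma tail_prob_range: "0 < xmin \<Longrightarrow> 1 < b \<Longrightarrow> xmin \<le> t \<Longrightarrow> 0 \<le> tail_prob xmin b t \<and> tail_prob xmin b t \<le> 1"
  unfolding tail_prob_def by (auto intro!: powr_le1)

section \<open>Dyadic scales and concentration of the weights\<close>

lemma dyad:
  assumes "0 < xmin" "xmin \<le> (x::real)"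
  shows "\<exists>k. xmin * 2 ^ k \<le> x \<and> x < xmin * 2 ^ Suc k"
proof -
  obtain k where "x / xmin < 2 ^ k" using real_arch_pow[of 2 "x / xmin"] by auto
  then have ex: "\<exists>k. x < xmin * 2 ^ k" using assms by (intro exI[of _ k]) (simp add: field_simps)
  define k where "k = (LEAST k. x < xmin * 2 ^ k)"
  have k: "x < xmin * 2 ^ k" unfolding k_def using ex by (rule LeastI_ex)
  then obtain j where j: "k = Suc j" using assms by (cases k) auto
  have "\<not> x < xmin * 2 ^ j" unfolding j by (rule not_less_Least) (use j k_def in simp)
  then show ?thesis using k j by (intro exI[of _ j]) auto
qed

text \<open>Grouping by dyadic scale reduces sums over weights to finitely many tail counts, the
  only random quantities that have to concentrate from above. Replacing the count of one scale by
  the whole tail above it costs only a constant for power laws.\<close>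

lemma sum_dyadic:
  fixes p f :: "nat \<Rightarrow> real"
  assumes V: "finite V" and J: "finite J" and x: "0 < xmin" and F: "\<And>k. 0 \<le> F k"
    and p: "\<And>v. v \<in> V \<Longrightarrow> xmin \<le> p v"
    and f: "\<And>v k. v \<in> V \<Longrightarrow> xmin * 2 ^ k \<le> p v \<Longrightarrow> p v < xmin * 2 ^ Suc k \<Longrightarrow> k \<in> J \<and> f v \<le> F k"
  shows "(\<Sum>v\<in>V. f v) \<le> (\<Sum>k\<in>J. real (card {v \<in> V. xmin * 2 ^ k \<le> p v}) * F k)"
proof -
  have "(\<Sum>v\<in>V. f v) \<le> (\<Sum>v\<in>V. \<Sum>k\<in>J. of_bool (xmin * 2 ^ k \<le> p v) * F k)"
  proof (rule sum_mono)
    fix v assume v: "v \<in> V"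
    obtain k where k: "xmin * 2 ^ k \<le> p v" "p v < xmin * 2 ^ Suc k" using dyad[OF x p[OF v]] by blast
    then have kJ: "k \<in> J" "f v \<le> F k" using f[OF v] by auto
    have "f v \<le> (\<Sum>k\<in>{k}. of_bool (xmin * 2 ^ k \<le> p v) * F k)" using k kJ by simp
    also have "\<dots> \<le> (\<Sum>k\<in>J. of_bool (xmin * 2 ^ k \<le> p v) * F k)"
      by (rule sum_mono2) (use J kJ F in auto)
    finally show "f v \<le> (\<Sum>k\<in>J. of_bool (xmin * 2 ^ k \<le> p v) * F k)" .
  qed
  also have "\<dots> = (\<Sum>k\<in>J. \<Sum>v\<in>V. of_bool (xmin * 2 ^ k \<le> p v) * F k)" by (rule sum.swap)
  also have "\<dots> = (\<Sum>k\<in>J. real (card {v \<in> V. xmin * 2 ^ k \<le> p v}) * F k)"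
    using V by (intro sum.cong refl) (simp add: sum_distrib_right[symmetric] Int_def)
  finally show ?thesis .
qed

abbreviation weight_prod :: "real \<Rightarrow> real \<Rightarrow> nat \<Rightarrow> (nat \<Rightarrow> real) measure" where
  "weight_prod xmin b n \<equiv> PiM {..<n} (\<lambda>_. weight_dist xmin b)"

text \<open>\<open>Tm\<close> bounds the weights, \<open>tw\<close> is the weight of a hub, \<open>th\<close> is the threshold for heavy vertices,
  and \<open>s\<close> is the slack in the dyadic counts.\<close>

definition regular_set :: "real \<Rightarrow> real \<Rightarrow> nat \<Rightarrow> real \<Rightarrow> real \<Rightarrow> real \<Rightarrow> real \<Rightarrow> (nat \<Rightarrow> real) set" where
  "regular_set xmin b n Tm tw th s = {p \<in> space (weight_prod xmin b n).
     (\<forall>v<n. p v \<in> {xmin..}) \<and> (\<forall>v<n. p v \<in> {..<Tm}) \<and> \<not> (\<forall>v<n. p v \<in> {..<tw}) \<and>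
     (\<forall>k<n. real (card {v. v < n \<and> xmin * 2 ^ k \<le> p v}) < 2 * (real n * tail_prob xmin b (xmin * 2 ^ k)) + s) \<and>
     real n * tail_prob xmin b th / 4 < real (card {v. v < n \<and> th \<le> p v})}"

context
  fixes xmin b :: real and n :: nat
  assumes xmin: "0 < xmin" and b: "1 < b"
begin

abbreviation W where "W \<equiv> weight_prod xmin b n"
abbreviation cnt where "cnt t p \<equiv> real (card {v. v < n \<and> t \<le> p v})"

lemma prob_space_W: "prob_space W"
  by (rule prob_space_PiM) (rule prob_space_weight_dist[OF xmin b])

interpretation W: prob_space W by (rule prob_space_W)

lemma W_box:
  assumes "A \<in> sets borel"
  shows "{p \<in> space W. \<forall>v<n. p v \<in> A} \<in> sets W"
    and "measure W {p \<in> space W. \<forall>v<n. p v \<in> A} = measure (weight_dist xmin b) A ^ n"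
proof -
  have eq: "{p \<in> space W. \<forall>v<n. p v \<in> A} = (\<Pi>\<^sub>E v\<in>{..<n}. A)"
    by (rule set_eqI) (simp add: space_PiM PiE_iff Ball_def conj_commute)
  show "{p \<in> space W. \<forall>v<n. p v \<in> A} \<in> sets W"
    unfolding eq by (rule sets_PiM_I_finite) (use assms in auto)
  interpret product_prob_space "\<lambda>_. weight_dist xmin b" "{..<n}"
    by (rule product_prob_spaceI) (rule prob_space_weight_dist[OF xmin b])
  interpret F: finite_product_prob_space "\<lambda>_. weight_dist xmin b" "{..<n}" by unfold_locales simp
  show "measure W {p \<in> space W. \<forall>v<n. p v \<in> A} = measure (weight_dist xmin b) A ^ n"
    unfolding eq by (subst F.finite_measure_PiM_emb) (use assms in auto)
qed

lemma W_cnt: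
  assumes "xmin \<le> t"
  shows "{p \<in> space W. R (cnt t p)} \<in> sets W"
    and "measure W {p \<in> space W. R (cnt t p)} =
      bprob {..<n} (\<lambda>_. tail_prob xmin b t) (\<lambda>g. R (\<Sum>v<n. of_bool (g v)))"
proof -
  define Q where "Q g \<longleftrightarrow> R (\<Sum>v<n. of_bool (g v))" for g
  have eq: "{p \<in> space W. R (cnt t p)} = {p \<in> space W. Q (\<lambda>i. i \<in> {..<n} \<and> p i \<in> {t..})}"
    by (auto simp: Q_def Int_def cong: conj_cong)
  have m: "measure (weight_dist xmin b) {t..} = tail_prob xmin b t" by (rule measure_weight_tail[OF xmin b assms])
  note PB = PiM_bern[of "{..<n}" "\<lambda>_. weight_dist xmin b" "\<lambda>_. {t..}" Q]
  show "{p \<in> space W. R (cnt t p)} \<in> sets W"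
    unfolding eq by (rule PB(1)) (use prob_space_weight_dist[OF xmin b] in auto)
  show "measure W {p \<in> space W. R (cnt t p)} =
      bprob {..<n} (\<lambda>_. tail_prob xmin b t) (\<lambda>g. R (\<Sum>v<n. of_bool (g v)))"
    unfolding eq Q_def[symmetric] m[symmetric]
    by (rule PB(2)) (use prob_space_weight_dist[OF xmin b] in auto)
qed

lemma W_cnt_upper:
  assumes "xmin \<le> t"
  shows "measure W {p \<in> space W. 2 * (real n * tail_prob xmin b t) + s \<le> cnt t p} \<le> exp (- s)"
  unfolding W_cnt(2)[OF assms, of "\<lambda>x. 2 * (real n * tail_prob xmin b t) + s \<le> x"]
  using bern_chernoff_upper[of "{..<n}" "{..<n}" "\<lambda>x. x" "\<lambda>_. tail_prob xmin b t" "\<lambda>_. 1" 1 "real n * tail_prob xmin b t" s]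
    tail_prob_range[OF xmin b assms] by simp

lemma W_cnt_lower:
  assumes "xmin \<le> t"
  shows "measure W {p \<in> space W. cnt t p \<le> real n * tail_prob xmin b t / 2 - s} \<le> exp (- s)"
  unfolding W_cnt(2)[OF assms, of "\<lambda>x. x \<le> real n * tail_prob xmin b t / 2 - s"]
  using bern_chernoff_lower[of "{..<n}" "{..<n}" "\<lambda>x. x" "\<lambda>_. tail_prob xmin b t" "real n * tail_prob xmin b t" s]
    tail_prob_range[OF xmin b assms] by simp

lemma measure_below:
  assumes "xmin \<le> t"
  shows "measure (weight_dist xmin b) {..<t} = 1 - tail_prob xmin b t"
proof -
  interpret D: prob_space "weight_dist xmin b" by (rule prob_space_weight_dist[OF xmin b])
  have "{..<t} = space (weight_dist xmin b) - {t..}" by auto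
  then show ?thesis using D.prob_compl[of "{t..}"] measure_weight_tail[OF xmin b assms] by simp
qed

text \<open>The four error terms belong to the maximum, the hub, the dyadic counts and the heavy
  vertices, in this order; the lower bound \<open>xmin\<close> fails with probability 0.\<close>

lemma measure_regular_set:
  assumes T: "xmin \<le> Tm" "xmin \<le> tw" "xmin \<le> th"
  shows "regular_set xmin b n Tm tw th s \<in> sets W"
    and "1 - (real n * tail_prob xmin b Tm + exp (- (real n * tail_prob xmin b tw)) + real n * exp (- s)
      + exp (- (real n * tail_prob xmin b th / 4))) \<le> measure W (regular_set xmin b n Tm tw th s)"
proof -
  define B1 where "B1 = {p \<in> space W. \<forall>v<n. p v \<in> {xmin..}}"
  define B2 where "B2 = {p \<in> space W. \<forall>v<n. p v \<in> {..<Tm}}"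
  define B3 where "B3 = {p \<in> space W. \<forall>v<n. p v \<in> {..<tw}}"
  define B4 where "B4 k = {p \<in> space W. 2 * (real n * tail_prob xmin b (xmin * 2 ^ k)) + s \<le> cnt (xmin * 2 ^ k) p}" for k
  \<comment> \<open>The Chernoff bound gives half of the mean minus a slack; the slack is chosen as
    a quarter of the mean.\<close>
  define B5 where "B5 = {p \<in> space W. cnt th p \<le> real n * tail_prob xmin b th / 2 - real n * tail_prob xmin b th / 4}"
  have x2: "xmin \<le> xmin * 2 ^ k" for k :: nat using xmin by simp
  have Bs [measurable, simp]: "B1 \<in> sets W" "B2 \<in> sets W" "B3 \<in> sets W" "B4 k \<in> sets W" "B5 \<in> sets W" for k
    unfolding B1_def B2_def B3_def B4_def B5_def
    by (rule W_box(1), simp, rule W_box(1), simp, rule W_box(1), simp,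
        rule W_cnt(1)[OF x2, of "\<lambda>x. 2 * (real n * tail_prob xmin b (xmin * 2 ^ k)) + s \<le> x" for k],
        rule W_cnt(1)[OF T(3), of "\<lambda>x. x \<le> real n * tail_prob xmin b th / 2 - real n * tail_prob xmin b th / 4"])
  have eq: "regular_set xmin b n Tm tw th s = (space W - ((space W - B1) \<union> ((space W - B2) \<union> (B3 \<union> ((\<Union>k\<in>{..<n}. B4 k) \<union> B5)))))"
  proof (rule set_eqI)
    fix p
    show "p \<in> regular_set xmin b n Tm tw th s \<longleftrightarrow> p \<in> space W - ((space W - B1) \<union> ((space W - B2) \<union> (B3 \<union> ((\<Union>k\<in>{..<n}. B4 k) \<union> B5))))"
    proof (cases "p \<in> space W")
      case True
      have 1: "p \<in> B1 \<longleftrightarrow> (\<forall>v<n. p v \<in> {xmin..})" "p \<in> B2 \<longleftrightarrow> (\<forall>v<n. p v \<in> {..<Tm})"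
        "p \<in> B3 \<longleftrightarrow> (\<forall>v<n. p v \<in> {..<tw})"
        unfolding B1_def B2_def B3_def using True by simp_all
      have 2: "p \<notin> (\<Union>k\<in>{..<n}. B4 k) \<longleftrightarrow> (\<forall>k<n. cnt (xmin * 2 ^ k) p < 2 * (real n * tail_prob xmin b (xmin * 2 ^ k)) + s)"
        unfolding B4_def using True by (simp add: not_le Ball_def)
      have 3: "p \<notin> B5 \<longleftrightarrow> real n * tail_prob xmin b th / 4 < cnt th p"
        unfolding B5_def using True by (simp add: not_le)
      have "p \<in> regular_set xmin b n Tm tw th s \<longleftrightarrow> p \<in> B1 \<and> p \<in> B2 \<and> p \<notin> B3 \<and> p \<notin> (\<Union>k\<in>{..<n}. B4 k) \<and> p \<notin> B5"
        unfolding 1 2 3 regular_set_def mem_Collect_eq using True by simp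
      then show ?thesis unfolding Diff_iff Un_iff using True by argo
    qed (simp add: regular_set_def)
  qed
  show "regular_set xmin b n Tm tw th s \<in> sets W"
    unfolding eq by (intro sets.Diff sets.Un sets.finite_UN sets.top Bs) simp
  have m1: "measure W (space W - B1) = 0"
  proof -
    have "measure W B1 = 1" unfolding B1_def
      by (subst W_box(2)) (use measure_weight_tail[OF xmin b, of xmin] xmin in \<open>auto simp: tail_prob_def\<close>)
    then show ?thesis using W.prob_compl[of B1] by simp
  qed
  have m2: "measure W (space W - B2) \<le> real n * tail_prob xmin b Tm"
  proof -
    have "measure W B2 = (1 - tail_prob xmin b Tm) ^ n" unfolding B2_def
      by (subst W_box(2)) (use measure_below[OF T(1)] in auto)
    also have "\<dots> \<ge> 1 + real n * (- tail_prob xmin b Tm)"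
      using Bernoulli_inequality[of "- tail_prob xmin b Tm" n] tail_prob_range[OF xmin b T(1)] by simp
    finally show ?thesis using W.prob_compl[of B2] by simp
  qed
  have m3: "measure W B3 \<le> exp (- (real n * tail_prob xmin b tw))"
  proof -
    have "measure W B3 = (1 - tail_prob xmin b tw) ^ n" unfolding B3_def
      by (subst W_box(2)) (use measure_below[OF T(2)] in auto)
    also have "\<dots> \<le> exp (- tail_prob xmin b tw) ^ n"
      using tail_prob_range[OF xmin b T(2)] exp_ge_add_one_self[of "- tail_prob xmin b tw"] by (intro power_mono) auto
    also have "\<dots> = exp (- (real n * tail_prob xmin b tw))" by (simp add: exp_of_nat_mult[symmetric])
    finally show ?thesis .
  qed
  have m4: "measure W (\<Union>k\<in>{..<n}. B4 k) \<le> real n * exp (- s)"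
  proof -
    have "measure W (\<Union>k\<in>{..<n}. B4 k) \<le> (\<Sum>k\<in>{..<n}. measure W (B4 k))"
      by (rule W.finite_measure_subadditive_finite) (simp_all add: image_subset_iff)
    also have "\<dots> \<le> (\<Sum>k\<in>{..<n}. exp (- s))"
      unfolding B4_def by (intro sum_mono W_cnt_upper x2)
    finally show ?thesis by simp
  qed
  have spread_mean: "measure W B5 \<le> exp (- (real n * tail_prob xmin b th / 4))"
    unfolding B5_def by (rule W_cnt_lower[OF T(3)])
  define U4 where "U4 = (\<Union>k\<in>{..<n}. B4 k)"
  define U where "U = (space W - B1) \<union> ((space W - B2) \<union> (B3 \<union> (U4 \<union> B5)))"
  have U4: "U4 \<in> sets W" unfolding U4_def by (rule sets.finite_UN) (simp_all only: Bs finite_lessThan)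
  have U: "U \<in> sets W" unfolding U_def by (intro sets.Diff sets.Un sets.top U4 Bs)
  have "measure W (U4 \<union> B5) \<le> measure W U4 + measure W B5"
    by (intro measure_Un_le sets.Diff sets.Un sets.top U4 Bs)
  moreover have "measure W (B3 \<union> (U4 \<union> B5)) \<le> measure W B3 + measure W (U4 \<union> B5)"
    by (intro measure_Un_le sets.Diff sets.Un sets.top U4 Bs)
  moreover have "measure W ((space W - B2) \<union> (B3 \<union> (U4 \<union> B5))) \<le> measure W (space W - B2) + measure W (B3 \<union> (U4 \<union> B5))"
    by (intro measure_Un_le sets.Diff sets.Un sets.top U4 Bs)
  moreover have "measure W U \<le> measure W (space W - B1) + measure W ((space W - B2) \<union> (B3 \<union> (U4 \<union> B5)))"
    unfolding U_def by (intro measure_Un_le sets.Diff sets.Un sets.top U4 Bs)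
  ultimately have "measure W U \<le> real n * tail_prob xmin b Tm + exp (- (real n * tail_prob xmin b tw)) + real n * exp (- s)
      + exp (- (real n * tail_prob xmin b th / 4))" using m1 m2 m3 m4[folded U4_def] spread_mean by linarith
  moreover have "measure W (regular_set xmin b n Tm tw th s) = 1 - measure W U"
    unfolding eq U4_def[symmetric] U_def[symmetric] by (rule W.prob_compl[OF U])
  ultimately show "1 - (real n * tail_prob xmin b Tm + exp (- (real n * tail_prob xmin b tw)) + real n * exp (- s)
      + exp (- (real n * tail_prob xmin b th / 4))) \<le> measure W (regular_set xmin b n Tm tw th s)" by linarith
qed

end

section \<open>Volume, tail and moment bounds from dyadic counts\<close>

definition geo_ratio :: "real \<Rightarrow> real" where "geo_ratio b = 2 powr (2 - b)"
text \<open>The summand 1 pays for the additive slack of the dyadic counts.\<close>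

definition vol_const :: "real \<Rightarrow> real \<Rightarrow> real" where "vol_const xmin b = 4 * xmin / (1 - geo_ratio b) + 1"
definition deg_ratio :: "real \<Rightarrow> real \<Rightarrow> real" where "deg_ratio xmin b = xmin / (2 * vol_const xmin b)"
definition tail_const :: "real \<Rightarrow> real \<Rightarrow> real" where
  "tail_const xmin b = 6 * xmin * (1 / (2 * xmin)) powr (2 - b) / (1 - geo_ratio b)"
text \<open>Number of dyadic scales up to \<open>T\<close> times a bound for the contribution of one
  scale, which is of order \<open>2 ^ k\<close> to the power \<open>5 - 2 * b\<close>: growing for
  \<open>b < 5/2\<close>, falling for \<open>b > 5/2\<close>. Counting scales costs a logarithm but
  treats \<open>b = 5/2\<close> uniformly.\<close>

definition moment_bound :: "real \<Rightarrow> real \<Rightarrow> real \<Rightarrow> real" where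
  "moment_bound xmin b T = 3 * (2 * xmin) powr (4 - b) * (1 + log 2 (T / xmin)) * max 1 ((T / xmin) powr (5 - 2 * b))"
definition high_bound :: "real \<Rightarrow> real \<Rightarrow> nat \<Rightarrow> real \<Rightarrow> real" where
  "high_bound xmin b n K = 3 * (1 / (8 * xmin)) powr (1 - b) * real n * K powr (1 - b)"

lemma powr_pow2: "(2 ^ k :: real) powr a = (2 powr a) ^ k"
  by (simp add: powr_powr powr_realpow[symmetric] mult.commute)

lemma geo_ratio_range: "2 < b \<Longrightarrow> 0 < geo_ratio b \<and> geo_ratio b < 1"
  unfolding geo_ratio_def using powr_less_mono[of "2 - b" 0 2] by simp

text \<open>\<open>geo_ratio b\<close> is the factor between the volumes of consecutive dyadic
  scales, so the volume above scale \<open>k0\<close> is a geometric series of the order of its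
  first term.\<close>

lemma geo_ratio_sum_le:
  assumes "2 < b" "finite J" "\<And>k. k \<in> J \<Longrightarrow> k0 \<le> k"
  shows "(\<Sum>k\<in>J. geo_ratio b ^ k) \<le> geo_ratio b ^ k0 / (1 - geo_ratio b)"
proof -
  have g: "0 < geo_ratio b" "geo_ratio b < 1" using geo_ratio_range[OF assms(1)] by auto
  have inj: "inj_on (\<lambda>k. k - k0) J" by (rule inj_onI) (metis assms(3) le_add_diff_inverse)
  have "(\<Sum>k\<in>J. geo_ratio b ^ k) = (\<Sum>k\<in>J. geo_ratio b ^ k0 * geo_ratio b ^ (k - k0))"
    using assms(3) by (intro sum.cong refl) (simp flip: power_add)
  also have "\<dots> = geo_ratio b ^ k0 * (\<Sum>k\<in>(\<lambda>k. k - k0) ` J. geo_ratio b ^ k)"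
    by (simp add: sum_distrib_left sum.reindex[OF inj])
  also have "(\<Sum>k\<in>(\<lambda>k. k - k0) ` J. geo_ratio b ^ k) \<le> (\<Sum>k. geo_ratio b ^ k)"
    using g assms(2) by (intro sum_le_suminf summable_geometric) auto
  also have "(\<Sum>k. geo_ratio b ^ k) = 1 / (1 - geo_ratio b)" using g by (intro suminf_geometric) auto
  finally show ?thesis using g by (simp add: mult_left_mono)
qed

lemma tail_prob_dyadic: "0 < xmin \<Longrightarrow> tail_prob xmin b (xmin * 2 ^ k) = (2 ^ k) powr (1 - b)"
  using powr_minus_divide[of "2 ^ k :: real" "b - 1"] by (simp add: tail_prob_def powr_divide)

text \<open>Two conditions tame the additive slack \<open>s\<close>: \<open>a3\<close> bounds its
  total contribution to the volume, up to the maximal weight \<open>Tm\<close>, and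
  \<open>a4\<close> absorbs it into the tail counts up to \<open>T2\<close>, the weight cap for
  vertices of degree less than \<open>K\<close>.\<close>

lemma regular_weights_from_regular_set:
  fixes xmin b K \<theta> Tm tw L s :: real and n :: nat and p :: "nat \<Rightarrow> real"
  defines "C1 \<equiv> vol_const xmin b" and "c0 \<equiv> deg_ratio xmin b"
  defines "T2 \<equiv> 4 * K / c0" and "th \<equiv> 16 * \<theta> / c0"
  assumes x: "0 < xmin" and b: "2 < b" "b < 3" and n: "2 \<le> n" and L: "L = ln (real n)" and s: "0 \<le> s"
    and p: "p \<in> regular_set xmin b n Tm tw th s"
    and a1: "Tm < xmin * 2 ^ n" and a2: "Tm \<le> real n" and a3: "4 * s * Tm \<le> real n"
    and a4: "s \<le> real n * (T2 / xmin) powr (1 - b)" and spread_weight: "T2 \<le> Tm"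
    and K: "8 * L \<le> K" "xmin \<le> K / 4" and \<theta>: "8 * L \<le> \<theta>" "6 * \<theta> \<le> real n" and L4: "xmin \<le> 4 * L"
    and tw: "4 * K \<le> c0 * tw" "16 * C1 * real n * L \<le> \<theta> * tw"
    and hv: "4 * C1 * real n * L \<le> \<theta> * xmin * (th * (real n * tail_prob xmin b th / 4))"
  shows "\<exists>w. regular_weights n p xmin C1 b K \<theta> L (tail_const xmin b) (moment_bound xmin b T2) (high_bound xmin b n K) w"
proof -
  have g: "0 < geo_ratio b" "geo_ratio b < 1" using geo_ratio_range[OF b(1)] by auto
  have C1: "4 * xmin \<le> C1" "0 < C1"
  proof -
    have "4 * xmin \<le> 4 * xmin / (1 - geo_ratio b)" using g x by (simp add: field_simps)
    then show "4 * xmin \<le> C1" unfolding C1_def vol_const_def by simp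
    then show "0 < C1" using x by simp
  qed
  have c0: "0 < c0" "c0 \<le> 1 / 8" using C1 x by (auto simp: c0_def deg_ratio_def C1_def[symmetric] field_simps)
  have L0: "0 < L" using n by (simp add: L)
  have th0: "0 < th" using \<theta> L0 c0 by (simp add: th_def)
  have K0: "0 < K" using K L0 by simp
  have pl: "xmin \<le> p v" "p v < Tm" if "v < n" for v using p that by (auto simp: regular_set_def)
  obtain w where w: "w < n" "tw \<le> p w" using p by (auto simp: regular_set_def not_less)
  have N: "real (card {v. v < n \<and> xmin * 2 ^ k \<le> p v}) \<le> 2 * real n * (2 ^ k) powr (1 - b) + s" if "k < n" for k
  proof -
    have "real (card {v. v < n \<and> xmin * 2 ^ k \<le> p v}) < 2 * (real n * tail_prob xmin b (xmin * 2 ^ k)) + s"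
      using p that by (auto simp: regular_set_def)
    then show ?thesis by (simp add: tail_prob_dyadic[OF x])
  qed
  have k_lt: "k < n" if "xmin * 2 ^ k \<le> Tm" for k
  proof -
    have "xmin * 2 ^ k < xmin * 2 ^ n" using that a1 by simp
    then show ?thesis using x by simp
  qed
  have N3: "real (card {v. v < n \<and> xmin * 2 ^ k \<le> p v}) \<le> 3 * real n * (2 ^ k) powr (1 - b)" if "xmin * 2 ^ k \<le> T2" for k
  proof -
    have "(T2 / xmin) powr (1 - b) \<le> (2 ^ k) powr (1 - b)"
      using that x b by (intro powr_mono2') (auto simp: field_simps)
    then have "s \<le> real n * (2 ^ k) powr (1 - b)" using a4 by (meson mult_left_mono of_nat_0_le_iff order_trans)
    then show ?thesis using N[of k] k_lt[of k] that spread_weight by simp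
  qed
  have gk: "(2 ^ k) powr (1 - b) * (xmin * 2 ^ Suc k) = 2 * xmin * geo_ratio b ^ k" for k
  proof -
    have "(2 ^ k :: real) powr (1 - b) * 2 ^ k = (2 ^ k) powr (2 - b)"
      using powr_add[of "2 ^ k :: real" "1 - b" 1] by simp
    then show ?thesis by (simp add: geo_ratio_def powr_pow2)
  qed
  have vol: "(\<Sum>v<n. p v) \<le> C1 * real n"
  proof -
    define J where "J = {k. xmin * 2 ^ k \<le> Tm}"
    have J: "finite J" by (rule finite_subset[of _ "{..<n}"]) (use k_lt in \<open>auto simp: J_def\<close>)
    have xTm: "xmin \<le> Tm" using pl[of 0] n by simp
    have "(\<Sum>v\<in>{..<n}. p v) \<le> (\<Sum>k\<in>J. real (card {v \<in> {..<n}. xmin * 2 ^ k \<le> p v}) * (xmin * 2 ^ Suc k))"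
    proof (rule sum_dyadic)
      fix v k assume "v \<in> {..<n}" "xmin * 2 ^ k \<le> p v" "p v < xmin * 2 ^ Suc k"
      then show "k \<in> J \<and> p v \<le> xmin * 2 ^ Suc k" using pl(2)[of v] by (simp add: J_def)
    qed (use J x pl in auto)
    also have "\<dots> \<le> (\<Sum>k\<in>J. (2 * real n * (2 ^ k) powr (1 - b) + s) * (xmin * 2 ^ Suc k))"
      using N k_lt x by (intro sum_mono mult_right_mono) (auto simp: J_def)
    also have "\<dots> = (\<Sum>k\<in>J. 2 * real n * ((2 ^ k) powr (1 - b) * (xmin * 2 ^ Suc k)) + 2 * s * (xmin * 2 ^ k))"
      by (intro sum.cong refl) (simp add: algebra_simps)
    also have "\<dots> = 4 * real n * xmin * (\<Sum>k\<in>J. geo_ratio b ^ k) + 2 * s * (\<Sum>k\<in>J. xmin * 2 ^ k)"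
      unfolding gk by (simp add: sum.distrib sum_distrib_left algebra_simps)
    also have "(\<Sum>k\<in>J. geo_ratio b ^ k) \<le> geo_ratio b ^ 0 / (1 - geo_ratio b)" by (rule geo_ratio_sum_le[OF b(1) J]) simp
    \<comment> \<open>The slack is the same at every scale, so its weighted sum grows geometrically
      and is dominated by the largest scale below \<open>Tm\<close>.\<close>
    also have "(\<Sum>k\<in>J. xmin * 2 ^ k) \<le> 2 * Tm"
    proof -
      have ne: "J \<noteq> {}" using xTm by (auto simp: J_def intro!: exI[of _ 0])
      define m where "m = Max J"
      have "m \<in> J" unfolding m_def by (rule Max_in[OF J ne])
      then have m: "xmin * 2 ^ m \<le> Tm" by (simp add: J_def)
      have "(\<Sum>k\<in>J. xmin * 2 ^ k) \<le> (\<Sum>k\<in>{..<Suc m}. xmin * 2 ^ k)"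
        by (rule sum_mono2) (use J x in \<open>auto simp: m_def less_Suc_eq_le\<close>)
      also have "\<dots> = xmin * (\<Sum>k<Suc m. 2 ^ k)" unfolding sum_distrib_left ..
      also have "(\<Sum>k<Suc m. 2 ^ k) = (2 ^ Suc m - 1 :: real)" using geometric_sum[of "2::real" "Suc m"] by simp
      also have "xmin * (2 ^ Suc m - 1) \<le> 2 * (xmin * 2 ^ m)" using x by (simp add: algebra_simps)
      finally show ?thesis using m by simp
    qed
    finally have "(\<Sum>v<n. p v) \<le> 4 * real n * xmin * (geo_ratio b ^ 0 / (1 - geo_ratio b)) + 2 * s * (2 * Tm)"
      using x s by (simp add: mult_left_mono)
    also have "\<dots> \<le> C1 * real n" using a3 by (simp add: C1_def vol_const_def algebra_simps)
    finally show ?thesis .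
  qed
  have tail: "(\<Sum>v | v < n \<and> t \<le> p v \<and> p v \<le> T2. p v) \<le> tail_const xmin b * real n * t powr (2 - b)"
    if t: "xmin \<le> t" "t \<le> T2" for t
  proof -
    have t0: "0 < t" using t x by simp
    obtain k0 where k0: "xmin * 2 ^ k0 \<le> t" "t < xmin * 2 ^ Suc k0" using dyad[OF x t(1)] by blast
    define J where "J = {k. xmin * 2 ^ k \<le> T2 \<and> k0 \<le> k}"
    have J: "finite J" by (rule finite_subset[of _ "{..<n}"]) (auto simp: J_def intro!: k_lt order_trans[OF _ spread_weight])
    define V where "V = {v. v < n \<and> t \<le> p v \<and> p v \<le> T2}"
    have "(\<Sum>v\<in>V. p v) \<le> (\<Sum>k\<in>J. real (card {v \<in> V. xmin * 2 ^ k \<le> p v}) * (xmin * 2 ^ Suc k))"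
    proof (rule sum_dyadic)
      fix v k assume v: "v \<in> V" "xmin * 2 ^ k \<le> p v" "p v < xmin * 2 ^ Suc k"
      have "xmin * 2 ^ k0 < xmin * 2 ^ Suc k" using k0 v by (auto simp: V_def)
      then have "(2::real) ^ k0 < 2 ^ Suc k" using x by (simp only: mult_less_cancel_left_pos)
      then have "k0 < Suc k" by (rule power_less_imp_less_exp[rotated]) simp
      then show "k \<in> J \<and> p v \<le> xmin * 2 ^ Suc k" using v by (auto simp: J_def V_def)
    qed (use J x pl in \<open>auto simp: V_def\<close>)
    also have "\<dots> \<le> (\<Sum>k\<in>J. (3 * real n * (2 ^ k) powr (1 - b)) * (xmin * 2 ^ Suc k))"
    proof (intro sum_mono mult_right_mono)
      fix k assume k: "k \<in> J"
      have "card {v \<in> V. xmin * 2 ^ k \<le> p v} \<le> card {v. v < n \<and> xmin * 2 ^ k \<le> p v}"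
        by (rule card_mono) (auto simp: V_def)
      then show "real (card {v \<in> V. xmin * 2 ^ k \<le> p v}) \<le> 3 * real n * (2 ^ k) powr (1 - b)"
        using N3[of k] k by (simp add: J_def)
    qed (use x in auto)
    also have "\<dots> = 6 * real n * xmin * (\<Sum>k\<in>J. geo_ratio b ^ k)"
      unfolding mult.assoc gk by (simp add: sum_distrib_left algebra_simps)
    also have "\<dots> \<le> 6 * real n * xmin * (geo_ratio b ^ k0 / (1 - geo_ratio b))"
      using x by (intro mult_left_mono geo_ratio_sum_le[OF b(1) J]) (auto simp: J_def)
    also have "\<dots> \<le> 6 * real n * xmin * ((t * (1 / (2 * xmin))) powr (2 - b) / (1 - geo_ratio b))"
    proof -
      have "geo_ratio b ^ k0 = (2 ^ k0) powr (2 - b)" by (simp add: geo_ratio_def powr_pow2)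
      \<comment> \<open>The exponent \<open>2 - b\<close> is negative, so the relevant side of the
        dyadic bracket is \<open>t < xmin * 2 ^ Suc k0\<close>.\<close>
      also have "\<dots> \<le> (t * (1 / (2 * xmin))) powr (2 - b)"
        using k0 x b t0 by (intro powr_mono2') (auto simp: field_simps)
      finally show ?thesis using g x by (intro mult_left_mono divide_right_mono) auto
    qed
    also have "\<dots> = tail_const xmin b * real n * t powr (2 - b)"
      unfolding powr_mult tail_const_def by simp
    finally show ?thesis by (simp add: V_def)
  qed
  have xT2: "xmin \<le> T2" and KT2: "K / 4 \<le> T2"
  proof -
    have "K \<le> K / c0" using K0 c0 by (simp add: field_simps)
    then show "K / 4 \<le> T2" using K0 by (simp add: T2_def)
    then show "xmin \<le> T2" using K by simp
  qed
  have M: "(\<Sum>v | v < n \<and> p v \<le> T2. p v powr (4 - b)) \<le> real n * moment_bound xmin b T2"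
  proof -
    define J where "J = {k. xmin * 2 ^ k \<le> T2}"
    have J: "finite J" by (rule finite_subset[of _ "{..<n}"]) (auto simp: J_def intro!: k_lt order_trans[OF _ spread_weight])
    define V where "V = {v. v < n \<and> p v \<le> T2}"
    have "(\<Sum>v\<in>V. p v powr (4 - b)) \<le> (\<Sum>k\<in>J. real (card {v \<in> V. xmin * 2 ^ k \<le> p v}) * (xmin * 2 ^ Suc k) powr (4 - b))"
    proof (rule sum_dyadic)
      fix v k assume v: "v \<in> V" "xmin * 2 ^ k \<le> p v" "p v < xmin * 2 ^ Suc k"
      then have "0 \<le> p v" using pl[of v] x by (simp add: V_def)
      then have "p v powr (4 - b) \<le> (xmin * 2 ^ Suc k) powr (4 - b)"
        using v b by (intro powr_mono2) auto
      then show "k \<in> J \<and> p v powr (4 - b) \<le> (xmin * 2 ^ Suc k) powr (4 - b)" using v by (auto simp: J_def V_def)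
    qed (use J x pl in \<open>auto simp: V_def\<close>)
    also have "\<dots> \<le> (\<Sum>k\<in>J. 3 * real n * (2 ^ k) powr (1 - b) * (xmin * 2 ^ Suc k) powr (4 - b))"
    proof (intro sum_mono mult_right_mono)
      fix k assume k: "k \<in> J"
      have "card {v \<in> V. xmin * 2 ^ k \<le> p v} \<le> card {v. v < n \<and> xmin * 2 ^ k \<le> p v}"
        by (rule card_mono) (auto simp: V_def)
      then show "real (card {v \<in> V. xmin * 2 ^ k \<le> p v}) \<le> 3 * real n * (2 ^ k) powr (1 - b)"
        using N3[of k] k by (simp add: J_def)
    qed auto
    also have "\<dots> \<le> (\<Sum>k\<in>J. 3 * real n * (2 * xmin) powr (4 - b) * max 1 ((T2 / xmin) powr (5 - 2 * b)))"
    proof (rule sum_mono)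
      fix k assume k: "k \<in> J"
      have "(xmin * 2 ^ Suc k) powr (4 - b) = ((2 * xmin) * 2 ^ k) powr (4 - b)" by (simp add: algebra_simps)
      also have "\<dots> = (2 * xmin) powr (4 - b) * (2 ^ k) powr (4 - b)" by (rule powr_mult)
      finally have "3 * real n * (2 ^ k) powr (1 - b) * (xmin * 2 ^ Suc k) powr (4 - b) =
        3 * real n * (2 * xmin) powr (4 - b) * ((2 ^ k) powr (1 - b) * (2 ^ k) powr (4 - b))" by simp
      also have "(2 ^ k :: real) powr (1 - b) * (2 ^ k) powr (4 - b) = (2 ^ k) powr (5 - 2 * b)"
        unfolding powr_add[symmetric] by simp
      \<comment> \<open>The largest term sits at the top or at the bottom scale, according to the
        sign of \<open>5 - 2 * b\<close>.\<close>
      also have "(2 ^ k :: real) powr (5 - 2 * b) \<le> max 1 ((T2 / xmin) powr (5 - 2 * b))"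
      proof (cases "5 - 2 * b \<ge> 0")
        case True
        then have "(2 ^ k :: real) powr (5 - 2 * b) \<le> (T2 / xmin) powr (5 - 2 * b)"
          using k x by (intro powr_mono2) (auto simp: J_def field_simps)
        then show ?thesis by simp
      next
        case False
        then have "(2 ^ k :: real) powr (5 - 2 * b) \<le> (2 ^ k) powr 0" by (intro powr_mono) auto
        then show ?thesis by simp
      qed
      finally show "3 * real n * (2 ^ k) powr (1 - b) * (xmin * 2 ^ Suc k) powr (4 - b) \<le>
         3 * real n * (2 * xmin) powr (4 - b) * max 1 ((T2 / xmin) powr (5 - 2 * b))"
        by (simp add: mult_left_mono)
    qed
    also have "\<dots> = real (card J) * (3 * real n * (2 * xmin) powr (4 - b) * max 1 ((T2 / xmin) powr (5 - 2 * b)))"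
      by simp
    also have "\<dots> \<le> (1 + log 2 (T2 / xmin)) * (3 * real n * (2 * xmin) powr (4 - b) * max 1 ((T2 / xmin) powr (5 - 2 * b)))"
    proof (rule mult_right_mono)
      have ne: "J \<noteq> {}" using xT2 by (auto simp: J_def intro!: exI[of _ 0])
      define m where "m = Max J"
      have "m \<in> J" unfolding m_def by (rule Max_in[OF J ne])
      then have "2 ^ m \<le> T2 / xmin" using x by (simp add: J_def field_simps)
      then have "log 2 (2 ^ m) \<le> log 2 (T2 / xmin)" using x xT2 by (subst log_le_cancel_iff) auto
      then have m: "real m \<le> log 2 (T2 / xmin)" by simp
      have "J \<subseteq> {..m}" using J by (auto simp: m_def)
      then have "card J \<le> card {..m}" by (intro card_mono) auto
      then show "real (card J) \<le> 1 + log 2 (T2 / xmin)" using m by simp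
    qed auto
    finally show ?thesis by (simp add: V_def moment_bound_def algebra_simps)
  qed
  have Hb: "real (card {v. v < n \<and> K / 4 \<le> p v}) \<le> high_bound xmin b n K"
  proof -
    obtain k where k: "xmin * 2 ^ k \<le> K / 4" "K / 4 < xmin * 2 ^ Suc k" using dyad[OF x K(2)] by blast
    have "card {v. v < n \<and> K / 4 \<le> p v} \<le> card {v. v < n \<and> xmin * 2 ^ k \<le> p v}"
      by (rule card_mono) (use k in auto)
    then have "real (card {v. v < n \<and> K / 4 \<le> p v}) \<le> 3 * real n * (2 ^ k) powr (1 - b)"
      using N3[of k] k KT2 by simp
    \<comment> \<open>The 8 is the 4 of \<open>K / 4\<close> times 2 for rounding down to a dyadic
      scale.\<close>
    also have "\<dots> \<le> 3 * real n * (1 / (8 * xmin) * K) powr (1 - b)"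
      using k x b K0 by (intro mult_left_mono powr_mono2') (auto simp: field_simps)
    also have "\<dots> = high_bound xmin b n K" unfolding powr_mult high_bound_def by simp
    finally show ?thesis .
  qed
  have heavy: "4 * C1 * real n * L \<le> \<theta> * xmin * (\<Sum>v | v < n \<and> th \<le> p v. p v)"
  proof -
    \<comment> \<open>Only the number of heavy vertices is estimated; each is counted with the
      threshold weight.\<close>
    have "real n * tail_prob xmin b th / 4 \<le> real (card {v. v < n \<and> th \<le> p v})" using p by (auto simp: regular_set_def)
    then have "th * (real n * tail_prob xmin b th / 4) \<le> th * real (card {v. v < n \<and> th \<le> p v})"
      using th0 by (intro mult_left_mono) auto
    also have "\<dots> = (\<Sum>v | v < n \<and> th \<le> p v. th)" by simp
    also have "\<dots> \<le> (\<Sum>v | v < n \<and> th \<le> p v. p v)" by (rule sum_mono) auto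
    finally have "\<theta> * xmin * (th * (real n * tail_prob xmin b th / 4)) \<le> \<theta> * xmin * (\<Sum>v | v < n \<and> th \<le> p v. p v)"
      using \<theta> L0 x by (intro mult_left_mono) auto
    then show ?thesis using hv by simp
  qed
  have pn: "p v \<le> real n" if "v < n" for v using pl(2)[OF that] a2 by simp
  have weighted_graph: "weighted_graph n p xmin C1"
    unfolding weighted_graph_def using x n pl(1) pn vol by blast
  have c0eq: "weighted_graph.c0 xmin C1 = c0" using weighted_graph.c0_def[OF weighted_graph] by (simp add: c0_def deg_ratio_def C1_def)
  have w1: "4 * K \<le> c0 * p w" using tw(1) w(2) c0 by (meson less_imp_le mult_left_mono order_trans)
  have w2: "16 * C1 * real n * L \<le> \<theta> * p w"
    using tw(2) w(2) \<theta> L0 by (smt (verit) mult_left_mono)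
  have C20: "0 \<le> tail_const xmin b" using g x by (simp add: tail_const_def)
  have "regular_weights n p xmin C1 b K \<theta> L (tail_const xmin b) (moment_bound xmin b T2) (high_bound xmin b n K) w"
    using b L K \<theta> L4 w(1) w1 w2 heavy C20 tail M Hb weighted_graph
    unfolding regular_weights_def regular_weights_axioms_def c0eq T2_def th_def by blast
  then show ?thesis by blast
qed

section \<open>Asymptotics\<close>

context regular_weights begin

text \<open>\<open>R\<close> stands for the rate. Two of the three logarithms are those of
  \<open>\<theta>\<close>; the third comes from the neighbours of low-weight vertices, in
  \<open>deg_const * \<theta> * L\<close>, or from the number of dyadic scales in
  \<open>M\<close>.\<close>

lemma label_bound_le:
  assumes R: "1 \<le> R" and L1: "1 \<le> L" and Hb: "Hb \<le> hb * R" and t: "\<theta> \<le> t0 * R * L\<^sup>2"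
    and M: "\<theta> * M \<le> cM * R * L ^ 3" and T: "wcap powr (3 - b) \<le> t3 * R" and hb: "0 \<le> hb" "0 \<le> t0" "0 \<le> t3"
  shows "label_bound \<le> (2 * hb + 3 * t0 + deg_const * t0 + 2 * nbr_const * (8 * cM / (c0 * xmin) + 4 * t3) + 2 * nbr_const * t3 + deg_const) * R * L ^ 3"
proof -
  have deg_const: "0 < deg_const" using c0_pos by (auto simp: deg_const_def intro: add_pos_pos)
  have RL: "0 \<le> R" "R \<le> R * L ^ 3" "R * L \<le> R * L ^ 3" "R * L\<^sup>2 \<le> R * L ^ 3" "L \<le> R * L ^ 3"
  proof -
    have l: "1 \<le> L ^ 3" "L \<le> L ^ 3" "L\<^sup>2 \<le> L ^ 3"
      using L1 power_increasing[of 1 3 L] power_increasing[of 2 3 L] one_le_power[of L 3] by auto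
    show "0 \<le> R" using R by simp
    then show "R \<le> R * L ^ 3" "R * L \<le> R * L ^ 3" "R * L\<^sup>2 \<le> R * L ^ 3"
      using l mult_left_mono[of 1 "L ^ 3" R] by (auto intro: mult_left_mono)
    have "0 \<le> L ^ 3" using l(1) by linarith
    then have "1 * L ^ 3 \<le> R * L ^ 3" using R by (rule mult_right_mono[rotated])
    then show "L \<le> R * L ^ 3" using l(2) by linarith
  qed
  have 1: "2 * Hb \<le> 2 * hb * (R * L ^ 3)"
    using Hb RL(2) hb(1) mult_left_mono[of R "R * L ^ 3" hb] by simp
  have 2: "3 * \<theta> \<le> 3 * t0 * (R * L ^ 3)"
    using t RL(4) hb(2) mult_left_mono[of "R * L\<^sup>2" "R * L ^ 3" t0] by (simp add: mult.assoc)
  have "\<theta> * L \<le> (t0 * R * L\<^sup>2) * L" using t L1 by (intro mult_right_mono) auto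
  also have "\<dots> = t0 * (R * L ^ 3)" by (simp add: power2_eq_square power3_eq_cube)
  finally have 3: "deg_const * \<theta> * L \<le> deg_const * t0 * (R * L ^ 3)"
    using deg_const mult_left_mono[of "\<theta> * L" "t0 * (R * L ^ 3)" deg_const] by (simp add: mult.assoc)
  have T0: "0 \<le> wcap powr (3 - b)" by simp
  have TL: "wcap powr (3 - b) * L \<le> t3 * (R * L ^ 3)"
  proof -
    have "wcap powr (3 - b) * L \<le> t3 * R * L" using T L1 by (intro mult_right_mono) auto
    also have "\<dots> \<le> t3 * (R * L ^ 3)" using hb(3) RL(3) mult_left_mono[of "R * L" "R * L ^ 3" t3] by (simp add: mult.assoc)
    finally show ?thesis .
  qed
  have "spread_bound = 8 / (c0 * xmin) * (\<theta> * M) + 4 * (wcap powr (3 - b) * L)"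
    by (simp add: spread_bound_def spread_mean_def)
  also have "\<dots> \<le> 8 / (c0 * xmin) * (cM * R * L ^ 3) + 4 * (t3 * (R * L ^ 3))"
    using M TL c0_pos xmin by (intro add_mono mult_left_mono) auto
  also have "\<dots> = (8 * cM / (c0 * xmin) + 4 * t3) * (R * L ^ 3)" by (simp add: algebra_simps)
  finally have 4: "2 * nbr_const * spread_bound \<le> 2 * nbr_const * ((8 * cM / (c0 * xmin) + 4 * t3) * (R * L ^ 3))"
    using nbr_const_nonneg by (intro mult_left_mono) auto
  have "wcap powr (3 - b) \<le> t3 * (R * L ^ 3)"
    using T RL(2) hb(3) mult_left_mono[of R "R * L ^ 3" t3] by simp
  then have 5: "2 * nbr_const * wcap powr (3 - b) \<le> 2 * nbr_const * (t3 * (R * L ^ 3))"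
    using nbr_const_nonneg by (intro mult_left_mono) auto
  have 6: "deg_const * L \<le> deg_const * (R * L ^ 3)" using deg_const RL(5) by simp
  have "label_bound \<le> 2 * hb * (R * L ^ 3) + 3 * t0 * (R * L ^ 3) + deg_const * t0 * (R * L ^ 3)
      + 2 * nbr_const * ((8 * cM / (c0 * xmin) + 4 * t3) * (R * L ^ 3)) + 2 * nbr_const * (t3 * (R * L ^ 3)) + deg_const * (R * L ^ 3)"
    unfolding label_bound_def using 1 2 3 4 5 6 by linarith
  also have "\<dots> = (2 * hb + 3 * t0 + deg_const * t0 + 2 * nbr_const * (8 * cM / (c0 * xmin) + 4 * t3) + 2 * nbr_const * t3 + deg_const) * (R * L ^ 3)"
    by (simp only: distrib_right mult.assoc)
  finally show ?thesis by (simp only: mult.assoc)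
qed

end

definition high_exp :: "real \<Rightarrow> real" where
  "high_exp b = (if 5/2 \<le> b then 1/2 else 1 / ((4 - b) * (b - 1)))"
definition cut_threshold :: "real \<Rightarrow> real \<Rightarrow> nat \<Rightarrow> real" where
  "cut_threshold b \<nu> n = 4 * \<nu> * (ln (real n))\<^sup>2 * real n powr ((b - 2) / (b - 1))"
definition label_rate :: "real \<Rightarrow> nat \<Rightarrow> real" where
  "label_rate b n = max (real n powr ((b - 2) / (b - 1))) (real n powr ((3 - b) / (4 - b)))"

text \<open>The strict inequalities leave room between \<open>K\<close> and the weight of the hub.
  The others compare the high-degree count, the single-vertex term and the spread term with the
  rate; the final equality is the balance that defines the exponent for
  \<open>b < 5/2\<close>.\<close>

lemma high_exp_props:
  assumes "2 < b" "b < 3"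
  shows "0 < high_exp b" "high_exp b < 1 / (b - 1)" "high_exp b * (b - 1) < 1"
    "1 - high_exp b * (b - 1) \<le> (3 - b) / (4 - b)" "high_exp b * (3 - b) \<le> (3 - b) / (4 - b)"
    "b < 5/2 \<Longrightarrow> (b - 2) / (b - 1) + high_exp b * (5 - 2 * b) = (3 - b) / (4 - b)"
proof -
  have p: "1 < b - 1" "1 < 4 - b" "4 - b < 2" "b - 1 < 2" using assms by auto
  show "0 < high_exp b" using p by (simp add: high_exp_def)
  show k1: "high_exp b * (b - 1) < 1" using p by (simp add: high_exp_def)
  then show "high_exp b < 1 / (b - 1)" using p by (simp add: field_simps)
  show "1 - high_exp b * (b - 1) \<le> (3 - b) / (4 - b)"
  proof (cases "5/2 \<le> b")
    case True
    have "1 - high_exp b * (b - 1) = (3 - b) / 2" using True by (simp add: high_exp_def field_simps)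
    also have "\<dots> \<le> (3 - b) / (4 - b)" using p assms by (intro divide_left_mono) auto
    finally show ?thesis .
  next
    case False
    have "high_exp b * (b - 1) = 1 / (4 - b)" using p False by (simp add: high_exp_def)
    also have "1 - 1 / (4 - b) = (3 - b) / (4 - b)" using p by (simp add: field_simps)
    finally show ?thesis by simp
  qed
  have "high_exp b \<le> 1 / (4 - b)"
  proof (cases "5/2 \<le> b")
    case True
    then show ?thesis using p by (simp add: high_exp_def field_simps)
  next
    case False
    have "(4 - b) * 1 \<le> (4 - b) * (b - 1)" using p by (intro mult_left_mono) auto
    then have "1 / ((4 - b) * (b - 1)) \<le> 1 / (4 - b)" using p by (intro divide_left_mono) auto
    then show ?thesis using False by (simp add: high_exp_def)
  qed
  then show "high_exp b * (3 - b) \<le> (3 - b) / (4 - b)"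
    using assms mult_right_mono[of "high_exp b" "1 / (4 - b)" "3 - b"] by simp
  assume b5: "b < 5/2"
  have "b - 1 \<noteq> 0" "4 - b \<noteq> 0" using p by auto
  then have "(b - 2) / (b - 1) + (5 - 2 * b) / ((4 - b) * (b - 1)) = (3 - b) / (4 - b)"
    by (simp add: divide_simps) algebra
  then show "(b - 2) / (b - 1) + high_exp b * (5 - 2 * b) = (3 - b) / (4 - b)"
    using b5 by (simp add: high_exp_def)
qed

lemma ln_sq_le_powr:
  fixes \<epsilon> C :: real assumes "0 < \<epsilon>"
  shows "eventually (\<lambda>n::nat. C * (ln (real n))\<^sup>2 \<le> real n powr \<epsilon>) sequentially"
  using assms by real_asymp

text \<open>The maximum of \<open>n\<close> weights has order \<open>n powr e\<close>;
  \<open>Tm\<close> lies above it by a factor \<open>L\<close> and \<open>tw\<close> below it by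
  \<open>sqrt L\<close>, which makes both failure probabilities vanish. The facts \<open>f1\<close>
  to \<open>f10\<close> are the inequalities that hold for all large \<open>n\<close>.\<close>

lemma regular_weights_at:
  fixes xmin b \<nu> :: real and n :: nat
  defines "C1 \<equiv> vol_const xmin b" and "c0 \<equiv> deg_ratio xmin b" and "\<kappa> \<equiv> high_exp b" and "e \<equiv> 1 / (b - 1)" and "a \<equiv> (b - 2) / (b - 1)"
  defines "D \<equiv> xmin * xmin powr (b - 1) * (16 / c0) powr (2 - b) / 4"
  defines "L \<equiv> ln (real n)" and "N \<equiv> real n" and "\<theta> \<equiv> cut_threshold b \<nu> n"
  defines "Tm \<equiv> N powr e * L" and "tw \<equiv> N powr e / sqrt L" and "th \<equiv> 16 * \<theta> / c0" and "s \<equiv> 3 * L"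
  defines "d \<equiv> (xmin * c0 / 16) powr (b - 1)"
  assumes x: "0 < xmin" and b: "2 < b" "b < 3" and \<nu>: "1 < \<nu>" and n: "2 \<le> n"
    and f1: "12 * L\<^sup>2 \<le> N powr (1 - e)"
    and f2: "N < xmin * 2 ^ n"
    and f3: "3 / (4 / (c0 * xmin)) powr (1 - b) * L\<^sup>2 \<le> N powr (1 - \<kappa> * (b - 1))"
    and f4: "4 / c0 * L\<^sup>2 \<le> N powr (e - \<kappa>)"
    and f5: "(8 + 4 * xmin) * L\<^sup>2 \<le> N powr \<kappa>"
    and f6: "24 * \<nu> * L\<^sup>2 \<le> N powr (1 - a)"
    and f7: "4 * \<nu> * L\<^sup>2 \<le> N powr (1/2 - a)"
    and f8: "2 \<le> L" "xmin \<le> L"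
    and f9: "16 * C1 * sqrt L \<le> 4 * \<nu> * L"
    and f10: "4 * C1 / D * L\<^sup>2 \<le> N powr (a * (3 - b))"
  shows "(\<forall>p\<in>regular_set xmin b n Tm tw th s.
       \<exists>w. regular_weights n p xmin C1 b (N powr \<kappa>) \<theta> L (tail_const xmin b) (moment_bound xmin b (4 * N powr \<kappa> / c0)) (high_bound xmin b n (N powr \<kappa>)) w)
    \<and> regular_set xmin b n Tm tw th s \<in> sets (weight_prod xmin b n)
    \<and> 1 - (xmin powr (b - 1) * L powr (1 - b) + exp (- (xmin powr (b - 1) * L powr ((b - 1) / 2)))
       + N * exp (- (3 * L)) + exp (- (d * N powr ((3 - b) / 2) / 4)))
     \<le> measure (weight_prod xmin b n) (regular_set xmin b n Tm tw th s)"
proof -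
  note kp = high_exp_props[OF b, folded \<kappa>_def]
  have g: "0 < geo_ratio b" "geo_ratio b < 1" using geo_ratio_range[OF b(1)] by auto
  have C1: "0 < C1" using g x by (simp add: C1_def vol_const_def add_pos_pos)
  have c0: "0 < c0" using C1 x by (simp add: c0_def deg_ratio_def C1_def)
  have e: "1/2 < e" "e < 1" "e * (b - 1) = 1" and a: "a = 1 - e" "0 < a" "a < 1/2"
    using b by (auto simp: e_def a_def field_simps)
  have D: "0 < D" using x c0 by (simp add: D_def)
  have N: "2 \<le> N" "0 < N" "1 \<le> N" using n by (auto simp: N_def)
  have L0: "0 < L" "1 \<le> L" "L \<le> L\<^sup>2" "1 \<le> L\<^sup>2" "sqrt L \<le> L"
  proof -
    show "0 < L" "1 \<le> L" using f8 by auto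
    then show "L \<le> L\<^sup>2" "1 \<le> L\<^sup>2" using self_le_power[of L 2] one_le_power[of L 2] by auto
    then show "sqrt L \<le> L" using \<open>0 < L\<close> by (intro real_le_lsqrt) auto
  qed
  have sL: "0 < sqrt L" "sqrt L * sqrt L = L" using L0 by auto
  have Npos: "0 < N powr r" for r using N by simp
  have \<theta>: "\<theta> = 4 * \<nu> * L\<^sup>2 * N powr a" by (simp add: \<theta>_def cut_threshold_def L_def N_def a_def)
  have \<theta>1: "N powr a \<le> \<theta>" "8 * L \<le> \<theta>"
  proof -
    have "1 * 1 \<le> (4 * \<nu>) * L\<^sup>2" using \<nu> L0 by (intro mult_mono) auto
    then show "N powr a \<le> \<theta>" unfolding \<theta> using Npos[of a] by simp
    have "8 * L \<le> 4 * 1 * (L * L)" using f8 L0 by simp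
    also have "\<dots> \<le> 4 * \<nu> * L\<^sup>2" using \<nu> L0 by (simp add: power2_eq_square)
    also have "\<dots> \<le> 4 * \<nu> * L\<^sup>2 * N powr a" using \<nu> L0 a N ge_one_powr_ge_zero[of N a] by simp
    finally show "8 * L \<le> \<theta>" unfolding \<theta> .
  qed
  have \<theta>0: "0 < \<theta>" using \<theta>1(2) L0 by linarith
  have th0: "0 < th" using \<theta>0 c0 by (simp add: th_def)
  have Ne: "N powr e * N powr (1 - e) = N" "N powr a * N powr (1 - a) = N"
    "N powr \<kappa> * N powr (e - \<kappa>) = N powr e" "N powr a * N powr (1/2 - a) = N powr (1/2)"
    "N powr a * N powr e = N"
    using N a(1) by (simp_all flip: powr_add)
  have b1: "1 < b" using b by simp
  have a3: "4 * s * Tm \<le> N"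
  proof -
    have "4 * s * Tm = 12 * L\<^sup>2 * N powr e" by (simp add: s_def Tm_def power2_eq_square)
    also have "\<dots> \<le> N powr (1 - e) * N powr e" using f1 by (intro mult_right_mono) auto
    finally show ?thesis using Ne(1) by (simp add: mult.commute)
  qed
  have a2: "Tm \<le> N"
  proof -
    have "0 \<le> Tm" using L0 by (simp add: Tm_def)
    then have "1 * Tm \<le> (4 * s) * Tm" using L0 by (intro mult_right_mono) (auto simp: s_def)
    then show ?thesis using a3 by simp
  qed
  have K: "8 * L \<le> N powr \<kappa>" "xmin \<le> N powr \<kappa> / 4"
  proof -
    have "8 * L \<le> (8 + 4 * xmin) * L\<^sup>2" using x L0 by (intro mult_mono) auto
    then show "8 * L \<le> N powr \<kappa>" using f5 by simp
    have "(4 * xmin) * 1 \<le> (8 + 4 * xmin) * L\<^sup>2" using x L0 by (intro mult_mono) auto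
    then show "xmin \<le> N powr \<kappa> / 4" using f5 by simp
  qed
  have Ke: "4 / c0 * N powr \<kappa> * L \<le> N powr e"
  proof -
    have "4 / c0 * N powr \<kappa> * L \<le> 4 / c0 * N powr \<kappa> * L\<^sup>2" using L0 c0 by (intro mult_left_mono) auto
    also have "\<dots> = N powr \<kappa> * (4 / c0 * L\<^sup>2)" by simp
    also have "\<dots> \<le> N powr \<kappa> * N powr (e - \<kappa>)" using f4 by (intro mult_left_mono) auto
    finally show ?thesis using Ne(3) by simp
  qed
  have spread_weight: "4 * N powr \<kappa> / c0 \<le> Tm"
  proof -
    have "4 * N powr \<kappa> / c0 * 1 \<le> 4 * N powr \<kappa> / c0 * L" using L0 c0 by (intro mult_left_mono) auto
    also have "\<dots> \<le> N powr e * 1" using Ke by simp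
    also have "\<dots> \<le> Tm" unfolding Tm_def using L0 by (intro mult_left_mono) auto
    finally show ?thesis by simp
  qed
  have tw1: "4 * N powr \<kappa> \<le> c0 * tw"
  proof -
    have "4 / c0 * N powr \<kappa> * sqrt L \<le> 4 / c0 * N powr \<kappa> * L" using L0 c0 by (intro mult_left_mono) auto
    then have "4 / c0 * N powr \<kappa> * sqrt L \<le> N powr e" using Ke by simp
    then show ?thesis unfolding tw_def using sL c0 by (simp add: field_simps)
  qed
  have c08: "c0 \<le> 1 / 8"
  proof -
    have "4 * xmin \<le> 4 * xmin / (1 - geo_ratio b)" using g x by (simp add: field_simps)
    then have "4 * xmin \<le> C1" unfolding C1_def vol_const_def by simp
    then show ?thesis using C1 by (simp add: c0_def deg_ratio_def C1_def field_simps)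
  qed
  have xs: "xmin \<le> Tm" "xmin \<le> tw" "xmin \<le> th"
  proof -
    have "xmin \<le> 4 * N powr \<kappa> * 1" using K(2) x by simp
    also have "\<dots> \<le> 4 * N powr \<kappa> * (1 / c0)" using c0 c08 by (intro mult_left_mono) (auto simp: field_simps)
    finally have "xmin \<le> 4 * N powr \<kappa> / c0" by simp
    then show "xmin \<le> Tm" using spread_weight by simp
    have "4 * N powr \<kappa> / c0 \<le> tw" using tw1 c0 by (simp add: field_simps)
    then show "xmin \<le> tw" using \<open>xmin \<le> 4 * N powr \<kappa> / c0\<close> by simp
    have "xmin \<le> 16 * \<theta> * 1" using f8 \<theta>1 L0 by simp
    also have "\<dots> \<le> 16 * \<theta> * (1 / c0)" using c0 c08 \<theta>0 by (intro mult_left_mono) (auto simp: field_simps)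
    finally show "xmin \<le> th" by (simp add: th_def)
  qed
  have gw: "\<exists>w. regular_weights n p xmin C1 b (N powr \<kappa>) \<theta> L (tail_const xmin b) (moment_bound xmin b (4 * N powr \<kappa> / c0)) (high_bound xmin b n (N powr \<kappa>)) w"
    if p: "p \<in> regular_set xmin b n Tm tw th s" for p
    unfolding C1_def c0_def
  proof (rule regular_weights_from_regular_set[where Tm = Tm and tw = tw and s = s])
    show "p \<in> regular_set xmin b n Tm tw (16 * \<theta> / deg_ratio xmin b) s" using p by (simp add: th_def c0_def)
    show "0 \<le> s" using L0 by (simp add: s_def)
    show "Tm < xmin * 2 ^ n" using a2 f2 by simp
    show "Tm \<le> real n" "4 * s * Tm \<le> real n" using a2 a3 by (auto simp: N_def)
    show "4 * N powr \<kappa> / deg_ratio xmin b \<le> Tm" using spread_weight by (simp add: c0_def)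
    show "6 * \<theta> \<le> real n"
    proof -
      have "6 * \<theta> = N powr a * (24 * \<nu> * L\<^sup>2)" by (simp add: \<theta>)
      also have "\<dots> \<le> N powr a * N powr (1 - a)" using f6 by (intro mult_left_mono) auto
      finally show ?thesis using Ne(2) by (simp add: N_def)
    qed
    show "xmin \<le> 4 * L" using f8 by simp
    show "4 * N powr \<kappa> \<le> deg_ratio xmin b * tw" using tw1 by (simp add: c0_def)
    \<comment> \<open>Since \<open>a + e = 1\<close>, the right side is
      \<open>4 * \<nu> * n * L * L / sqrt L\<close>; the spare factor \<open>sqrt L\<close> beats
      the constant.\<close>
    show "16 * vol_const xmin b * real n * L \<le> \<theta> * tw"
    proof -
      have "\<theta> * tw = 4 * \<nu> * L\<^sup>2 * (N powr a * N powr e) / sqrt L" by (simp add: \<theta> tw_def)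
      also have "\<dots> = (4 * \<nu> * L) * L * N / sqrt L" using Ne(5) by (simp add: power2_eq_square)
      also have "\<dots> \<ge> (16 * C1 * sqrt L) * L * N / sqrt L"
        using f9 L0 N sL by (intro divide_right_mono mult_right_mono) auto
      also have "(16 * C1 * sqrt L) * L * N / sqrt L = 16 * C1 * N * L" using sL by simp
      finally show ?thesis by (simp add: N_def C1_def)
    qed
    \<comment> \<open>As \<open>\<kappa> * (b - 1) < 1\<close>, the expected tail count at a scale
      of order \<open>K\<close> is a positive power of \<open>n\<close>, far above the
      slack.\<close>
    show "s \<le> real n * (4 * N powr \<kappa> / deg_ratio xmin b / xmin) powr (1 - b)"
    proof -
      have pos: "0 < (4 / (c0 * xmin)) powr (1 - b)" using c0 x by simp
      have "(4 * N powr \<kappa> / c0 / xmin) powr (1 - b) = ((4 / (c0 * xmin)) * N powr \<kappa>) powr (1 - b)"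
        by (simp add: field_simps)
      also have "\<dots> = (4 / (c0 * xmin)) powr (1 - b) * N powr (\<kappa> * (1 - b))"
        unfolding powr_mult powr_powr ..
      finally have eq: "(4 * N powr \<kappa> / c0 / xmin) powr (1 - b) = (4 / (c0 * xmin)) powr (1 - b) * N powr (\<kappa> * (1 - b))" .
      have "3 * L / (4 / (c0 * xmin)) powr (1 - b) \<le> 3 * L\<^sup>2 / (4 / (c0 * xmin)) powr (1 - b)"
        using L0 pos by (intro divide_right_mono) auto
      also have "\<dots> \<le> N powr (1 - \<kappa> * (b - 1))" using f3 by simp
      also have "\<dots> = N * N powr (\<kappa> * (1 - b))"
        using N powr_add[of N 1 "\<kappa> * (1 - b)"] by (simp add: algebra_simps)
      finally have "3 * L \<le> N * N powr (\<kappa> * (1 - b)) * (4 / (c0 * xmin)) powr (1 - b)"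
        using pos by (simp only: pos_divide_le_eq)
      then show ?thesis using eq by (simp add: s_def N_def c0_def mult_ac)
    qed
    \<comment> \<open>The heavy weight is at least of order
      \<open>n * \<theta> powr (2 - b)\<close>, so the right side is at least of order
      \<open>n * \<theta> powr (3 - b)\<close>, which exceeds \<open>n\<close> by a positive power
      of \<open>n\<close>.\<close>
    show "4 * vol_const xmin b * real n * L \<le> \<theta> * xmin * (16 * \<theta> / deg_ratio xmin b * (real n * tail_prob xmin b (16 * \<theta> / deg_ratio xmin b) / 4))"
    proof -
      have "tail_prob xmin b th = xmin powr (b - 1) * th powr (1 - b)"
        using th0 x powr_minus_divide[of th "b - 1"] by (simp add: tail_prob_def powr_divide)
      then have "th * tail_prob xmin b th = xmin powr (b - 1) * (th powr 1 * th powr (1 - b))" using th0 by simp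
      also have "th powr 1 * th powr (1 - b) = th powr (2 - b)"
        using powr_add[of th 1 "1 - b"] by (simp add: algebra_simps)
      also have "th powr (2 - b) = (16 / c0) powr (2 - b) * \<theta> powr (2 - b)"
        using powr_mult[of "16 / c0" \<theta> "2 - b"] by (simp add: th_def)
      finally have tt: "th * tail_prob xmin b th = xmin powr (b - 1) * ((16 / c0) powr (2 - b) * \<theta> powr (2 - b))" .
      have "\<theta> * xmin * (th * (N * tail_prob xmin b th / 4)) = \<theta> * xmin * N / 4 * (th * tail_prob xmin b th)" by simp
      also have "\<dots> = N * D * (\<theta> powr 1 * \<theta> powr (2 - b))" unfolding tt D_def using \<theta>0 by simp
      also have "\<theta> powr 1 * \<theta> powr (2 - b) = \<theta> powr (3 - b)"
        using powr_add[of \<theta> 1 "2 - b"] by (simp add: algebra_simps)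
      finally have eq: "\<theta> * xmin * (th * (N * tail_prob xmin b th / 4)) = N * D * \<theta> powr (3 - b)" .
      have "4 * C1 / D * L \<le> 4 * C1 / D * L\<^sup>2" using L0 C1 D by (intro mult_left_mono) auto
      also have "\<dots> \<le> (N powr a) powr (3 - b)" using f10 by (simp add: powr_powr)
      also have "\<dots> \<le> \<theta> powr (3 - b)" using \<theta>1 b by (intro powr_mono2) auto
      finally have "4 * C1 * L \<le> D * \<theta> powr (3 - b)" using D by (simp add: field_simps)
      then have "N * (4 * C1 * L) \<le> N * (D * \<theta> powr (3 - b))" using N by (intro mult_left_mono) auto
      then show ?thesis using eq by (simp add: N_def c0_def C1_def th_def mult_ac)
    qed
  qed (use x b n K \<theta>1 in \<open>auto simp: L_def\<close>)
  note GPm = measure_regular_set[OF x b1 xs, of n s]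
  have t1: "N * tail_prob xmin b Tm = xmin powr (b - 1) * L powr (1 - b)"
  proof -
    have "tail_prob xmin b Tm = xmin powr (b - 1) / (N powr (e * (b - 1)) * L powr (b - 1))"
      using x L0 by (simp add: tail_prob_def Tm_def powr_divide powr_mult powr_powr)
    then show ?thesis using e(3) N powr_minus_divide[of L "b - 1"] by simp
  qed
  have t2: "N * tail_prob xmin b tw = xmin powr (b - 1) * L powr ((b - 1) / 2)"
  proof -
    have "sqrt L powr (b - 1) = L powr ((b - 1) / 2)"
      using L0 by (simp add: powr_half_sqrt[symmetric] powr_powr)
    moreover have "tail_prob xmin b tw = xmin powr (b - 1) * sqrt L powr (b - 1) / N powr (e * (b - 1))"
      using x L0 sL N by (simp add: tail_prob_def tw_def powr_divide powr_mult powr_powr)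
    ultimately show ?thesis using e(3) N by simp
  qed
  \<comment> \<open>Because \<open>a < 1/2\<close>, the logarithms in \<open>\<theta>\<close> still
    leave \<open>\<theta> \<le> sqrt n\<close>, and the expected number of heavy vertices is at
    least a positive power of \<open>n\<close>.\<close>
  have t3: "d * N powr ((3 - b) / 2) \<le> N * tail_prob xmin b th"
  proof -
    have "\<theta> = N powr a * (4 * \<nu> * L\<^sup>2)" by (simp add: \<theta>)
    also have "\<dots> \<le> N powr a * N powr (1/2 - a)" using f7 by (intro mult_left_mono) auto
    finally have "\<theta> \<le> N powr (1/2)" using Ne(4) by simp
    then have "xmin * c0 / 16 / N powr (1/2) \<le> xmin * c0 / 16 / \<theta>"
      using x c0 \<theta>0 Npos by (intro divide_left_mono) auto
    also have "\<dots> = xmin / th" by (simp add: th_def)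
    finally have "(xmin * c0 / 16 / N powr (1/2)) powr (b - 1) \<le> tail_prob xmin b th"
      unfolding tail_prob_def using x c0 b by (intro powr_mono2) auto
    also have "(xmin * c0 / 16 / N powr (1/2)) powr (b - 1) = d / N powr ((b - 1) / 2)"
      using x c0 N powr_divide[of "xmin * c0 / 16" "N powr (1/2)" "b - 1"]
      unfolding d_def powr_powr by simp
    finally have "N * (d / N powr ((b - 1) / 2)) \<le> N * tail_prob xmin b th" using N by (intro mult_left_mono) auto
    moreover have "N / N powr ((b - 1) / 2) = N powr ((3 - b) / 2)"
      using powr_diff[of N 1 "(b - 1) / 2"] N by (simp add: field_simps)
    moreover have "N * (d / N powr ((b - 1) / 2)) = d * (N / N powr ((b - 1) / 2))" by simp
    ultimately show ?thesis by simp
  qed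
  have "exp (- (N * tail_prob xmin b th / 4)) \<le> exp (- (d * N powr ((3 - b) / 2) / 4))" using t3 by simp
  then have "1 - (xmin powr (b - 1) * L powr (1 - b) + exp (- (xmin powr (b - 1) * L powr ((b - 1) / 2)))
       + N * exp (- (3 * L)) + exp (- (d * N powr ((3 - b) / 2) / 4))) \<le>
      measure (weight_prod xmin b n) (regular_set xmin b n Tm tw th s)"
    using GPm(2)[folded N_def, unfolded t1 t2] unfolding s_def by linarith
  then show ?thesis using gw GPm(1) by blast
qed

abbreviation regular_at :: "real \<Rightarrow> real \<Rightarrow> real \<Rightarrow> nat \<Rightarrow> (nat \<Rightarrow> real) \<Rightarrow> nat \<Rightarrow> bool" where
  "regular_at xmin b \<nu> n p w \<equiv> regular_weights n p xmin (vol_const xmin b) b (real n powr high_exp b) (cut_threshold b \<nu> n) (ln (real n)) (tail_const xmin b)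
        (moment_bound xmin b (4 * real n powr high_exp b / deg_ratio xmin b)) (high_bound xmin b n (real n powr high_exp b)) w"

abbreviation label_bound_at :: "real \<Rightarrow> real \<Rightarrow> real \<Rightarrow> nat \<Rightarrow> real" where
  "label_bound_at xmin b \<nu> n \<equiv> regular_weights.label_bound xmin (vol_const xmin b) b (real n powr high_exp b) (cut_threshold b \<nu> n) (ln (real n)) (tail_const xmin b)
        (moment_bound xmin b (4 * real n powr high_exp b / deg_ratio xmin b)) (high_bound xmin b n (real n powr high_exp b))"

text \<open>The constant is quantified before \<open>n\<close>, so it is assembled from quantities
  in which \<open>n\<close> and the weights no longer occur.\<close>

lemma label_bound_at_le:
  fixes xmin b \<nu> :: real
  assumes x: "0 < xmin" and b: "2 < b" "b < 3" and \<nu>: "1 < \<nu>"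
  shows "\<exists>C. 0 < C \<and> (\<forall>n p w. regular_at xmin b \<nu> n p w \<longrightarrow>
      2 \<le> ln (real n) \<longrightarrow> 2 * \<bar>ln xmin\<bar> \<le> ln (real n) \<longrightarrow>
      label_bound_at xmin b \<nu> n
      \<le> C * label_rate b n * ln (real n) ^ 3)"
proof -
  define C1 where "C1 = vol_const xmin b"
  define cc0 where "cc0 = deg_ratio xmin b"
  define \<kappa> where "\<kappa> = high_exp b"
  define a where "a = (b - 2) / (b - 1)"
  note kp = high_exp_props[OF b, folded \<kappa>_def a_def]
  define u where "u = 4 / (cc0 * xmin)"
  define hb where "hb = 3 * (1 / (8 * xmin)) powr (1 - b)"
  define cM where "cM = 48 * \<nu> * (2 * xmin) powr (4 - b) * max 1 (u powr (5 - 2 * b))"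
  define t3 where "t3 = (4 / cc0) powr (3 - b)"
  define C where "C = (2 * hb + 3 * (4 * \<nu>) + regular_weights.deg_const xmin C1 * (4 * \<nu>) +
        2 * regular_weights.nbr_const xmin C1 b (tail_const xmin b) * (8 * cM / (weighted_graph.c0 xmin C1 * xmin) + 4 * t3) +
        2 * regular_weights.nbr_const xmin C1 b (tail_const xmin b) * t3 + regular_weights.deg_const xmin C1)"
  show ?thesis
  proof (intro exI[of _ "max 1 C"] conjI allI impI)
    show "0 < max 1 C" by simp
    fix n p w
    let ?N = "real n" and ?L = "ln (real n)" and ?K = "real n powr \<kappa>" and ?\<theta> = "cut_threshold b \<nu> n" and ?R = "label_rate b n"
    let ?M = "moment_bound xmin b (4 * ?K / cc0)" and ?Hb = "high_bound xmin b n ?K"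
    assume "regular_at xmin b \<nu> n p w"
    then interpret regular_weights n p xmin C1 b ?K ?\<theta> ?L "tail_const xmin b" ?M ?Hb w
      by (simp add: C1_def cc0_def \<kappa>_def)
    have c0eq: "weighted_graph.c0 xmin C1 = cc0" using c0_def by (simp only: cc0_def deg_ratio_def C1_def)
    assume L2: "2 \<le> ?L" and Lx: "2 * \<bar>ln xmin\<bar> \<le> ?L"
    have c0p: "0 < cc0" using c0_pos c0eq by simp
    have N: "1 \<le> ?N" "0 < ?N" using n2 by auto
    have a0: "0 \<le> a" using b by (simp add: a_def)
    have Ra: "?N powr a \<le> ?R" and Rb: "?N powr ((3 - b) / (4 - b)) \<le> ?R" by (auto simp: label_rate_def a_def)
    have R1: "1 \<le> ?R" using ge_one_powr_ge_zero[OF N(1) a0] Ra by linarith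
    have R0: "0 < ?R" using R1 by simp
    have \<theta>: "?\<theta> = 4 * \<nu> * ?L\<^sup>2 * ?N powr a" by (simp add: cut_threshold_def a_def)
    have "label_bound \<le> C * ?R * ?L ^ 3"
      unfolding C_def
    proof (rule label_bound_le)
      show "1 \<le> ?R" "1 \<le> ?L" using R1 L2 by auto
      show "0 \<le> hb" "0 \<le> t3" "0 \<le> 4 * \<nu>" using \<nu> by (auto simp: hb_def t3_def)
      have "?Hb = hb * (?N * ?N powr (\<kappa> * (1 - b)))" by (simp add: high_bound_def hb_def powr_powr)
      also have "?N * ?N powr (\<kappa> * (1 - b)) = ?N powr (1 - \<kappa> * (b - 1))"
        using N powr_add[of ?N 1 "\<kappa> * (1 - b)"] by (simp add: algebra_simps)
      also have "hb * ?N powr (1 - \<kappa> * (b - 1)) \<le> hb * ?R"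
        using powr_mono[OF kp(4) N(1)] Rb by (intro mult_left_mono) (auto simp: hb_def)
      finally show "?Hb \<le> hb * ?R" .
      show "?\<theta> \<le> 4 * \<nu> * ?R * ?L\<^sup>2"
        unfolding \<theta> using Ra \<nu> mult_left_mono[OF Ra, of "4 * \<nu> * ?L\<^sup>2"] by (simp add: mult_ac)
      have "wcap powr (3 - b) = t3 * ?N powr (\<kappa> * (3 - b))"
        using powr_mult[of "4 / cc0" "?N powr \<kappa>" "3 - b"] by (simp add: wcap_def c0eq t3_def powr_powr)
      also have "\<dots> \<le> t3 * ?R"
        using powr_mono[OF kp(5) N(1)] Rb by (intro mult_left_mono) (auto simp: t3_def)
      finally show "wcap powr (3 - b) \<le> t3 * ?R" .
      show "?\<theta> * ?M \<le> cM * ?R * ?L ^ 3"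
      proof -
        have Tp: "0 < 4 * ?K / cc0" using c0p N by simp
        have "4 * ?K \<le> cc0 * p w" using w(2) c0eq by simp
        also have "\<dots> \<le> cc0 * ?N" using p_le[OF w(1)] c0p by simp
        finally have "4 * ?K / cc0 \<le> ?N" using c0p by (simp add: field_simps)
        then have "ln (4 * ?K / cc0) \<le> ?L" using Tp N by simp
        moreover have "ln (t / xmin) = ln t - ln xmin" if "0 < t" for t
          using that x by (simp add: ln_div)
        note this[OF Tp]
        \<comment> \<open>The weight cap is at most \<open>p w \<le> n\<close>, and
          \<open>ln xmin\<close> costs at most half of \<open>?L\<close>; hence there are at most
          \<open>4 * ?L\<close> dyadic scales.\<close>
        ultimately have "ln (4 * ?K / cc0 / xmin) \<le> 3/2 * ?L" using Lx by linarith
        moreover have "2/3 \<le> ln (2::real)" by (rule ln2_ge_two_thirds)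
        ultimately have "ln (4 * ?K / cc0 / xmin) \<le> 3 * ?L * ln 2"
          using L2 mult_left_mono[of "2/3" "ln (2::real)" "3 * ?L"] by linarith
        then have "log 2 (4 * ?K / cc0 / xmin) \<le> 3 * ?L"
          unfolding log_def by (subst pos_divide_le_eq) auto
        then have lg: "1 + log 2 (4 * ?K / cc0 / xmin) \<le> 4 * ?L" using L2 by linarith
        let ?m = "max 1 ((4 * ?K / cc0 / xmin) powr (5 - 2 * b))"
        have m: "?m \<le> max 1 (u powr (5 - 2 * b)) * max 1 (?N powr (\<kappa> * (5 - 2 * b)))"
        proof -
          have "4 * ?K / cc0 / xmin = u * ?K" by (simp add: u_def)
          then have "(4 * ?K / cc0 / xmin) powr (5 - 2 * b) = u powr (5 - 2 * b) * ?N powr (\<kappa> * (5 - 2 * b))"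
            by (simp add: powr_mult powr_powr)
          also have "\<dots> \<le> max 1 (u powr (5 - 2 * b)) * max 1 (?N powr (\<kappa> * (5 - 2 * b)))"
            by (intro mult_mono) auto
          finally show ?thesis using mult_mono[of 1 "max 1 (u powr (5 - 2 * b))" 1 "max 1 (?N powr (\<kappa> * (5 - 2 * b)))"] by simp
        qed
        \<comment> \<open>For \<open>b < 5/2\<close> this is the balance of exponents; otherwise the
          maximum equals 1 and \<open>n powr a\<close> alone is below the rate.\<close>
        have NR: "?N powr a * max 1 (?N powr (\<kappa> * (5 - 2 * b))) \<le> ?R"
        proof (cases "b < 5/2")
          case True
          then have "?N powr a * ?N powr (\<kappa> * (5 - 2 * b)) = ?N powr ((3 - b) / (4 - b))"
            using kp(6) by (simp flip: powr_add)
          moreover have "1 \<le> ?N powr (\<kappa> * (5 - 2 * b))"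
            using True kp(1) by (intro ge_one_powr_ge_zero N) auto
          ultimately show ?thesis using Rb by (simp add: max_def)
        next
          case False
          then have "?N powr (\<kappa> * (5 - 2 * b)) \<le> ?N powr 0"
            using kp(1) N by (intro powr_mono) (auto simp: mult_le_0_iff)
          then show ?thesis using Ra N by (simp add: max_def)
        qed
        have m0: "0 \<le> ?m" "0 \<le> max 1 (u powr (5 - 2 * b))" by auto
        have "?M \<le> 3 * (2 * xmin) powr (4 - b) * (4 * ?L) * ?m"
          unfolding moment_bound_def using lg m0 by (intro mult_right_mono mult_left_mono) auto
        also have "\<dots> \<le> 3 * (2 * xmin) powr (4 - b) * (4 * ?L) * (max 1 (u powr (5 - 2 * b)) * max 1 (?N powr (\<kappa> * (5 - 2 * b))))"
          using m L2 by (intro mult_left_mono) auto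
        finally have "?\<theta> * ?M \<le> ?\<theta> * (3 * (2 * xmin) powr (4 - b) * (4 * ?L) * (max 1 (u powr (5 - 2 * b)) * max 1 (?N powr (\<kappa> * (5 - 2 * b)))))"
          using \<theta>_pos by (intro mult_left_mono) auto
        also have "\<dots> = cM * ?L ^ 3 * (?N powr a * max 1 (?N powr (\<kappa> * (5 - 2 * b))))"
          unfolding \<theta> cM_def by (simp add: power2_eq_square power3_eq_cube)
        also have "\<dots> \<le> cM * ?L ^ 3 * ?R"
          using NR L2 \<nu> m0 by (intro mult_left_mono) (auto simp: cM_def)
        finally show ?thesis by (simp add: mult_ac)
      qed
    qed
    also have "\<dots> \<le> max 1 C * ?R * ?L ^ 3"
      using R0 L2 by (intro mult_right_mono) auto
    finally show "label_bound_at xmin b \<nu> n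
      \<le> max 1 C * label_rate b n * ln (real n) ^ 3" by (simp add: C1_def cc0_def \<kappa>_def)
  qed
qed

section \<open>From fixed weights to the probability space\<close>

definition pruning_ok :: "real \<Rightarrow> real \<Rightarrow> real \<Rightarrow> nat \<Rightarrow> (nat \<Rightarrow> nat \<Rightarrow> bool) \<Rightarrow> bool" where
  "pruning_ok C b \<nu> n E \<longleftrightarrow> (\<forall>xs. degree_ordering E n xs \<longrightarrow>
     (let L = approx_pruning E n xs (card {v. v < n \<and> real n powr high_exp b \<le> real (deg E n v)}) (radius E n (cut_threshold b \<nu> n))
      in is_2hop_cover E n L \<and> (\<forall>v<n. real (num_landmarks L v) \<le> C * label_rate b n * ln (real n) ^ 3)))"

abbreviation unif :: "real measure" where "unif \<equiv> uniform_measure lborel {0..1::real}"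

lemma prob_space_unif: "prob_space unif"
  by (rule prob_space_uniform_measure) auto

lemma measure_unif:
  assumes "0 \<le> q" "q \<le> 1"
  shows "measure unif {..<q} = q"
proof -
  have "{0..1} \<inter> {..<q} = {0..<q}" using assms by auto
  then show ?thesis using assms by (subst measure_uniform_measure) auto
qed

lemma graph_of_eq:
  "graph_of n (p, c) = egraph n (\<lambda>e. e \<in> vpairs n \<and> c e \<in> {..<eprob n p e})"
proof (intro ext)
  fix x y
  have "eprob n p (upair (x, y)) = min (p x * p y / (\<Sum>v<n. p v)) 1"
    by (auto simp: eprob_def upair_def min_def max_def mult.commute)
  moreover have "upair (x, y) \<in> vpairs n" if "x < n" "y < n" "x \<noteq> y"
    using that by (auto simp: upair_def vpairs_def min_def max_def)
  ultimately show "graph_of n (p, c) x y = egraph n (\<lambda>e. e \<in> vpairs n \<and> c e \<in> {..<eprob n p e}) x y"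
    by (auto simp: graph_of_def egraph_def upair_def)
qed

text \<open>For fixed weights the uniform variables turn into independent edge indicators, the
  setting of all estimates for explorations.\<close>

lemma slice_prob:
  assumes q: "\<And>e. e \<in> vpairs n \<Longrightarrow> 0 \<le> eprob n p e \<and> eprob n p e \<le> 1"
  shows "measure (PiM (vpairs n) (\<lambda>_. unif)) {c \<in> space (PiM (vpairs n) (\<lambda>_. unif)). Q (graph_of n (p, c))} =
    bprob (vpairs n) (eprob n p) (\<lambda>g. Q (egraph n g))"
proof -
  have "measure (PiM (vpairs n) (\<lambda>_. unif)) {c \<in> space (PiM (vpairs n) (\<lambda>_. unif)). Q (graph_of n (p, c))} =
    bprob (vpairs n) (\<lambda>e. measure unif {..<eprob n p e}) (\<lambda>g. Q (egraph n g))"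
    unfolding graph_of_eq
    by (rule PiM_bern(2)[where Q = "\<lambda>g. Q (egraph n g)"]) (auto intro: prob_space_unif)
  also have "bern (vpairs n) (\<lambda>e. measure unif {..<eprob n p e}) = bern (vpairs n) (eprob n p)"
    unfolding bern_def by (rule Pi_pmf_cong) (use q measure_unif in auto)
  finally show ?thesis .
qed

lemma graph_of_dom: "graph_of n \<omega> x y \<Longrightarrow> x < n \<and> y < n"
  by (auto simp: graph_of_def split: prod.splits)

lemma rplg_eq: "rplg xmin b n = weight_prod xmin b n \<Otimes>\<^sub>M PiM (vpairs n) (\<lambda>_. unif)"
  unfolding rplg_def vpairs_def ..

text \<open>There are only finitely many graphs on \<open>n\<close> vertices, so for an arbitrary
  predicate \<open>Q\<close> the event is a finite union of events that fix every edge.\<close>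

lemma graph_event_measurable:
  "{\<omega> \<in> space (rplg xmin b n). Q (graph_of n \<omega>)} \<in> sets (rplg xmin b n)"
proof -
  have edge: "{\<omega> \<in> space (rplg xmin b n). graph_of n \<omega> x y} \<in> sets (rplg xmin b n)" for x y
  proof (cases "x < n \<and> y < n \<and> x \<noteq> y")
    case False
    then have "\<not> graph_of n \<omega> x y" for \<omega> by (cases \<omega>) (auto simp: graph_of_def)
    then show ?thesis by simp
  next
    case True
    then have e: "(min x y, max x y) \<in> vpairs n" by (auto simp: vpairs_def min_def max_def)
    have w: "(\<lambda>\<omega>. fst \<omega> v) \<in> borel_measurable (rplg xmin b n)" if "v < n" for v
    proof -
      have "(\<lambda>p. p v) \<in> measurable (weight_prod xmin b n) borel"
        using measurable_component_singleton[of v "{..<n}" "\<lambda>_. weight_dist xmin b"] that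
        by (simp cong: measurable_cong_sets)
      then show ?thesis unfolding rplg_eq by measurable
    qed
    have c: "(\<lambda>\<omega>. snd \<omega> (min x y, max x y)) \<in> borel_measurable (rplg xmin b n)"
    proof -
      have "(\<lambda>c. c (min x y, max x y)) \<in> measurable (PiM (vpairs n) (\<lambda>_. unif)) borel"
        using measurable_component_singleton[OF e, of "\<lambda>_. unif"] by (simp cong: measurable_cong_sets)
      then show ?thesis unfolding rplg_eq by measurable
    qed
    have s: "(\<lambda>\<omega>. \<Sum>v<n. fst \<omega> v) \<in> borel_measurable (rplg xmin b n)"
      by (intro borel_measurable_sum w) auto
    have "{\<omega> \<in> space (rplg xmin b n). graph_of n \<omega> x y} = {\<omega> \<in> space (rplg xmin b n).
        snd \<omega> (min x y, max x y) < min (fst \<omega> x * fst \<omega> y / (\<Sum>v<n. fst \<omega> v)) 1}"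
      using True by (auto simp: graph_of_def)
    also have "\<dots> \<in> sets (rplg xmin b n)"
      using True by (intro borel_measurable_less c borel_measurable_min borel_measurable_divide borel_measurable_times w s) auto
    finally show ?thesis .
  qed
  define Rel where "Rel = {E. Q E \<and> (\<forall>x y. E x y \<longrightarrow> x < n \<and> y < n)}"
  have fin: "finite Rel"
  proof (rule inj_on_finite[of "\<lambda>E. {(x, y). E x y}" _ "Pow ({..<n} \<times> {..<n})"])
    show "inj_on (\<lambda>E. {(x, y). E x y}) Rel" by (auto simp: inj_on_def fun_eq_iff set_eq_iff)
  qed (auto simp: Rel_def)
  have ev: "{\<omega> \<in> space (rplg xmin b n). graph_of n \<omega> = E} \<in> sets (rplg xmin b n)" if "E \<in> Rel" for E
  proof -
    have "{\<omega> \<in> space (rplg xmin b n). graph_of n \<omega> = E} = {\<omega> \<in> space (rplg xmin b n).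
        \<forall>x\<in>{..<n}. \<forall>y\<in>{..<n}. graph_of n \<omega> x y \<longleftrightarrow> E x y}"
      using that graph_of_dom unfolding Rel_def fun_eq_iff by blast
    also have "\<dots> \<in> sets (rplg xmin b n)"
    proof (intro sets.sets_Collect_finite_All)
      fix x y
      show "{\<omega> \<in> space (rplg xmin b n). graph_of n \<omega> x y = E x y} \<in> sets (rplg xmin b n)"
        using edge[of x y] sets.sets_Collect_neg[OF edge[of x y]] by (cases "E x y") auto
    qed auto
    finally show ?thesis .
  qed
  have "{\<omega> \<in> space (rplg xmin b n). Q (graph_of n \<omega>)} = (\<Union>E\<in>Rel. {\<omega> \<in> space (rplg xmin b n). graph_of n \<omega> = E})"
    using graph_of_dom by (auto simp: Rel_def)
  also have "\<dots> \<in> sets (rplg xmin b n)" by (intro sets.finite_UN fin ev)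
  finally show ?thesis .
qed

lemma prob_space_rplg:
  assumes "0 < xmin" "1 < b"
  shows "prob_space (rplg xmin b n)"
  unfolding rplg_eq
  by (intro prob_space_pair prob_space_PiM prob_space_weight_dist assms prob_space_unif)

text \<open>Fubini over the weights: for weights in \<open>G\<close> the slice of the event has
  probability at least \<open>r\<close>, elsewhere it is bounded below by 0.\<close>

lemma rplg_lower:
  assumes x: "0 < xmin" "1 < b"
    and G: "G \<in> sets (weight_prod xmin b n)"
    and Gq: "\<And>p e. p \<in> G \<Longrightarrow> e \<in> vpairs n \<Longrightarrow> 0 \<le> eprob n p e \<and> eprob n p e \<le> 1"
    and Gp: "\<And>p. p \<in> G \<Longrightarrow> r \<le> bprob (vpairs n) (eprob n p) (\<lambda>g. Q (egraph n g))" and r: "0 \<le> r"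
  shows "r * measure (weight_prod xmin b n) G \<le> measure (rplg xmin b n) {\<omega> \<in> space (rplg xmin b n). Q (graph_of n \<omega>)}"
proof -
  define W where "W = weight_prod xmin b n"
  define Cm where "Cm = PiM (vpairs n) (\<lambda>_. unif)"
  define A where "A = {\<omega> \<in> space (rplg xmin b n). Q (graph_of n \<omega>)}"
  interpret W: prob_space W unfolding W_def by (intro prob_space_PiM prob_space_weight_dist x)
  interpret Cm: prob_space Cm unfolding Cm_def by (intro prob_space_PiM prob_space_unif)
  interpret R: prob_space "rplg xmin b n" by (rule prob_space_rplg[OF x])
  have A: "A \<in> sets (W \<Otimes>\<^sub>M Cm)"
    using graph_event_measurable[of xmin b n Q] by (simp add: A_def rplg_eq W_def Cm_def)
  have "ennreal (r * measure W G) = (\<integral>\<^sup>+p. ennreal r * indicator G p \<partial>W)"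
    using G by (simp add: nn_integral_cmult_indicator W_def[symmetric] W.emeasure_eq_measure ennreal_mult'[OF r])
  also have "\<dots> \<le> (\<integral>\<^sup>+p. emeasure Cm (Pair p -` A) \<partial>W)"
  proof (rule nn_integral_mono)
    fix p assume p: "p \<in> space W"
    show "ennreal r * indicator G p \<le> emeasure Cm (Pair p -` A)"
    proof (cases "p \<in> G")
      case True
      have "Pair p -` A = {c \<in> space Cm. Q (graph_of n (p, c))}"
        using p by (auto simp: A_def rplg_eq space_pair_measure W_def[symmetric] Cm_def[symmetric])
      then have "measure Cm (Pair p -` A) = bprob (vpairs n) (eprob n p) (\<lambda>g. Q (egraph n g))"
        using slice_prob[of n p Q] Gq[OF True] by (simp add: Cm_def)
      then show ?thesis using Gp[OF True] True by (simp add: Cm.emeasure_eq_measure ennreal_leI)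
    qed simp
  qed
  also have "\<dots> = emeasure (W \<Otimes>\<^sub>M Cm) A"
    by (rule Cm.emeasure_pair_measure_alt[symmetric, OF A])
  also have "\<dots> = ennreal (measure (rplg xmin b n) A)"
    by (simp add: W_def Cm_def rplg_eq[symmetric] R.emeasure_eq_measure)
  finally have "r * measure W G \<le> measure (rplg xmin b n) A" by simp
  then show ?thesis by (simp add: W_def A_def)
qed

lemma regular_weights_pruning_ok:
  assumes gw: "regular_weights n p xmin C1 b (real n powr high_exp b) (cut_threshold b \<nu> n) (ln (real n)) C2 M Hb w"
    and label_bound: "regular_weights.label_bound xmin C1 b (real n powr high_exp b) (cut_threshold b \<nu> n) (ln (real n)) C2 M Hb \<le> C * label_rate b n * ln (real n) ^ 3"
  shows "1 - 6 / (real n)\<^sup>2 \<le> bprob (vpairs n) (eprob n p) (\<lambda>g. pruning_ok C b \<nu> n (egraph n g))"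
    and "e \<in> vpairs n \<Longrightarrow> 0 \<le> eprob n p e \<and> eprob n p e \<le> 1"
proof -
  interpret regular_weights n p xmin C1 b "real n powr high_exp b" "cut_threshold b \<nu> n" "ln (real n)" C2 M Hb w by (rule gw)
  have "pruning_ok C b \<nu> n (egraph n g)" if "good g" for g
    unfolding pruning_ok_def Let_def
    using good_cover[OF that _ refl] good_landmarks[OF that _ refl] label_bound by (auto intro: order_trans)
  then have "Pr good \<le> Pr (\<lambda>g. pruning_ok C b \<nu> n (egraph n g))" by (rule pmf_prob_mono)
  then show "1 - 6 / (real n)\<^sup>2 \<le> bprob (vpairs n) (eprob n p) (\<lambda>g. pruning_ok C b \<nu> n (egraph n g))"
    using prob_good by simp
  show "0 \<le> eprob n p e \<and> eprob n p e \<le> 1" if "e \<in> vpairs n"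
    using q_range[of "fst e" "snd e"] that by (auto simp: vpairs_def upair_def)
qed

lemma sqrt_ln_le:
  fixes c r :: real
  assumes "0 < r"
  shows "eventually (\<lambda>n::nat. c * sqrt (ln (real n)) \<le> r * ln (real n)) sequentially"
  using assms by real_asymp

text \<open>The slowest error is the negative power of \<open>ln n\<close> that comes from bounding
  the maximal weight.\<close>

lemma failure_tendsto:
  fixes b c d :: real
  assumes "2 < b" "b < 3" "0 < c" "0 < d"
  shows "(\<lambda>n. (1 - 6 / (real n)\<^sup>2) * (1 - (c * ln (real n) powr (1 - b) + exp (- (c * ln (real n) powr ((b - 1) / 2)))
      + real n * exp (- (3 * ln (real n))) + exp (- (d * real n powr ((3 - b) / 2) / 4))))) \<longlonglongrightarrow> 1"
  using assms by real_asymp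

lemma whp_pruning_ok:
  fixes xmin b \<nu> :: real
  assumes x: "0 < xmin" and b: "2 < b" "b < 3" and \<nu>: "1 < \<nu>"
  shows "\<exists>C>0. (\<lambda>n. measure (rplg xmin b n) {\<omega> \<in> space (rplg xmin b n). pruning_ok C b \<nu> n (graph_of n \<omega>)}) \<longlonglongrightarrow> 1"
proof -
  obtain C where CLB: "0 < C \<and> (\<forall>n p w. regular_at xmin b \<nu> n p w \<longrightarrow>
      2 \<le> ln (real n) \<longrightarrow> 2 * \<bar>ln xmin\<bar> \<le> ln (real n) \<longrightarrow>
      label_bound_at xmin b \<nu> n
      \<le> C * label_rate b n * ln (real n) ^ 3)"
    using label_bound_at_le[OF x b \<nu>] by (rule exE)
  note C = CLB[THEN conjunct1] and label_bound = CLB[THEN conjunct2, rule_format]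
  note kp = high_exp_props[OF b]
  have b1: "1 < b" using b by simp
  have e: "0 < 1 - 1 / (b - 1)" "0 < 1 - high_exp b * (b - 1)" "0 < 1 / (b - 1) - high_exp b" "0 < 1 - (b - 2) / (b - 1)"
    "0 < 1/2 - (b - 2) / (b - 1)" "0 < (b - 2) / (b - 1) * (3 - b)"
  proof -
    show "0 < 1 - 1 / (b - 1)" "0 < 1/2 - (b - 2) / (b - 1)" "0 < 1 - (b - 2) / (b - 1)"
      using b by (auto simp: field_simps)
    show "0 < (b - 2) / (b - 1) * (3 - b)" using b by simp
  qed (use kp(2,3) in auto)
  define d where "d = (xmin * deg_ratio xmin b / 16) powr (b - 1)"
  have c0: "0 < deg_ratio xmin b"
    using x geo_ratio_range[OF b(1)] by (simp add: deg_ratio_def vol_const_def add_pos_pos)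
  have d: "0 < d" using x c0 by (simp add: d_def)
  define Pn where "Pn n = measure (rplg xmin b n) {\<omega> \<in> space (rplg xmin b n). pruning_ok C b \<nu> n (graph_of n \<omega>)}" for n
  define err where "err n = xmin powr (b - 1) * ln (real n) powr (1 - b) + exp (- (xmin powr (b - 1) * ln (real n) powr ((b - 1) / 2)))
       + real n * exp (- (3 * ln (real n))) + exp (- (d * real n powr ((3 - b) / 2) / 4))" for n :: nat
  define D where "D = xmin * xmin powr (b - 1) * (16 / deg_ratio xmin b) powr (2 - b) / 4"
  have "eventually (\<lambda>n. (1 - 6 / (real n)\<^sup>2) * (1 - err n) \<le> Pn n) sequentially"
  proof -
    have "eventually (\<lambda>n::nat. real n < xmin * 2 ^ n) sequentially" using x by real_asymp
    moreover have "eventually (\<lambda>n::nat. 16 * vol_const xmin b * sqrt (ln (real n)) \<le> 4 * \<nu> * ln (real n)) sequentially"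
      by (rule sqrt_ln_le) (use \<nu> in simp)
    moreover have "eventually (\<lambda>n::nat. 2 \<le> ln (real n)) sequentially"
       "eventually (\<lambda>n::nat. xmin \<le> ln (real n)) sequentially"
       "eventually (\<lambda>n::nat. 2 * \<bar>ln xmin\<bar> \<le> ln (real n)) sequentially" by real_asymp+
    ultimately show ?thesis
      using eventually_ge_at_top[of "3::nat"] ln_sq_le_powr[OF e(1), of 12]
        ln_sq_le_powr[OF e(2), of "3 / (4 / (deg_ratio xmin b * xmin)) powr (1 - b)"]
        ln_sq_le_powr[OF e(3), of "4 / deg_ratio xmin b"] ln_sq_le_powr[OF kp(1), of "8 + 4 * xmin"]
        ln_sq_le_powr[OF e(4), of "24 * \<nu>"] ln_sq_le_powr[OF e(5), of "4 * \<nu>"]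
        ln_sq_le_powr[OF e(6), of "4 * vol_const xmin b / D"]
    proof eventually_elim
      case (elim n)
      let ?G = "regular_set xmin b n (real n powr (1 / (b - 1)) * ln (real n)) (real n powr (1 / (b - 1)) / sqrt (ln (real n)))
          (16 * cut_threshold b \<nu> n / deg_ratio xmin b) (3 * ln (real n))"
      have n2: "2 \<le> n" using elim(6) by simp
      note at = regular_weights_at[OF x b \<nu> n2 elim(7) elim(1) elim(8) elim(9) elim(10) elim(11) elim(12) elim(3) elim(4) elim(2)
          elim(13)[unfolded D_def], folded d_def, folded err_def]
      \<comment> \<open>From \<open>n \<ge> 3\<close> on, \<open>1 - 6 / n ^ 2\<close> is
        nonnegative and may multiply an inequality.\<close>
      have "9 \<le> (real n)\<^sup>2" using elim(6) power_mono[of 3 "real n" 2] by simp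
      then have "0 < (real n)\<^sup>2" "6 \<le> (real n)\<^sup>2" by linarith+
      then have r: "0 \<le> 1 - 6 / (real n)\<^sup>2" using divide_le_eq_1_pos[of "(real n)\<^sup>2" 6] by linarith
      have "(1 - 6 / (real n)\<^sup>2) * (1 - err n) \<le> (1 - 6 / (real n)\<^sup>2) * measure (weight_prod xmin b n) ?G"
        by (rule mult_left_mono[OF at[THEN conjunct2, THEN conjunct2] r])
      also have "\<dots> \<le> Pn n"
        unfolding Pn_def
      proof (rule rplg_lower[OF x b1])
        show "?G \<in> sets (weight_prod xmin b n)" by (rule at[THEN conjunct2, THEN conjunct1])
        fix p assume p: "p \<in> ?G"
        from bspec[OF at[THEN conjunct1] p] obtain w where gw: "regular_at xmin b \<nu> n p w"
          by (rule exE)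
        note ap = regular_weights_pruning_ok[OF gw label_bound[OF gw elim(3) elim(5)]]
        show "1 - 6 / (real n)\<^sup>2 \<le> bprob (vpairs n) (eprob n p) (\<lambda>g. pruning_ok C b \<nu> n (egraph n g))" by (rule ap(1))
        show "0 \<le> eprob n p e \<and> eprob n p e \<le> 1" if "e \<in> vpairs n" for e by (rule ap(2)[OF that])
      qed (rule r)
      finally show ?case .
    qed
  qed
  moreover have lim: "(\<lambda>n. (1 - 6 / (real n)\<^sup>2) * (1 - err n)) \<longlonglongrightarrow> 1"
    unfolding err_def by (rule failure_tendsto[OF b _ d]) (use x in simp)
  moreover have "eventually (\<lambda>n. Pn n \<le> 1) sequentially"
    unfolding Pn_def by (intro always_eventually allI prob_space.prob_le_1 prob_space_rplg x b1)
  ultimately have "Pn \<longlonglongrightarrow> 1"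
    using tendsto_sandwich[OF _ _ lim tendsto_const[of 1]] by (simp only:)
  then have "0 < C \<and> Pn \<longlonglongrightarrow> 1" using C by (rule conjI[rotated])
  then show ?thesis unfolding Pn_def by (rule exI[of _ C])
qed

theorem theorem4p2:
  fixes xmin \<beta> :: real
  assumes "0 < xmin" and "2 < \<beta>" and "\<beta> < 3" and "plaw_mean xmin \<beta> > 1"
  shows "\<exists>C > 0. \<exists>A :: nat \<Rightarrow> ((nat \<Rightarrow> real) \<times> (nat \<times> nat \<Rightarrow> real)) set.
    (\<forall>n. A n \<in> sets (rplg xmin \<beta> n)) \<and>
    (\<lambda>n. measure (rplg xmin \<beta> n) (A n)) \<longlonglongrightarrow> 1 \<and>
    (\<forall>n. \<forall>\<omega> \<in> A n.
       (let E = graph_of n \<omega>;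
            \<nu> = plaw_mean xmin \<beta>;
            K = (if 5/2 \<le> \<beta> then sqrt (real n)
                 else real n powr (1 / ((4 - \<beta>) * (\<beta> - 1))));
            H = card {v. v < n \<and> real (deg E n v) \<ge> K};
            \<delta> = 4 * \<nu> * (ln (real n))\<^sup>2;
            \<theta> = \<delta> * real n powr ((\<beta> - 2) / (\<beta> - 1))
        in \<forall>xs. degree_ordering E n xs \<longrightarrow>
             (let L = approx_pruning E n xs H (radius E n \<theta>)
              in is_2hop_cover E n L \<and>
                 (\<forall>v<n. real (num_landmarks L v) \<le>
                    C * max (real n powr ((\<beta> - 2) / (\<beta> - 1))) (real n powr ((3 - \<beta>) / (4 - \<beta>)))
                      * (ln (real n)) ^ 3))))"
proof -
  obtain C where C: "0 < C" and lim: "(\<lambda>n. measure (rplg xmin \<beta> n) {\<omega> \<in> space (rplg xmin \<beta> n).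
      pruning_ok C \<beta> (plaw_mean xmin \<beta>) n (graph_of n \<omega>)}) \<longlonglongrightarrow> 1"
    using whp_pruning_ok[OF assms] by (elim exE conjE)
  have K: "(if 5/2 \<le> \<beta> then sqrt (real n) else real n powr (1 / ((4 - \<beta>) * (\<beta> - 1)))) = real n powr high_exp \<beta>" for n
    by (simp add: high_exp_def powr_half_sqrt)
  \<comment> \<open>The witness is the whole set on which the claim holds, measurable by
    \<open>graph_event_measurable\<close>.\<close>
  show ?thesis
    unfolding Let_def K
    by (intro exI[of _ C] exI[of _ "\<lambda>n. {\<omega> \<in> space (rplg xmin \<beta> n). pruning_ok C \<beta> (plaw_mean xmin \<beta>) n (graph_of n \<omega>)}"] conjI C lim allI ballI graph_event_measurable)
       (auto simp: pruning_ok_def Let_def cut_threshold_def label_rate_def)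
qed

end
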